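(* Let $(E,A,B,C,D)$ be a descriptor system $E\dot x=Ax+B(u+w)$, $y=Cx+D(u+w)$, with $E,A$ of size $n\times n$, $B$ of size $n\times m$, $C$ of size $m\times n$, $D$ of size $m\times m$, $\det(sE-A)\not\equiv 0$, and transfer function $G(s)=C(sE-A)^{-1}B+D$. Consider the objectives, for $m\times m$ matrices $K,L$ with $I-KD$ non-singular: (1) the pair $(E,\,A+B(I-KD)^{-1}KC)$ is stable, and (2) $L(I-GK)^{-1}G$ is strictly positive real (SPR). There exist matrices $K$ and $L$, with $I-KD$ non-singular, such that (1) and (2) hold if and only if the following conditions hold: (a) $G$ is invertible (as a rational matrix function) and $$G(s)^{-1}=sH_1+D_2+R(s),$$ where $H_1$ and $D_2$ are constant matrices and either (i) $R=0$, or (ii) $R(s)=C_2(sI-A_2)^{-1}B_2$ with $A_2,B_2,C_2$ constant matrices and $A_2$ Hurwitz; (b) the uncontrollable eigenvalues and the unobservable eigenvalues of the system $(E,A,B,C,D)$ have negative real part. Moreover, when (a) and (b) hold, matrices $L$ and $K$ achieving (1) and (2) are obtained as follows: $L$ is any invertible matrix such that $L'H_1$ is symmetric positive semi-definite, and $$K=D_2-L^{-\prime}N,$$ where $N$ is any matrix, with $I-KD$ non-singular, that satisfies: in case (i) ($R=0$): $N+N'>0$; in case (ii) ($R(s)=C_2(sI-A_2)^{-1}B_2$): $N+N'>(PB_2-C_2'L)'Q^{-1}(PB_2-C_2'L)$, where $Q$ is any symmetric positive-definite matrix and $P$ is the unique solution to $PA_2+A_2'P+Q=0$.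
   Context: Fix $\mathbb{F}\in\{\mathbb{R},\mathbb{C}\}$; all constant matrices have entries in $\mathbb{F}$. $M'$ denotes the conjugate transpose of $M$ and $M^{-\prime}=(M^{-1})'$; "symmetric" means $M=M'$ (Hermitian in the complex case). For symmetric matrices, $M>N$ means that $M-N$ is positive definite. A square matrix is Hurwitz if all its eigenvalues have negative real part. Eigenvalues and stability of a pair: a number $\lambda\in\mathbb{C}$ is an eigenvalue of a pair $(E,F)$ of square matrices of the same size if there is a non-zero (complex) vector $v$ with $(\lambda E-F)v=0$. The pair $(E,F)$ is stable if every eigenvalue of $(E,F)$ has negative real part. Poles: $\lambda\in\mathbb{C}$ is a pole of a rational matrix function $H$ if $\lim_{s\to\lambda}H(s)$ does not exist (as a finite matrix). SPR: a square rational matrix function $H$ is strictly positive real if there is $\epsilon>0$ such that $H(s)+H(s)'>0$ for every $s\in\mathbb{C}$ with $\Re(s)\ge-\epsilon$ that is not a pole of $H$. The statement that $L(I-GK)^{-1}G$ is SPR includes that $I-GK$ is invertible as a rational matrix function. Uncontrollable/unobservable eigenvalues: $\lambda\in\mathbb{C}$ is an uncontrollable eigenvalue of the system if $\begin{bmatrix}\lambda E-A & B\end{bmatrix}$ does not have maximum rank (rank $n$); it is an unobservable eigenvalue if $\begin{bmatrix}\lambda E-A\\ C\end{bmatrix}$ does not have maximum rank (rank $n$). *)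

theory Defs
  imports
    Complex_Main
    "HOL-Computational_Algebra.Normalized_Fraction"
    "HOL-Computational_Algebra.Field_as_Ring"
    "Jordan_Normal_Form.Schur_Decomposition"
    "Jordan_Normal_Form.Gauss_Jordan_Elimination"
    "Jordan_Normal_Form.DL_Rank"
begin

text \<open>All matrices are complex; the base field enters as a set \<open>F\<close> of scalars, either
  \<open>\<real>\<close> or \<open>UNIV\<close>. For matrices with real entries, \<^const>\<open>mat_adjoint\<close> is the transpose.\<close>

definition mats :: "'a set \<Rightarrow> nat \<Rightarrow> nat \<Rightarrow> 'a mat set" where
  "mats F r c = {M \<in> carrier_mat r c. elements_mat M \<subseteq> F}"

text \<open>Meaningful only for invertible \<open>M\<close>.\<close>

definition minv :: "'a :: field mat \<Rightarrow> 'a mat" where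
  "minv M = the (mat_inverse M)"

text \<open>\<open>(M *\<^sub>v v) \<bullet>c v\<close> is $v'Mv$, which is real for Hermitian \<open>M\<close>. For a real symmetric \<open>M\<close> it
  does not matter whether the test vectors are real or complex.\<close>

definition pos_def :: "complex mat \<Rightarrow> bool" where
  "pos_def M \<longleftrightarrow> square_mat M \<and> mat_adjoint M = M \<and>
     (\<forall>v \<in> carrier_vec (dim_row M). v \<noteq> 0\<^sub>v (dim_row M) \<longrightarrow> Re ((M *\<^sub>v v) \<bullet>c v) > 0)"

definition pos_semidef :: "complex mat \<Rightarrow> bool" where
  "pos_semidef M \<longleftrightarrow> square_mat M \<and> mat_adjoint M = M \<and>
     (\<forall>v \<in> carrier_vec (dim_row M). Re ((M *\<^sub>v v) \<bullet>c v) \<ge> 0)"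

definition hurwitz :: "complex mat \<Rightarrow> bool" where
  "hurwitz M \<longleftrightarrow> (\<forall>ev. eigenvalue M ev \<longrightarrow> Re ev < 0)"

definition pair_eigenvalue :: "complex mat \<Rightarrow> complex mat \<Rightarrow> complex \<Rightarrow> bool" where
  "pair_eigenvalue E M ev \<longleftrightarrow>
     (\<exists>v \<in> carrier_vec (dim_row E). v \<noteq> 0\<^sub>v (dim_row E) \<and>
        (ev \<cdot>\<^sub>m E - M) *\<^sub>v v = 0\<^sub>v (dim_row E))"

definition stable_pair :: "complex mat \<Rightarrow> complex mat \<Rightarrow> bool" where
  "stable_pair E M \<longleftrightarrow> (\<forall>ev. pair_eigenvalue E M ev \<longrightarrow> Re ev < 0)"

text \<open>The block matrix with two empty lower blocks is $[\lambda E - A \;\; B]$.\<close>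

definition uncontrollable_ev ::
    "nat \<Rightarrow> nat \<Rightarrow> complex mat \<Rightarrow> complex mat \<Rightarrow> complex mat \<Rightarrow> complex \<Rightarrow> bool" where
  "uncontrollable_ev n m E A B ev \<longleftrightarrow>
     vec_space.rank n (four_block_mat (ev \<cdot>\<^sub>m E - A) B (0\<^sub>m 0 n) (0\<^sub>m 0 m)) \<noteq> n"

definition unobservable_ev ::
    "nat \<Rightarrow> nat \<Rightarrow> complex mat \<Rightarrow> complex mat \<Rightarrow> complex mat \<Rightarrow> complex \<Rightarrow> bool" where
  "unobservable_ev n m E A C ev \<longleftrightarrow>
     vec_space.rank (n + m) ((ev \<cdot>\<^sub>m E - A) @\<^sub>r C) \<noteq> n"

text \<open>Rational matrix functions are matrices over the field of fractions of the polynomial ring,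
  so that their products, inverses and invertibility are the algebraic ones.\<close>

type_synonym ratmat = "complex poly fract mat"

definition const_rm :: "complex mat \<Rightarrow> ratmat" where
  "const_rm M = map_mat (\<lambda>c. to_fract [:c:]) M"

definition s_rm :: "complex poly fract" where
  "s_rm = to_fract [:0, 1:]"

definition transfer_fn ::
    "complex mat \<Rightarrow> complex mat \<Rightarrow> complex mat \<Rightarrow> complex mat \<Rightarrow> complex mat \<Rightarrow> ratmat" where
  "transfer_fn E A B C D =
     const_rm C * minv (s_rm \<cdot>\<^sub>m const_rm E - const_rm A) * const_rm B + const_rm D"

definition strictly_proper_rm :: "complex mat \<Rightarrow> complex mat \<Rightarrow> complex mat \<Rightarrow> ratmat" where
  "strictly_proper_rm A2 B2 C2 =
     const_rm C2 * minv (s_rm \<cdot>\<^sub>m 1\<^sub>m (dim_row A2) - const_rm A2) * const_rm B2"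

text \<open>Since \<^const>\<open>quot_of_fract\<close> yields the fraction in lowest terms, this is the value of the
  rational function wherever it is finite, removable singularities included.\<close>

definition eval_rf :: "complex poly fract \<Rightarrow> complex \<Rightarrow> complex" where
  "eval_rf f z = poly (fst (quot_of_fract f)) z / poly (snd (quot_of_fract f)) z"

definition eval_rm :: "ratmat \<Rightarrow> complex \<Rightarrow> complex mat" where
  "eval_rm H z = map_mat (\<lambda>f. eval_rf f z) H"

definition pole_rm :: "ratmat \<Rightarrow> complex \<Rightarrow> bool" where
  "pole_rm H z \<longleftrightarrow>
     \<not> (\<exists>X \<in> carrier_mat (dim_row H) (dim_col H). \<forall>i < dim_row H. \<forall>j < dim_col H.
          ((\<lambda>s. eval_rm H s $$ (i, j)) \<longlongrightarrow> X $$ (i, j)) (at z))"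

definition strictly_positive_real :: "ratmat \<Rightarrow> bool" where
  "strictly_positive_real H \<longleftrightarrow> square_mat H \<and>
     (\<exists>\<epsilon>>0. \<forall>s. Re s \<ge> - \<epsilon> \<and> \<not> pole_rm H s \<longrightarrow>
        pos_def (eval_rm H s + mat_adjoint (eval_rm H s)))"

definition stability_objective ::
    "complex mat \<Rightarrow> complex mat \<Rightarrow> complex mat \<Rightarrow> complex mat \<Rightarrow> complex mat \<Rightarrow>
     complex mat \<Rightarrow> bool" where
  "stability_objective E A B C D K \<longleftrightarrow>
     stable_pair E (A + B * minv (1\<^sub>m (dim_row K) - K * D) * K * C)"

definition spr_objective :: "ratmat \<Rightarrow> complex mat \<Rightarrow> complex mat \<Rightarrow> bool" where
  "spr_objective G K L \<longleftrightarrow>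
     invertible_mat (1\<^sub>m (dim_row G) - G * const_rm K) \<and>
     strictly_positive_real
       (const_rm L * minv (1\<^sub>m (dim_row G) - G * const_rm K) * G)"

definition achieves ::
    "complex mat \<Rightarrow> complex mat \<Rightarrow> complex mat \<Rightarrow> complex mat \<Rightarrow> complex mat \<Rightarrow>
     complex mat \<Rightarrow> complex mat \<Rightarrow> bool" where
  "achieves E A B C D K L \<longleftrightarrow>
     stability_objective E A B C D K \<and> spr_objective (transfer_fn E A B C D) K L"

definition inverse_condition :: "complex set \<Rightarrow> nat \<Rightarrow> ratmat \<Rightarrow> bool" where
  "inverse_condition F m G \<longleftrightarrow>
     invertible_mat G \<and>
     (\<exists>H1 \<in> mats F m m. \<exists>D2 \<in> mats F m m. \<exists>R \<in> carrier_mat m m.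
        minv G = s_rm \<cdot>\<^sub>m const_rm H1 + const_rm D2 + R \<and>
        (R = 0\<^sub>m m m \<or>
         (\<exists>k. \<exists>A2 \<in> mats F k k. \<exists>B2 \<in> mats F k m. \<exists>C2 \<in> mats F m k.
            hurwitz A2 \<and> R = strictly_proper_rm A2 B2 C2)))"

definition hidden_modes_condition ::
    "nat \<Rightarrow> nat \<Rightarrow> complex mat \<Rightarrow> complex mat \<Rightarrow> complex mat \<Rightarrow> complex mat \<Rightarrow> bool" where
  "hidden_modes_condition n m E A B C \<longleftrightarrow>
     (\<forall>ev. uncontrollable_ev n m E A B ev \<or> unobservable_ev n m E A C ev \<longrightarrow> Re ev < 0)"

definition admissible_L :: "complex set \<Rightarrow> nat \<Rightarrow> complex mat \<Rightarrow> complex mat \<Rightarrow> bool" where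
  "admissible_L F m H1 L \<longleftrightarrow>
     L \<in> mats F m m \<and> invertible_mat L \<and> pos_semidef (mat_adjoint L * H1)"

definition gain :: "complex mat \<Rightarrow> complex mat \<Rightarrow> complex mat \<Rightarrow> complex mat" where
  "gain D2 L N = D2 - mat_adjoint (minv L) * N"

text \<open>\<open>W\<close> is the lower bound that $N + N'$ has to exceed.\<close>

definition admissible_N ::
    "complex set \<Rightarrow> nat \<Rightarrow> complex mat \<Rightarrow> complex mat \<Rightarrow> complex mat \<Rightarrow> complex mat \<Rightarrow>
     complex mat \<Rightarrow> bool" where
  "admissible_N F m D D2 L W N \<longleftrightarrow>
     N \<in> mats F m m \<and> invertible_mat (1\<^sub>m m - gain D2 L N * D) \<and>
     pos_def (N + mat_adjoint N - W)"

definition lyapunov_solution ::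
    "complex set \<Rightarrow> nat \<Rightarrow> complex mat \<Rightarrow> complex mat \<Rightarrow> complex mat \<Rightarrow> bool" where
  "lyapunov_solution F k A2 Q P \<longleftrightarrow>
     P \<in> mats F k k \<and> P * A2 + mat_adjoint A2 * P + Q = 0\<^sub>m k k"

definition riccati_bound ::
    "complex mat \<Rightarrow> complex mat \<Rightarrow> complex mat \<Rightarrow> complex mat \<Rightarrow> complex mat \<Rightarrow> complex mat" where
  "riccati_bound B2 C2 L P Q =
     mat_adjoint (P * B2 - mat_adjoint C2 * L) * minv Q * (P * B2 - mat_adjoint C2 * L)"

end

theory Submission
  imports Defs "Jordan_Normal_Form.Spectral_Radius"
begin

text \<open>Write \<open>Z = G\<^sup>-\<^sup>1\<close>. Since \<open>L(I - GK)\<^sup>-\<^sup>1G = L(Z - K)\<^sup>-\<^sup>1\<close>, the closed loop is governed by \<open>Z - K\<close>.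

  Sufficiency: for the given gain, \<open>L'(Z - K) = sL'H\<^sub>1 + L'R + N\<close>, and completing the square in the
  Lyapunov equation shows that its Hermitian part is positive definite on a half plane
  \<open>Re s \<ge> -\<epsilon>\<close>; positivity passes to the inverse by congruence. For stability, the absence of
  uncontrollable modes in \<open>Re s \<ge> 0\<close> makes \<open>ZC(sE - A)\<^sup>-\<^sup>1\<close> regular there, so that a closed-loop mode
  with input \<open>u = Ky\<close> also satisfies \<open>Z(s)y = u\<close>. As \<open>Z(s) - K\<close> is non-singular, \<open>y = 0\<close>, and the mode is
  unobservable.

  Necessity: stability makes \<open>(I - GK)\<^sup>-\<^sup>1G\<close> regular in \<open>Re s \<ge> 0\<close>, and positivity makes it invertible
  there. Hence \<open>Z\<close> has no pole in \<open>Re s \<ge> 0\<close>, and \<open>(Z - K)L\<^sup>-\<^sup>1\<close> is positive real, so the polynomial part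
  of \<open>Z\<close> has degree at most one. The strictly proper part is realized by a block companion matrix.\<close>

section \<open>Matrix algebra\<close>

text \<open>Sufficiency needs one margin \<open>e\<close> for the whole half plane
  \<open>Re s >= -e\<close>, although the state \<open>(s - A2)^-1 B2 w\<close> varies over an
  unbounded range of \<open>s\<close>. The completed square is therefore kept as a term that is
  coercive in the distance of the state from its minimizer \<open>Q^-1 X w\<close>, where
  \<open>X = P B2 - C2' L\<close>; it pays for the loss \<open>2 Re s * z'Pz\<close> to the left of
  the axis. The Lyapunov solution itself is a convergent matrix series, reached by a Cayley
  transform. In the stability proof a point of the closed right half plane may be an eigenvalue of
  \<open>(E,A)\<close>, where \<open>G\<close> need not have a value; only polynomial identities
  between regular functions can be evaluated there. The real case is obtained by descent: the
  Lyapunov solution, the reduced fraction and the quotient with remainder are each unique, hence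
  fixed by complex conjugation. The matrix \<open>L\<close> is built from \<open>H1\<close> by
  rank-one additions, because these use only kernel vectors, which exist over the base
  field.\<close>

text \<open>The library states these laws with carrier premises; with premises on dimensions they can be
  used as rewrite rules.\<close>

lemma mult_assoc_dims:
  fixes A :: "'a :: semiring_0 mat"
  assumes "dim_col A = dim_row B" "dim_col B = dim_row C"
  shows "A * B * C = A * (B * C)"
  using assms by (intro assoc_mult_mat[of _ "dim_row A" "dim_col A" _ "dim_col B" _ "dim_col C"]) auto

lemma mult_vec_assoc_dims:
  fixes A :: "'a :: semiring_0 mat"
  assumes "dim_col A = dim_row B" "dim_col B = dim_vec v"
  shows "A * B *\<^sub>v v = A *\<^sub>v (B *\<^sub>v v)"
  using assms by (intro assoc_mult_mat_vec[of _ "dim_row A" "dim_col A" _ "dim_col B"]) (auto intro: carrier_vecI)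

lemma add_mult_dims:
  fixes A :: "'a :: semiring_0 mat"
  assumes "dim_row A = dim_row B" "dim_col A = dim_col B" "dim_col A = dim_row C"
  shows "(A + B) * C = A * C + B * C"
  using assms by (intro add_mult_distrib_mat[of _ "dim_row A" "dim_col A" _ _ "dim_col C"]) auto

lemma mult_add_dims:
  fixes A :: "'a :: semiring_0 mat"
  assumes "dim_row B = dim_row C" "dim_col B = dim_col C" "dim_col A = dim_row B"
  shows "A * (B + C) = A * B + A * C"
  using assms by (intro mult_add_distrib_mat[of _ "dim_row A" "dim_col A" _ "dim_col C"]) auto

lemma minus_mult_dims:
  fixes A :: "'a :: ring mat"
  assumes "dim_row A = dim_row B" "dim_col A = dim_col B" "dim_col A = dim_row C"
  shows "(A - B) * C = A * C - B * C"
  using assms by (intro minus_mult_distrib_mat[of _ "dim_row A" "dim_col A" _ _ "dim_col C"]) auto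

lemma mult_minus_dims:
  fixes A :: "'a :: ring mat"
  assumes "dim_row B = dim_row C" "dim_col B = dim_col C" "dim_col A = dim_row B"
  shows "A * (B - C) = A * B - A * C"
  using assms by (intro mult_minus_distrib_mat[of _ "dim_row A" "dim_col A" _ "dim_col C"]) auto

lemma add_mult_vec_dims:
  fixes A :: "'a :: semiring_0 mat"
  assumes "dim_row A = dim_row B" "dim_col A = dim_col B" "dim_col A = dim_vec v"
  shows "(A + B) *\<^sub>v v = A *\<^sub>v v + B *\<^sub>v v"
  using assms by (intro add_mult_distrib_mat_vec[of _ "dim_row A" "dim_col A"]) (auto intro: carrier_vecI)

lemma minus_mult_vec_dims:
  fixes A :: "'a :: ring mat"
  assumes "dim_row A = dim_row B" "dim_col A = dim_col B" "dim_col A = dim_vec v"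
  shows "(A - B) *\<^sub>v v = A *\<^sub>v v - B *\<^sub>v v"
  using assms by (intro minus_mult_distrib_mat_vec[of _ "dim_row A" "dim_col A"]) (auto intro: carrier_vecI)

lemma mult_vec_add_dims:
  fixes A :: "'a :: semiring_0 mat"
  assumes "dim_vec v = dim_vec w" "dim_col A = dim_vec v"
  shows "A *\<^sub>v (v + w) = A *\<^sub>v v + A *\<^sub>v w"
  using assms by (intro mult_add_distrib_mat_vec[of _ "dim_row A" "dim_col A"]) (auto intro: carrier_vecI)

lemma mult_vec_minus_dims:
  fixes A :: "'a :: ring mat"
  assumes "dim_vec v = dim_vec w" "dim_col A = dim_vec v"
  shows "A *\<^sub>v (v - w) = A *\<^sub>v v - A *\<^sub>v w"
  using assms by (intro mult_minus_distrib_mat_vec[of _ "dim_row A" "dim_col A"]) (auto intro: carrier_vecI)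

lemma smult_mult_dims:
  fixes A :: "'a :: comm_semiring_0 mat"
  assumes "dim_col A = dim_row B"
  shows "(k \<cdot>\<^sub>m A) * B = k \<cdot>\<^sub>m (A * B)" "A * (k \<cdot>\<^sub>m B) = k \<cdot>\<^sub>m (A * B)"
  using assms by (intro mult_smult_assoc_mat[of _ "dim_row A" "dim_col A" _ "dim_col B"]
      mult_smult_distrib[of _ "dim_row A" "dim_col A" _ "dim_col B"]; auto)+

lemma smult_mult_vec_dims:
  fixes A :: "'a :: comm_semiring_0 mat"
  assumes "dim_col A = dim_vec v"
  shows "(k \<cdot>\<^sub>m A) *\<^sub>v v = k \<cdot>\<^sub>v (A *\<^sub>v v)" "A *\<^sub>v (k \<cdot>\<^sub>v v) = k \<cdot>\<^sub>v (A *\<^sub>v v)"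
  using assms by (auto intro!: eq_vecI simp: scalar_prod_def sum_distrib_left ac_simps)

lemma mult_one_dims:
  fixes A :: "'a :: semiring_1 mat" and v :: "'a vec"
  shows "dim_col A = n \<Longrightarrow> A * 1\<^sub>m n = A" "dim_row A = n \<Longrightarrow> 1\<^sub>m n * A = A"
    "dim_vec v = n \<Longrightarrow> 1\<^sub>m n *\<^sub>v v = v"
  using one_mult_mat_vec[OF carrier_vecI, of v n]
  by (auto intro!: right_mult_one_mat[of _ "dim_row A"] left_mult_one_mat[of _ _ "dim_col A"])

lemmas mat_alg = mult_assoc_dims mult_vec_assoc_dims add_mult_dims mult_add_dims minus_mult_dims
  mult_minus_dims add_mult_vec_dims minus_mult_vec_dims mult_vec_add_dims mult_vec_minus_dims
  smult_mult_dims smult_mult_vec_dims mult_one_dims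

lemma vec_diff_eq_iff:
  fixes u :: "'a :: ring vec"
  assumes "u \<in> carrier_vec n" "v \<in> carrier_vec n" "w \<in> carrier_vec n"
  shows "u - v = w \<longleftrightarrow> u = w + v"
  using assms by (auto simp: vec_eq_iff diff_eq_eq)

section \<open>Inverses, determinants and kernels of square matrices\<close>

lemma invertible_mat_iff_det:
  fixes A :: "'a :: field mat"
  assumes A: "A \<in> carrier_mat n n"
  shows "invertible_mat A \<longleftrightarrow> det A \<noteq> 0"
proof
  assume "invertible_mat A"
  then obtain B where B: "A * B = 1\<^sub>m n" "B * A = 1\<^sub>m (dim_row B)"
    using A by (auto simp: invertible_mat_def inverts_mat_def)
  have "dim_col B = n" using arg_cong[OF B(1), of dim_col] by simp
  moreover have "dim_row B = n" using arg_cong[OF B(2), of dim_col] A by simp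
  ultimately have "det A * det B = 1"
    using arg_cong[OF B(1), of det] det_mult[OF A, of B] by auto
  thus "det A \<noteq> 0" by auto
next
  assume "det A \<noteq> 0"
  from det_non_zero_imp_unit[OF A this] A show "invertible_mat A"
    by (auto simp: Units_def ring_mat_def invertible_mat_def inverts_mat_def)
qed

lemma minv:
  fixes A :: "'a :: field mat"
  assumes A: "A \<in> carrier_mat n n" and "det A \<noteq> 0"
  shows "minv A \<in> carrier_mat n n" "A * minv A = 1\<^sub>m n" "minv A * A = 1\<^sub>m n"
proof -
  have "A \<in> Units (ring_mat TYPE('a) n ())" using assms by (rule det_non_zero_imp_unit)
  then obtain B where "mat_inverse A = Some B"
    using mat_inverse(1)[OF A, of "()"] by (cases "mat_inverse A") auto
  with mat_inverse(2)[OF A this]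
  show "minv A \<in> carrier_mat n n" "A * minv A = 1\<^sub>m n" "minv A * A = 1\<^sub>m n"
    by (auto simp: minv_def)
qed

lemma right_inverse_det_nonzero:
  fixes A :: "'a :: field mat"
  assumes "A \<in> carrier_mat n n" "B \<in> carrier_mat n n" "A * B = 1\<^sub>m n"
  shows "det A \<noteq> 0" "det B \<noteq> 0"
  using arg_cong[OF assms(3), of det] det_mult[OF assms(1,2)] by auto

lemma minv_unique:
  fixes A :: "'a :: field mat"
  assumes A: "A \<in> carrier_mat n n" and B: "B \<in> carrier_mat n n" and AB: "A * B = 1\<^sub>m n"
  shows "minv A = B"
proof -
  note m = minv[OF A right_inverse_det_nonzero(1)[OF assms]]
  have "minv A = minv A * (A * B)" using m A B by (simp add: AB)
  also have "\<dots> = B" using m A B by (simp flip: mult_assoc_dims)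
  finally show ?thesis .
qed

lemma minv_mult:
  fixes A :: "'a :: field mat"
  assumes A: "A \<in> carrier_mat n n" "det A \<noteq> 0" and B: "B \<in> carrier_mat n n" "det B \<noteq> 0"
  shows "minv (A * B) = minv B * minv A"
proof (rule minv_unique[of _ n])
  note mA = minv[OF A] and mB = minv[OF B]
  have "A * B * (minv B * minv A) = A * ((B * minv B) * minv A)"
    using mA(1) mB(1) A B by (simp add: mult_assoc_dims del: mB)
  thus "A * B * (minv B * minv A) = 1\<^sub>m n" using mA mB by simp
qed (use minv[OF A] minv[OF B] A B in auto)

lemma minv_minv:
  fixes A :: "'a :: field mat"
  assumes A: "A \<in> carrier_mat n n" "det A \<noteq> 0"
  shows "minv (minv A) = A" "det (minv A) \<noteq> 0"
  using minv[OF A] A by (auto intro!: minv_unique[of _ n] dest: right_inverse_det_nonzero(2))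

lemma det_nonzero_iff_kernel:
  fixes A :: "'a :: field mat"
  assumes A: "A \<in> carrier_mat n n"
  shows "det A \<noteq> 0 \<longleftrightarrow> (\<forall>v \<in> carrier_vec n. A *\<^sub>v v = 0\<^sub>v n \<longrightarrow> v = 0\<^sub>v n)"
  using det_0_iff_vec_prod_zero_field[OF A] by auto

section \<open>Matrices with entries in a subring\<close>

lemma mats_iff: "M \<in> mats S r c \<longleftrightarrow> M \<in> carrier_mat r c \<and> (\<forall>i<r. \<forall>j<c. M $$ (i,j) \<in> S)"
  by (fastforce simp: mats_def dest: elements_matD intro: elements_matI)

lemma mats_carrier: "M \<in> mats S r c \<Longrightarrow> M \<in> carrier_mat r c"
  by (simp add: mats_def)

lemma mats_dim: "M \<in> mats S r c \<Longrightarrow> dim_row M = r" "M \<in> mats S r c \<Longrightarrow> dim_col M = c"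
  by (auto dest: mats_carrier)

text \<open>Instantiated for the base field, the functions regular at a point, the polynomials over
  the base field and the rational functions over it. Each time determinants and adjugates stay
  inside for the same reason. Differences in place of sums and negatives keep the instances
  short.\<close>

locale closed_subring =
  fixes S :: "'a :: comm_ring_1 set"
  assumes one_closed: "1 \<in> S"
    and diff_closed: "x \<in> S \<Longrightarrow> y \<in> S \<Longrightarrow> x - y \<in> S"
    and mult_closed: "x \<in> S \<Longrightarrow> y \<in> S \<Longrightarrow> x * y \<in> S"
begin

lemma zero_closed: "0 \<in> S"
  using diff_closed[OF one_closed one_closed] by simp

lemma uminus_closed: "x \<in> S \<Longrightarrow> - x \<in> S"
  using diff_closed[OF zero_closed] by simp

lemma add_closed: "x \<in> S \<Longrightarrow> y \<in> S \<Longrightarrow> x + y \<in> S"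
  using diff_closed[OF _ uminus_closed] by force

lemma sum_closed: "(\<And>i. i \<in> I \<Longrightarrow> f i \<in> S) \<Longrightarrow> sum f I \<in> S"
  by (induction I rule: infinite_finite_induct) (auto intro: zero_closed add_closed)

lemma prod_closed: "(\<And>i. i \<in> I \<Longrightarrow> f i \<in> S) \<Longrightarrow> prod f I \<in> S"
  by (induction I rule: infinite_finite_induct) (auto intro: one_closed mult_closed)

lemma mats_mult: "A \<in> mats S n k \<Longrightarrow> B \<in> mats S k l \<Longrightarrow> A * B \<in> mats S n l"
  by (auto simp: mats_iff scalar_prod_def intro!: sum_closed mult_closed)

lemma mats_add: "A \<in> mats S n k \<Longrightarrow> B \<in> mats S n k \<Longrightarrow> A + B \<in> mats S n k"
  by (auto simp: mats_iff intro!: add_closed)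

lemma mats_minus: "A \<in> mats S n k \<Longrightarrow> B \<in> mats S n k \<Longrightarrow> A - B \<in> mats S n k"
  by (auto simp: mats_iff minus_mat_def intro!: diff_closed)

lemma mats_smult: "c \<in> S \<Longrightarrow> A \<in> mats S n k \<Longrightarrow> c \<cdot>\<^sub>m A \<in> mats S n k"
  by (auto simp: mats_iff intro!: mult_closed)

lemma mats_one: "1\<^sub>m n \<in> mats S n n"
  by (auto simp: mats_iff intro!: one_closed zero_closed)

lemma det_closed: assumes "A \<in> mats S n n" shows "det A \<in> S"
proof -
  have "of_int (sign p) * (\<Prod>i = 0..<n. A $$ (i, p i)) \<in> S" if "p permutes {0..<n}" for p
  proof (rule mult_closed)
    show "of_int (sign p) \<in> S" by (auto simp: sign_def intro: one_closed uminus_closed)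
    show "(\<Prod>i = 0..<n. A $$ (i, p i)) \<in> S"
      using assms permutes_in_image[OF that] by (intro prod_closed) (auto simp: mats_iff)
  qed
  thus ?thesis using assms by (auto simp: det_def mats_dim intro!: sum_closed)
qed

lemma adj_mat_closed: assumes "A \<in> mats S n n" shows "adj_mat A \<in> mats S n n"
proof -
  have "cofactor A i j \<in> S" if "i < n" "j < n" for i j
  proof -
    have "mat_delete A i j \<in> mats S (n - 1) (n - 1)"
      using assms by (auto simp: mats_iff mat_delete_def)
    moreover have "(- 1) ^ k \<in> S" for k :: nat
      by (induction k) (auto intro: one_closed uminus_closed)
    ultimately show ?thesis by (auto simp: cofactor_def intro: mult_closed det_closed)
  qed
  thus ?thesis using assms by (auto simp: mats_iff adj_mat_def)
qed

end

text \<open>Cramer's rule: the adjugate is polynomial in the entries, so the reciprocal of the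
  determinant is the only division, and membership of an inverse in a subring reduces to that one
  element.\<close>

lemma minv_eq_adj_mat:
  fixes A :: "'a :: field mat"
  assumes A: "A \<in> carrier_mat n n" and d: "det A \<noteq> 0"
  shows "minv A = inverse (det A) \<cdot>\<^sub>m adj_mat A"
  by (rule minv_unique[OF A]) (use adj_mat[OF A] A d in \<open>auto simp: smult_mult_dims intro!: eq_matI\<close>)

lemma mats_minv:
  fixes A :: "'a :: field mat"
  assumes "closed_subring S" and A: "A \<in> mats S n n" and d: "det A \<noteq> 0"
    and i: "inverse (det A) \<in> S"
  shows "minv A \<in> mats S n n"
proof -
  interpret closed_subring S by fact
  show ?thesis
    using mats_smult[OF i adj_mat_closed[OF A]] minv_eq_adj_mat[OF mats_carrier[OF A] d] by simp
qed

section \<open>Adjoints and Hermitian forms\<close>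

lemma index_mat_adjoint [simp]:
  "i < dim_col A \<Longrightarrow> j < dim_row A \<Longrightarrow> mat_adjoint A $$ (i,j) = conjugate (A $$ (j,i))"
  by (simp add: mat_adjoint_def mat_of_rows_index)

lemma dim_mat_adjoint [simp]: "dim_row (mat_adjoint A) = dim_col A" "dim_col (mat_adjoint A) = dim_row A"
  by (simp_all add: mat_adjoint_def)

lemma mat_adjoint_carrier [simp]: "A \<in> carrier_mat r c \<Longrightarrow> mat_adjoint A \<in> carrier_mat c r"
  by auto

lemma mat_adjoint_adjoint [simp]: "mat_adjoint (mat_adjoint A) = A"
  by (rule eq_matI) auto

lemma mat_adjoint_mult:
  "dim_col A = dim_row B \<Longrightarrow> mat_adjoint (A * B) = mat_adjoint B * mat_adjoint (A :: complex mat)"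
  by (rule eq_matI) (auto simp: scalar_prod_def mult.commute)

lemma mat_adjoint_add:
  "dim_row A = dim_row B \<Longrightarrow> dim_col A = dim_col B \<Longrightarrow>
    mat_adjoint (A + B) = mat_adjoint A + mat_adjoint (B :: complex mat)"
  by (rule eq_matI) auto

lemma mat_adjoint_minus:
  "dim_row A = dim_row B \<Longrightarrow> dim_col A = dim_col B \<Longrightarrow>
    mat_adjoint (A - B) = mat_adjoint A - mat_adjoint (B :: complex mat)"
  by (rule eq_matI) auto

lemma mat_adjoint_smult: "mat_adjoint (c \<cdot>\<^sub>m A) = cnj c \<cdot>\<^sub>m mat_adjoint (A :: complex mat)"
  by (rule eq_matI) auto

lemma mat_adjoint_one: "mat_adjoint (1\<^sub>m n) = (1\<^sub>m n :: complex mat)"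
  by (rule eq_matI) auto

lemma mat_adjoint_zero: "mat_adjoint (0\<^sub>m n k) = (0\<^sub>m k n :: complex mat)"
  by (rule eq_matI) auto

lemmas mat_adjoint_simps = mat_adjoint_mult mat_adjoint_add mat_adjoint_minus mat_adjoint_smult
  mat_adjoint_one mat_adjoint_zero

lemma mat_adjoint_minv:
  fixes A :: "complex mat"
  assumes A: "A \<in> carrier_mat n n" and d: "det A \<noteq> 0"
  shows "mat_adjoint (minv A) = minv (mat_adjoint A)"
  using minv[OF A d] A
  by (intro minv_unique[of _ n, symmetric]) (auto simp flip: mat_adjoint_mult simp: mat_adjoint_one)

lemma det_mat_adjoint_nonzero:
  fixes A :: "complex mat"
  assumes A: "A \<in> carrier_mat n n" and d: "det A \<noteq> 0"
  shows "det (mat_adjoint A) \<noteq> 0"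
  by (rule right_inverse_det_nonzero(1)[of _ n "mat_adjoint (minv A)"])
    (use minv[OF A d] A in \<open>auto simp flip: mat_adjoint_mult simp: mat_adjoint_one\<close>)

lemma inner_sum: "dim_vec v = dim_vec w \<Longrightarrow> v \<bullet>c w = (\<Sum>i<dim_vec w. v $ i * cnj (w $ i))"
  by (simp add: scalar_prod_def atLeast0LessThan)

lemma inner_mat_adjoint:
  fixes A :: "complex mat"
  assumes "dim_col A = dim_vec v" "dim_row A = dim_vec w"
  shows "(A *\<^sub>v v) \<bullet>c w = v \<bullet>c (mat_adjoint A *\<^sub>v w)"
proof -
  have "(A *\<^sub>v v) \<bullet>c w = (\<Sum>i<dim_vec w. \<Sum>j<dim_vec v. A $$ (i,j) * v $ j * cnj (w $ i))"
    using assms by (simp add: inner_sum scalar_prod_def sum_distrib_right atLeast0LessThan)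
  also have "\<dots> = (\<Sum>j<dim_vec v. \<Sum>i<dim_vec w. A $$ (i,j) * v $ j * cnj (w $ i))"
    by (rule sum.swap)
  also have "\<dots> = v \<bullet>c (mat_adjoint A *\<^sub>v w)"
    using assms by (simp add: inner_sum scalar_prod_def sum_distrib_left atLeast0LessThan ac_simps)
  finally show ?thesis .
qed

lemma inner_cnj: "dim_vec v = dim_vec w \<Longrightarrow> cnj (v \<bullet>c w) = w \<bullet>c v"
  by (simp add: inner_sum mult.commute)

lemma inner_add:
  fixes u v w :: "complex vec"
  assumes "dim_vec u = dim_vec w" "dim_vec v = dim_vec w"
  shows "(u + v) \<bullet>c w = u \<bullet>c w + v \<bullet>c w" "w \<bullet>c (u + v) = w \<bullet>c u + w \<bullet>c v"
    "(u - v) \<bullet>c w = u \<bullet>c w - v \<bullet>c w" "w \<bullet>c (u - v) = w \<bullet>c u - w \<bullet>c v"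
  using assms by (simp_all add: inner_sum sum.distrib sum_subtractf algebra_simps)

lemma inner_smult:
  fixes v w :: "complex vec"
  assumes "dim_vec v = dim_vec w"
  shows "(c \<cdot>\<^sub>v v) \<bullet>c w = c * (v \<bullet>c w)" "w \<bullet>c (c \<cdot>\<^sub>v v) = cnj c * (w \<bullet>c v)"
  using assms by (simp_all add: inner_sum sum_distrib_left ac_simps)

lemma inner_zero [simp]: "v \<bullet>c 0\<^sub>v (dim_vec v) = (0::complex)"
  "0\<^sub>v (dim_vec v) \<bullet>c v = (0::complex)"
  by (auto simp: inner_sum)

definition sqnorm :: "complex vec \<Rightarrow> real" where
  "sqnorm v = (\<Sum>i<dim_vec v. (cmod (v $ i))\<^sup>2)"

lemma inner_self: "v \<bullet>c v = complex_of_real (sqnorm v)"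
  by (simp add: inner_sum sqnorm_def flip: complex_norm_square)

lemma sqnorm_nonneg: "sqnorm v \<ge> 0"
  by (simp add: sqnorm_def sum_nonneg)

lemma sqnorm_eq_0_iff: "sqnorm v = 0 \<longleftrightarrow> v = 0\<^sub>v (dim_vec v)"
  by (auto simp: sqnorm_def sum_nonneg_eq_0_iff vec_eq_iff)

lemma sqnorm_pos: "v \<noteq> 0\<^sub>v (dim_vec v) \<Longrightarrow> sqnorm v > 0"
  using sqnorm_nonneg sqnorm_eq_0_iff by (metis order_le_less)

lemma sqnorm_entry: "i < dim_vec v \<Longrightarrow> (cmod (v $ i))\<^sup>2 \<le> sqnorm v"
  unfolding sqnorm_def by (rule member_le_sum) auto

section \<open>Evaluation of rational matrix functions\<close>

text \<open>The local ring of the rational functions at \<open>z\<close>, on which evaluation is a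
  ring homomorphism. Reading it off the reduced fraction makes removable singularities
  regular.\<close>

definition regular_at :: "complex \<Rightarrow> complex poly fract set" where
  "regular_at z = {f. poly (snd (quot_of_fract f)) z \<noteq> 0}"

lemma fract_eq_quot: "f = to_fract (fst (quot_of_fract f)) / to_fract (snd (quot_of_fract f))"
  by (metis Fract_conv_to_fract Fract_quot_of_fract)

text \<open>Any fraction whose denominator is non-zero at \<open>z\<close> may be used for
  evaluation, reduced or not. Cross-multiplying with the reduced fraction \<open>a / b\<close>, a
  root of \<open>b\<close> at \<open>z\<close> would also be a root of \<open>a\<close>, against
  coprimality.\<close>

lemma regular_at_quotient:
  assumes f: "f = to_fract p / to_fract q" and q: "poly q z \<noteq> 0"
  shows "f \<in> regular_at z" "eval_rf f z = poly p z / poly q z"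
proof -
  define a b where "a = fst (quot_of_fract f)" and "b = snd (quot_of_fract f)"
  have b0: "b \<noteq> 0" and cop: "coprime a b" by (simp_all add: a_def b_def coprime_quot_of_fract)
  from q have q0: "q \<noteq> 0" by auto
  have "to_fract a / to_fract b = to_fract p / to_fract q"
    using f fract_eq_quot[of f] by (simp add: a_def b_def)
  hence "to_fract (a * q) = to_fract (p * b)"
    using b0 q0 by (simp add: frac_eq_eq to_fract_mult)
  hence e: "a * q = p * b" by (simp only: to_fract_eq_iff)
  hence e': "poly a z * poly q z = poly p z * poly b z" by (metis poly_mult)
  have "poly b z \<noteq> 0"
  proof
    assume bz: "poly b z = 0"
    with e' q have "poly a z = 0" by simp
    with bz have "[:- z, 1:] dvd a" "[:- z, 1:] dvd b" by (auto simp: poly_eq_0_iff_dvd)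
    with cop have "is_unit [:- z, 1:]" by (rule coprime_common_divisor)
    thus False by (auto simp: is_unit_iff_degree)
  qed
  thus "f \<in> regular_at z" "eval_rf f z = poly p z / poly q z"
    using e' q by (auto simp: regular_at_def eval_rf_def a_def b_def field_simps)
qed

lemma regular_at_quotientE:
  assumes "f \<in> regular_at z"
  obtains p q where "f = to_fract p / to_fract q" "poly q z \<noteq> 0" "eval_rf f z = poly p z / poly q z"
  using assms fract_eq_quot[of f] by (auto simp: regular_at_def eval_rf_def)

lemma regular_at_minus:
  assumes "f \<in> regular_at z" "g \<in> regular_at z"
  shows "f - g \<in> regular_at z" "eval_rf (f - g) z = eval_rf f z - eval_rf g z"
proof -
  obtain p q p' q' where pq: "f = to_fract p / to_fract q" "poly q z \<noteq> 0" "eval_rf f z = poly p z / poly q z"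
    "g = to_fract p' / to_fract q'" "poly q' z \<noteq> 0" "eval_rf g z = poly p' z / poly q' z"
    using assms by (metis regular_at_quotientE)
  from pq have "q \<noteq> 0" "q' \<noteq> 0" by auto
  hence "f - g = to_fract (p * q' - p' * q) / to_fract (q * q')"
    by (simp add: pq to_fract_mult to_fract_diff diff_frac_eq)
  from regular_at_quotient[OF this, of z] pq
  show "f - g \<in> regular_at z" "eval_rf (f - g) z = eval_rf f z - eval_rf g z"
    by (auto simp: diff_frac_eq)
qed

lemma regular_at_mult:
  assumes "f \<in> regular_at z" "g \<in> regular_at z"
  shows "f * g \<in> regular_at z" "eval_rf (f * g) z = eval_rf f z * eval_rf g z"
proof -
  obtain p q p' q' where pq: "f = to_fract p / to_fract q" "poly q z \<noteq> 0" "eval_rf f z = poly p z / poly q z"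
    "g = to_fract p' / to_fract q'" "poly q' z \<noteq> 0" "eval_rf g z = poly p' z / poly q' z"
    using assms by (metis regular_at_quotientE)
  have "f * g = to_fract (p * p') / to_fract (q * q')"
    by (simp add: pq to_fract_mult)
  from regular_at_quotient[OF this, of z] pq
  show "f * g \<in> regular_at z" "eval_rf (f * g) z = eval_rf f z * eval_rf g z"
    by auto
qed

lemma regular_at_to_fract: "to_fract p \<in> regular_at z" "eval_rf (to_fract p) z = poly p z"
  using regular_at_quotient[of "to_fract p" p 1 z] by simp_all

lemma regular_at_0: "0 \<in> regular_at z" "eval_rf 0 z = 0"
  using regular_at_to_fract[of 0 z] by simp_all

lemma regular_at_1: "1 \<in> regular_at z" "eval_rf 1 z = 1"
  using regular_at_to_fract[of 1 z] by simp_all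

interpretation regular_at: closed_subring "regular_at z"
  by standard (auto simp: regular_at_1 regular_at_mult regular_at_minus)

lemma eval_rf_add:
  assumes "f \<in> regular_at z" "g \<in> regular_at z"
  shows "eval_rf (f + g) z = eval_rf f z + eval_rf g z"
proof -
  have "f + g = f - (0 - g)" by simp
  thus ?thesis using assms by (simp only: regular_at_minus regular_at_0) simp
qed

lemma eval_rf_uminus:
  assumes "f \<in> regular_at z"
  shows "eval_rf (- f) z = - eval_rf f z"
proof -
  have "- f = 0 - f" by simp
  thus ?thesis using assms by (simp only: regular_at_minus regular_at_0) simp
qed

lemma eval_rf_sum:
  "(\<And>i. i \<in> I \<Longrightarrow> f i \<in> regular_at z) \<Longrightarrow> eval_rf (sum f I) z = (\<Sum>i\<in>I. eval_rf (f i) z)"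
  by (induction I rule: infinite_finite_induct)
    (auto simp: regular_at_0 eval_rf_add regular_at.sum_closed)

lemma eval_rf_prod:
  "(\<And>i. i \<in> I \<Longrightarrow> f i \<in> regular_at z) \<Longrightarrow> eval_rf (prod f I) z = (\<Prod>i\<in>I. eval_rf (f i) z)"
  by (induction I rule: infinite_finite_induct)
    (auto simp: regular_at_1 regular_at_mult regular_at.prod_closed)

lemma regular_at_inverse:
  assumes "f \<in> regular_at z" "eval_rf f z \<noteq> 0"
  shows "inverse f \<in> regular_at z"
proof -
  obtain p q where pq: "f = to_fract p / to_fract q" "poly q z \<noteq> 0" "eval_rf f z = poly p z / poly q z"
    using assms by (metis regular_at_quotientE)
  from pq have "inverse f = to_fract q / to_fract p" by simp
  from regular_at_quotient(1)[OF this, of z] pq assms show ?thesis by auto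
qed

section \<open>Evaluation of matrices entry by entry\<close>

lemma eval_rm_carrier [simp]: "H \<in> carrier_mat r c \<Longrightarrow> eval_rm H z \<in> carrier_mat r c"
  by (simp add: eval_rm_def)

lemma eval_rm_dim [simp]: "dim_row (eval_rm H z) = dim_row H" "dim_col (eval_rm H z) = dim_col H"
  by (simp_all add: eval_rm_def)

lemma eval_rm_index [simp]: "i < dim_row H \<Longrightarrow> j < dim_col H \<Longrightarrow> eval_rm H z $$ (i,j) = eval_rf (H $$ (i,j)) z"
  by (simp add: eval_rm_def)

lemma eval_rm_mult:
  assumes "H \<in> mats (regular_at z) r k" "K \<in> mats (regular_at z) k c"
  shows "eval_rm (H * K) z = eval_rm H z * eval_rm K z"
  using assms
  by (intro eq_matI) (auto simp: mats_iff scalar_prod_def regular_at_mult intro!: trans[OF eval_rf_sum])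

lemma eval_rm_add:
  assumes "H \<in> mats (regular_at z) r c" "K \<in> mats (regular_at z) r c"
  shows "eval_rm (H + K) z = eval_rm H z + eval_rm K z"
  using assms by (intro eq_matI) (auto simp: mats_iff eval_rf_add)

lemma eval_rm_minus:
  assumes "H \<in> mats (regular_at z) r c" "K \<in> mats (regular_at z) r c"
  shows "eval_rm (H - K) z = eval_rm H z - eval_rm K z"
  using assms by (intro eq_matI) (auto simp: mats_iff regular_at_minus)

lemma eval_rm_smult:
  assumes "f \<in> regular_at z" "H \<in> mats (regular_at z) r c"
  shows "eval_rm (f \<cdot>\<^sub>m H) z = eval_rf f z \<cdot>\<^sub>m eval_rm H z"
  using assms by (intro eq_matI) (auto simp: mats_iff regular_at_mult)

lemma eval_rm_one: "eval_rm (1\<^sub>m n) z = 1\<^sub>m n"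
  by (rule eq_matI) (auto simp: regular_at_1 regular_at_0)

lemma const_rm_dim [simp]: "dim_row (const_rm M) = dim_row M" "dim_col (const_rm M) = dim_col M"
  by (simp_all add: const_rm_def)

lemma const_rm_carrier [simp]: "const_rm M \<in> carrier_mat r c \<longleftrightarrow> M \<in> carrier_mat r c"
  by (auto simp: const_rm_def)

lemma const_rm_index [simp]: "i < dim_row M \<Longrightarrow> j < dim_col M \<Longrightarrow> const_rm M $$ (i,j) = to_fract [:M $$ (i,j):]"
  by (simp add: const_rm_def)

lemma eval_const_rm [simp]: "eval_rm (const_rm M) z = M"
  by (rule eq_matI) (auto simp: regular_at_to_fract)

lemma const_rm_regular: "M \<in> carrier_mat r c \<Longrightarrow> const_rm M \<in> mats (regular_at z) r c"
  by (auto simp: mats_iff regular_at_to_fract)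

lemma s_rm_regular [simp]: "s_rm \<in> regular_at z" "eval_rf s_rm z = z"
  by (simp_all add: s_rm_def regular_at_to_fract)

lemma resolvent_pencil:
  assumes A: "A \<in> carrier_mat k k"
  shows "s_rm \<cdot>\<^sub>m 1\<^sub>m k - const_rm A \<in> mats (regular_at z) k k"
    "eval_rm (s_rm \<cdot>\<^sub>m 1\<^sub>m k - const_rm A) z = z \<cdot>\<^sub>m 1\<^sub>m k - A"
proof -
  note s = regular_at.mats_smult[OF s_rm_regular(1) regular_at.mats_one]
  note A = const_rm_regular[OF A]
  show "s_rm \<cdot>\<^sub>m 1\<^sub>m k - const_rm A \<in> mats (regular_at z) k k" by (rule regular_at.mats_minus[OF s A])
  show "eval_rm (s_rm \<cdot>\<^sub>m 1\<^sub>m k - const_rm A) z = z \<cdot>\<^sub>m 1\<^sub>m k - A"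
    unfolding eval_rm_minus[OF s A] eval_rm_smult[OF s_rm_regular(1) regular_at.mats_one] by (simp add: eval_rm_one)
qed

lemma sum_to_fract: "(\<Sum>i\<in>I. to_fract (f i)) = to_fract (sum f I)"
  by (induction I rule: infinite_finite_induct) (auto simp: to_fract_add)

lemma const_pCons_sum: "(\<Sum>i\<in>I. [:f i:]) = [:sum f I:]"
  by (induction I rule: infinite_finite_induct) auto

lemma const_rm_mult: "dim_col A = dim_row B \<Longrightarrow> const_rm (A * B) = const_rm A * const_rm B"
  by (rule eq_matI) (auto simp: scalar_prod_def sum_to_fract const_pCons_sum mult.commute simp flip: to_fract_mult)

lemma const_rm_minus: "dim_row A = dim_row B \<Longrightarrow> dim_col A = dim_col B \<Longrightarrow> const_rm (A - B) = const_rm A - const_rm B"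
  by (rule eq_matI) (auto simp flip: to_fract_diff)

lemma const_rm_one: "const_rm (1\<^sub>m n) = 1\<^sub>m n"
  by (rule eq_matI) (auto simp: pCons_one)

lemma eval_rm_det:
  assumes "H \<in> mats (regular_at z) n n"
  shows "eval_rf (det H) z = det (eval_rm H z)"
proof -
  have "eval_rf (of_int (sign p) * (\<Prod>i = 0..<n. H $$ (i, p i))) z
      = of_int (sign p) * (\<Prod>i = 0..<n. eval_rm H z $$ (i, p i))"
    and "of_int (sign p) * (\<Prod>i = 0..<n. H $$ (i, p i)) \<in> regular_at z"
    if "p permutes {0..<n}" for p
  proof -
    have *: "H $$ (i, p i) \<in> regular_at z" "p i < n" if "i < n" for i
      using assms permutes_in_image[OF \<open>p permutes _\<close>, of i] that by (auto simp: mats_iff)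
    have **: "of_int (sign p) \<in> regular_at z" "eval_rf (of_int (sign p)) z = of_int (sign p)"
      by (auto simp: sign_def regular_at_1 eval_rf_uminus regular_at.uminus_closed)
    show "of_int (sign p) * (\<Prod>i = 0..<n. H $$ (i, p i)) \<in> regular_at z"
      using * ** by (auto intro!: regular_at_mult regular_at.prod_closed)
    show "eval_rf (of_int (sign p) * (\<Prod>i = 0..<n. H $$ (i, p i))) z
      = of_int (sign p) * (\<Prod>i = 0..<n. eval_rm H z $$ (i, p i))"
      using * ** assms
      by (subst regular_at_mult(2)) (auto intro!: regular_at.prod_closed prod.cong trans[OF eval_rf_prod] simp: mats_dim)
  qed
  thus ?thesis using assms by (auto simp: det_def mats_dim intro!: trans[OF eval_rf_sum])
qed

text \<open>An identically vanishing determinant vanishes at every point of regularity, so a single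
  point with an invertible value suffices for invertibility over the rational functions.\<close>

lemma det_nonzero_eval:
  assumes "H \<in> mats (regular_at z) n n" "det (eval_rm H z) \<noteq> 0"
  shows "det H \<noteq> 0"
  using eval_rm_det[OF assms(1)] assms(2) regular_at_0(2) by auto

text \<open>The determinant is a unit of the local ring at \<open>z\<close>, so by Cramer's rule the
  inverse is regular there; uniqueness of inverses identifies its value.\<close>

lemma eval_rm_minv:
  assumes H: "H \<in> mats (regular_at z) n n" and d: "det (eval_rm H z) \<noteq> 0"
  shows "minv H \<in> mats (regular_at z) n n" "eval_rm (minv H) z = minv (eval_rm H z)"
proof -
  note d' = det_nonzero_eval[OF H d]
  have "inverse (det H) \<in> regular_at z"
    using eval_rm_det[OF H] d by (intro regular_at_inverse regular_at.det_closed[OF H]) auto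
  thus r: "minv H \<in> mats (regular_at z) n n"
    by (rule mats_minv[OF regular_at.closed_subring_axioms H d'])
  have "eval_rm H z * eval_rm (minv H) z = 1\<^sub>m n"
    using minv(2)[OF mats_carrier[OF H] d'] by (metis eval_rm_mult[OF H r] eval_rm_one)
  thus "eval_rm (minv H) z = minv (eval_rm H z)"
    using mats_carrier[OF H] mats_carrier[OF r] by (intro minv_unique[symmetric]) auto
qed

lemma eval_rf_continuous:
  assumes "f \<in> regular_at z"
  shows "((\<lambda>s. eval_rf f s) \<longlongrightarrow> eval_rf f z) (at z)"
  unfolding eval_rf_def using assms by (intro tendsto_intros) (auto simp: regular_at_def)

text \<open>A reduced fraction is continuous where its denominator is non-zero. This connects
  regularity with the definition of poles by limits, so that strict positive realness can be applied
  at such points.\<close>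

lemma regular_not_pole:
  assumes "H \<in> mats (regular_at z) r c"
  shows "\<not> pole_rm H z"
  unfolding pole_rm_def not_not
proof (intro bexI[of _ "eval_rm H z"] allI impI)
  fix i j assume "i < dim_row H" "j < dim_col H"
  thus "((\<lambda>s. eval_rm H s $$ (i, j)) \<longlongrightarrow> eval_rm H z $$ (i, j)) (at z)"
    using assms by (auto intro!: eval_rf_continuous simp: mats_iff)
qed simp

section \<open>Positive definite matrices\<close>

abbreviation qform :: "complex mat \<Rightarrow> complex vec \<Rightarrow> complex" where
  "qform M v \<equiv> (M *\<^sub>v v) \<bullet>c v"

lemma form_expand:
  fixes M :: "complex mat"
  assumes "M \<in> carrier_mat n n" "v \<in> carrier_vec n"
  shows "qform M v = (\<Sum>i<n. \<Sum>j<n. M $$ (i,j) * (v $ j * cnj (v $ i)))"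
  using assms by (simp add: inner_sum scalar_prod_def sum_distrib_right sum_distrib_left atLeast0LessThan ac_simps)

lemma form_bound:
  fixes M :: "complex mat"
  assumes M: "M \<in> carrier_mat n n"
  obtains c where "c > 0" "\<And>v. v \<in> carrier_vec n \<Longrightarrow> cmod (qform M v) \<le> c * sqnorm v"
proof
  \<comment> \<open>The summand 1 keeps the bound positive even for the zero matrix; such bounds
    later stand in denominators.\<close>
  define c where "c = 1 + (\<Sum>i<n. \<Sum>j<n. cmod (M $$ (i,j)))"
  show "c > 0" unfolding c_def by (intro add_pos_nonneg sum_nonneg) auto
  fix v :: "complex vec" assume v: "v \<in> carrier_vec n"
  have b: "cmod (v $ j) * cmod (v $ i) \<le> sqnorm v" if "i < n" "j < n" for i j
  proof -
    have "2 * (cmod (v $ j) * cmod (v $ i)) \<le> (cmod (v $ j))\<^sup>2 + (cmod (v $ i))\<^sup>2"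
      using zero_le_power2[of "cmod (v $ j) - cmod (v $ i)"] by (simp add: power2_diff)
    with sqnorm_entry[of i v] sqnorm_entry[of j v] v that show ?thesis by auto
  qed
  have "cmod (qform M v) \<le> (\<Sum>i<n. \<Sum>j<n. cmod (M $$ (i,j)) * (cmod (v $ j) * cmod (v $ i)))"
    unfolding form_expand[OF M v]
    by (intro sum_norm_le order.trans[OF norm_sum] sum_mono) (simp add: norm_mult)
  also have "\<dots> \<le> (\<Sum>i<n. \<Sum>j<n. cmod (M $$ (i,j)) * sqnorm v)"
    using b by (intro sum_mono mult_left_mono) auto
  also have "\<dots> \<le> c * sqnorm v"
    by (simp add: c_def distrib_right sum_distrib_right sqnorm_nonneg)
  finally show "cmod (qform M v) \<le> c * sqnorm v" .
qed

lemma pos_def_iff: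
  "M \<in> carrier_mat n n \<Longrightarrow> pos_def M \<longleftrightarrow> mat_adjoint M = M \<and>
     (\<forall>v \<in> carrier_vec n. v \<noteq> 0\<^sub>v n \<longrightarrow> Re (qform M v) > 0)"
  by (auto simp: pos_def_def)

lemma pos_semidef_iff:
  "M \<in> carrier_mat n n \<Longrightarrow> pos_semidef M \<longleftrightarrow> mat_adjoint M = M \<and>
     (\<forall>v \<in> carrier_vec n. Re (qform M v) \<ge> 0)"
  by (auto simp: pos_semidef_def)

lemma Re_hermitian_form:
  fixes M :: "complex mat"
  assumes "M \<in> carrier_mat n n" "mat_adjoint M = M" "v \<in> carrier_vec n"
  shows "qform M v = of_real (Re (qform M v))"
proof -
  have "qform M v = v \<bullet>c (M *\<^sub>v v)" using assms by (subst inner_mat_adjoint) auto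
  also have "\<dots> = cnj (qform M v)" using assms by (intro inner_cnj[symmetric]) auto
  finally have "Im (qform M v) = 0" by (metis cnj.sel(2) equal_neg_zero)
  thus ?thesis by (simp add: complex_eq_iff)
qed

lemma Re_form_add_adjoint:
  fixes S :: "complex mat"
  assumes S: "S \<in> carrier_mat n n" and v: "v \<in> carrier_vec n"
  shows "Re (qform (S + mat_adjoint S) v) = 2 * Re (qform S v)"
proof -
  have "qform (S + mat_adjoint S) v = qform S v + v \<bullet>c (S *\<^sub>v v)"
    using S v by (simp add: add_mult_vec_dims inner_add inner_mat_adjoint)
  also have "v \<bullet>c (S *\<^sub>v v) = cnj (qform S v)" using S v by (intro inner_cnj[symmetric]) auto
  finally show ?thesis by simp
qed

lemma mult_mat_vec_zero [simp]:
  fixes M :: "'a :: semiring_0 mat"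
  shows "dim_col M = n \<Longrightarrow> M *\<^sub>v 0\<^sub>v n = 0\<^sub>v (dim_row M)"
  by (rule eq_vecI) auto

lemma inner_zero_dims [simp]:
  fixes v :: "complex vec"
  shows "dim_vec v = n \<Longrightarrow> v \<bullet>c 0\<^sub>v n = 0" "dim_vec v = n \<Longrightarrow> 0\<^sub>v n \<bullet>c v = 0"
  using inner_zero by blast+

lemma form_nonzero_det:
  fixes M :: "complex mat"
  assumes M: "M \<in> carrier_mat n n"
    and "\<And>v. v \<in> carrier_vec n \<Longrightarrow> v \<noteq> 0\<^sub>v n \<Longrightarrow> qform M v \<noteq> 0"
  shows "det M \<noteq> 0"
  unfolding det_nonzero_iff_kernel[OF M] using assms(2) by fastforce

lemma pos_def_det:
  assumes M: "M \<in> carrier_mat n n" and "pos_def M"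
  shows "det M \<noteq> 0"
  using assms by (intro form_nonzero_det[OF M]) (force simp: pos_def_iff[OF M])

lemma form_nonneg_pos_def:
  assumes M: "M \<in> carrier_mat n n" and "pos_def M" "v \<in> carrier_vec n"
  shows "Re (qform M v) \<ge> 0"
  using assms by (cases "v = 0\<^sub>v n") (auto simp: pos_def_iff[OF M] intro: less_imp_le)

text \<open>Expanding the form at \<open>v - t M\<^sup>-\<^sup>1 v\<close> gives \<open>0 \<le> v'Mv - 2t |v|\<^sup>2 + t\<^sup>2 v'M\<^sup>-\<^sup>1v\<close>, so coercivity
  follows from boundedness of the inverse, without a compactness argument.\<close>

lemma pos_def_coercive:
  assumes M: "M \<in> carrier_mat n n" and pd: "pos_def M"
  obtains d where "d > 0" "\<And>v. v \<in> carrier_vec n \<Longrightarrow> d * sqnorm v \<le> Re (qform M v)"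
proof -
  note N = minv[OF M pos_def_det[OF M pd]]
  obtain c where c: "c > 0" "\<And>v. v \<in> carrier_vec n \<Longrightarrow> cmod (qform (minv M) v) \<le> c * sqnorm v"
    using form_bound[OF N(1)] by blast
  have "1 / c * sqnorm v \<le> Re (qform M v)" if v: "v \<in> carrier_vec n" for v
  proof -
    define t where "t = complex_of_real (1 / c)"
    define w where "w = v - t \<cdot>\<^sub>v (minv M *\<^sub>v v)"
    have w: "w \<in> carrier_vec n" using v N(1) by (auto simp: w_def)
    have MNv: "M *\<^sub>v (minv M *\<^sub>v v) = v"
      using M N v by (simp flip: mult_vec_assoc_dims)
    have Mw: "M *\<^sub>v w = M *\<^sub>v v - t \<cdot>\<^sub>v v"
      using M N v MNv by (simp add: w_def mult_vec_minus_dims smult_mult_vec_dims)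
    have *: "(M *\<^sub>v v) \<bullet>c (minv M *\<^sub>v v) = complex_of_real (sqnorm v)"
      using M N v pd by (simp add: inner_mat_adjoint pos_def_iff[OF M] MNv inner_self)
    have **: "v \<bullet>c (minv M *\<^sub>v v) = cnj (qform (minv M) v)"
      using N v by (intro inner_cnj[symmetric]) auto
    have ***: "cnj t = t" by (simp add: t_def)
    have "qform M w = qform M v - 2 * t * of_real (sqnorm v)
        + t * t * cnj (qform (minv M) v)"
      using M N v unfolding Mw unfolding w_def
      by (simp add: inner_add inner_smult * ** *** inner_self algebra_simps)
    hence "Re (qform M w) = Re (qform M v) - 2 / c * sqnorm v
        + 1 / c * (1 / c * Re (qform (minv M) v))"
      by (simp add: t_def mult.assoc)
    moreover have "Re (qform M w) \<ge> 0" by (rule form_nonneg_pos_def[OF M pd w])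
    moreover have "Re (qform (minv M) v) \<le> c * sqnorm v"
      using c(2)[OF v] complex_Re_le_cmod[of "qform (minv M) v"] by linarith
    hence "1 / c * (1 / c * Re (qform (minv M) v)) \<le> 1 / c * (1 / c * (c * sqnorm v))"
      using c(1) by (intro mult_left_mono) auto
    moreover have "1 / c * (1 / c * (c * sqnorm v)) = 1 / c * sqnorm v" using c(1) by simp
    moreover have "2 / c * sqnorm v = 2 * (1 / c * sqnorm v)" by simp
    ultimately show ?thesis by linarith
  qed
  thus thesis using c(1) that[of "1 / c"] by auto
qed

lemma pos_def_congruence:
  assumes M: "M \<in> carrier_mat n n" and pd: "pos_def M" and T: "T \<in> carrier_mat n n" "det T \<noteq> 0"
  shows "pos_def (mat_adjoint T * M * T)"
proof -
  have c: "mat_adjoint T * M * T \<in> carrier_mat n n" using M T by auto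
  have "Re (qform (mat_adjoint T * M * T) v) > 0" if v: "v \<in> carrier_vec n" "v \<noteq> 0\<^sub>v n" for v
  proof -
    have "T *\<^sub>v v \<noteq> 0\<^sub>v n" using T v det_nonzero_iff_kernel[OF T(1)] by auto
    moreover have "qform (mat_adjoint T * M * T) v = qform M (T *\<^sub>v v)"
      using M T v by (simp add: mat_alg inner_mat_adjoint)
    ultimately show ?thesis using pd T v by (auto simp: pos_def_iff[OF M])
  qed
  moreover have "mat_adjoint (mat_adjoint T * M * T) = mat_adjoint T * M * T"
    using M T pd by (simp add: pos_def_iff[OF M] mat_adjoint_mult mult_assoc_dims)
  ultimately show ?thesis unfolding pos_def_iff[OF c] by blast
qed

lemma pos_def_one: "pos_def (1\<^sub>m n)"
proof (subst pos_def_iff[of _ n], simp, intro conjI ballI impI)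
  fix v :: "complex vec" assume "v \<in> carrier_vec n" "v \<noteq> 0\<^sub>v n"
  thus "0 < Re (qform (1\<^sub>m n) v)" using sqnorm_pos[of v] by (auto simp: inner_self)
qed (simp add: mat_adjoint_one)

section \<open>The Lyapunov equation\<close>

lemma smult_pow_mat:
  fixes A :: "'a :: comm_semiring_1 mat"
  assumes A: "A \<in> carrier_mat n n"
  shows "(c \<cdot>\<^sub>m A) ^\<^sub>m k = c ^ k \<cdot>\<^sub>m A ^\<^sub>m k"
  using A by (induction k) (auto simp: smult_mult_dims ac_simps intro!: eq_matI)

text \<open>Rescaling: with \<open>r\<close> halfway between the spectral radius and 1, the matrix
  \<open>M / r\<close> still has spectral radius below 1, hence bounded powers, and
  \<open>M^k\<close> is \<open>r^k\<close> times such a power.\<close>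

lemma power_bound_geometric:
  fixes M :: "complex mat"
  assumes M: "M \<in> carrier_mat n n" and ev: "\<And>e. eigenvalue M e \<Longrightarrow> cmod e < 1"
  obtains c r where "0 < r" "r < 1" "0 \<le> c" "\<And>k. norm_bound (M ^\<^sub>m k) (c * r ^ k)"
\<comment> \<open>The spectral radius is a maximum over the spectrum, which is empty in dimension
  zero.\<close>
proof (cases "n = 0")
  case True
  have "norm_bound (M ^\<^sub>m k) (0 * (1/2) ^ k)" for k using True M by (auto simp: norm_bound_def)
  thus thesis using that[of "1/2" 0] by auto
next
  case False
  hence n: "n > 0" by simp
  obtain e where e: "eigenvalue M e" "spectral_radius M = cmod e"
    using spectral_radius_mem_max(1)[OF M n] by (auto simp: spectrum_def)
  define r where "r = (1 + cmod e) / 2"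
  have r: "0 < r" "cmod e < r" "r < 1" using ev[OF e(1)] by (auto simp: r_def intro: add_pos_nonneg)
  define A where "A = complex_of_real (1 / r) \<cdot>\<^sub>m M"
  have A: "A \<in> carrier_mat n n" using M by (simp add: A_def)
  obtain a where a: "eigenvalue A a" "spectral_radius A = cmod a"
    using spectral_radius_mem_max(1)[OF A n] by (auto simp: spectrum_def)
  then obtain v where v: "v \<in> carrier_vec n" "v \<noteq> 0\<^sub>v n" "A *\<^sub>v v = a \<cdot>\<^sub>v v"
    using A by (auto simp: eigenvalue_def eigenvector_def)
  have "M = complex_of_real r \<cdot>\<^sub>m A" using r M by (auto simp: A_def intro!: eq_matI)
  hence "M *\<^sub>v v = (complex_of_real r * a) \<cdot>\<^sub>v v"
    using v A by (simp add: smult_mult_vec_dims smult_smult_assoc)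
  hence "eigenvalue M (complex_of_real r * a)"
    using v M by (auto simp: eigenvalue_def eigenvector_def)
  hence "cmod (complex_of_real r * a) \<le> cmod e"
    using spectral_radius_mem_max(2)[OF M n] e by (auto simp: spectrum_def)
  hence "cmod a < 1" using r by (simp add: norm_mult) (smt (verit) mult_le_cancel_left1)
  then obtain c where c: "\<And>k. norm_bound (A ^\<^sub>m k) c"
    using spectral_radius_jnf_norm_bound_less_1_upper_triangular[OF A] a by auto
  have "norm_bound (M ^\<^sub>m k) (max c 0 * r ^ k)" for k
  proof (rule norm_boundI)
    fix i j assume "i < dim_row (M ^\<^sub>m k)" "j < dim_col (M ^\<^sub>m k)"
    hence ij: "i < n" "j < n" using pow_carrier_mat[OF M, of k] by (metis carrier_matD)+
    have "M ^\<^sub>m k = complex_of_real r ^ k \<cdot>\<^sub>m A ^\<^sub>m k"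
      using smult_pow_mat[OF A] \<open>M = _ \<cdot>\<^sub>m A\<close> by metis
    hence "cmod ((M ^\<^sub>m k) $$ (i,j)) = r ^ k * cmod ((A ^\<^sub>m k) $$ (i,j))"
      using ij A r by (simp add: norm_mult norm_power)
    also have "\<dots> \<le> r ^ k * max c 0"
      using c[of k] ij A r by (intro mult_left_mono) (auto simp: norm_bound_def le_max_iff_disj)
    finally show "cmod ((M ^\<^sub>m k) $$ (i,j)) \<le> max c 0 * r ^ k" by (simp add: mult.commute)
  qed
  thus thesis using that[of r "max c 0"] r by auto
qed

text \<open>Each of the two powers in a term contributes a factor \<open>r ^ k\<close>, so the terms
  decay like the geometric sequence \<open>(r * r) ^ k\<close>. The two factors \<open>n\<close> in
  the bound come from the two matrix products.\<close>

lemma stein_summable: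
  fixes M Q :: "complex mat"
  assumes M: "M \<in> carrier_mat n n" and Q: "Q \<in> carrier_mat n n"
    and ev: "\<And>e. eigenvalue M e \<Longrightarrow> cmod e < 1" and ij: "i < n" "j < n"
  shows "summable (\<lambda>k. (mat_adjoint (M ^\<^sub>m k) * Q * M ^\<^sub>m k) $$ (i,j))"
proof -
  obtain c r where cr: "0 < r" "r < 1" "0 \<le> c" "\<And>k. norm_bound (M ^\<^sub>m k) (c * r ^ k)"
    using power_bound_geometric[OF M ev] by blast
  define q where "q = (\<Sum>i<n. \<Sum>j<n. cmod (Q $$ (i,j)))"
  have "norm_bound Q q" unfolding norm_bound_def
  proof (intro allI impI)
    fix i j assume "i < dim_row Q" "j < dim_col Q"
    hence ij: "i < n" "j < n" using Q by auto
    have "cmod (Q $$ (i,j)) \<le> (\<Sum>j<n. cmod (Q $$ (i,j)))" using ij by (intro member_le_sum) auto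
    also have "\<dots> \<le> q" unfolding q_def using ij
      by (intro member_le_sum[of i "{..<n}" "\<lambda>i. \<Sum>j<n. cmod (Q $$ (i,j))"]) (auto intro: sum_nonneg)
    finally show "cmod (Q $$ (i,j)) \<le> q" .
  qed
  define T where "T k = mat_adjoint (M ^\<^sub>m k) * Q * M ^\<^sub>m k" for k
  have "norm_bound (T k) (c * r ^ k * q * n * (c * r ^ k) * n)" for k
  proof -
    have Mk: "M ^\<^sub>m k \<in> carrier_mat n n" using M by (rule pow_carrier_mat)
    have "norm_bound (mat_adjoint (M ^\<^sub>m k)) (c * r ^ k)"
      using cr(4)[of k] by (auto simp: norm_bound_def)
    thus ?thesis unfolding T_def using cr(4)[of k] Mk Q \<open>norm_bound Q q\<close>
      by (intro norm_bound_mult[of _ n n _ n]) (auto intro!: mult_carrier_mat[of _ n n])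
  qed
  hence "cmod (T k $$ (i,j)) \<le> c * r ^ k * q * n * (c * r ^ k) * n" for k
    using ij M Q by (simp add: norm_bound_def T_def)
  also have "c * r ^ k * q * n * (c * r ^ k) * n = c * c * q * n * n * (r * r) ^ k" for k
    by (simp add: power_mult_distrib)
  finally have b: "cmod (T k $$ (i,j)) \<le> c * c * q * n * n * (r * r) ^ k" for k .
  have "summable (\<lambda>k. c * c * q * n * n * (r * r) ^ k)"
    using cr mult_strict_mono[of r 1 r 1] by (intro summable_mult summable_geometric) auto
  hence "summable (\<lambda>k. T k $$ (i,j))"
    by (rule summable_comparison_test'[where N = 0]) (use b in auto)
  thus ?thesis by (simp add: T_def)
qed

text \<open>Iterating the equation shows that every term of the series built from \<open>X\<close>
  equals \<open>X\<close>; summability forces this constant sequence to zero.\<close>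

lemma stein_unique:
  fixes M X :: "complex mat"
  assumes M: "M \<in> carrier_mat n n" and X: "X \<in> carrier_mat n n"
    and ev: "\<And>e. eigenvalue M e \<Longrightarrow> cmod e < 1" and eq: "X = mat_adjoint M * X * M"
  shows "X = 0\<^sub>m n n"
proof (rule eq_matI)
  have *: "mat_adjoint (M ^\<^sub>m k) * X * M ^\<^sub>m k = X" for k
  proof (induction k)
    case 0
    show ?case using M X by (simp add: mat_adjoint_one)
  next
    case (Suc k)
    have "mat_adjoint (M ^\<^sub>m Suc k) * X * M ^\<^sub>m Suc k
        = mat_adjoint M * (mat_adjoint (M ^\<^sub>m k) * X * M ^\<^sub>m k) * M"
      using M X by (simp add: mat_adjoint_mult mult_assoc_dims)
    thus ?case using Suc eq by simp
  qed
  fix i j assume "i < dim_row (0\<^sub>m n n)" "j < dim_col (0\<^sub>m n n)"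
  hence ij: "i < n" "j < n" by auto
  from stein_summable[OF M X ev ij] have "(\<lambda>k::nat. X $$ (i,j)) \<longlonglongrightarrow> 0"
    unfolding * by (rule summable_LIMSEQ_zero)
  thus "X $$ (i,j) = 0\<^sub>m n n $$ (i,j)" using ij by (simp add: LIMSEQ_const_iff)
qed (use X in auto)

text \<open>\<open>P\<close> is the sum of the terms \<open>(M^k)' Q M^k\<close>. The map
  \<open>P -> M'PM\<close> shifts the series by one term, and non-negativity of the form passes from
  the terms to the sum.\<close>

lemma stein_exists:
  fixes M Q :: "complex mat"
  assumes M: "M \<in> carrier_mat n n" and Q: "Q \<in> carrier_mat n n"
    and ev: "\<And>e. eigenvalue M e \<Longrightarrow> cmod e < 1"
    and nn: "\<And>v. v \<in> carrier_vec n \<Longrightarrow> Re (qform Q v) \<ge> 0"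
  obtains P where "P \<in> carrier_mat n n" "P = mat_adjoint M * P * M + Q"
    "\<And>v. v \<in> carrier_vec n \<Longrightarrow> Re (qform P v) \<ge> 0"
proof
  define T where "T k = mat_adjoint (M ^\<^sub>m k) * Q * M ^\<^sub>m k" for k
  define P where "P = mat n n (\<lambda>(i,j). \<Sum>k. T k $$ (i,j))"
  show P: "P \<in> carrier_mat n n" by (simp add: P_def)
  have T: "T k \<in> carrier_mat n n" for k using M Q by (auto simp: T_def)
  have sums: "(\<lambda>k. T k $$ (i,j)) sums (P $$ (i,j))" if "i < n" "j < n" for i j
    using stein_summable[OF M Q ev that] that by (auto simp: P_def T_def summable_sums)
  have T0: "T 0 = Q" using M Q by (simp add: T_def mat_adjoint_one)
  have TS: "T (Suc k) = mat_adjoint M * T k * M" for k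
    using M Q by (simp add: T_def mat_adjoint_mult mult_assoc_dims)
  show "P = mat_adjoint M * P * M + Q"
  proof (rule eq_matI)
    fix i j assume "i < dim_row (mat_adjoint M * P * M + Q)" "j < dim_col (mat_adjoint M * P * M + Q)"
    hence ij: "i < n" "j < n" using Q by auto
    have ex: "(mat_adjoint M * X * M) $$ (i,j)
        = (\<Sum>b<n. (\<Sum>a<n. cnj (M $$ (a,i)) * X $$ (a,b)) * M $$ (b,j))"
      if "X \<in> carrier_mat n n" for X
      using M ij that by (simp add: scalar_prod_def atLeast0LessThan)
    have "(\<lambda>k. \<Sum>b<n. (\<Sum>a<n. cnj (M $$ (a,i)) * T k $$ (a,b)) * M $$ (b,j))
       sums (\<Sum>b<n. (\<Sum>a<n. cnj (M $$ (a,i)) * P $$ (a,b)) * M $$ (b,j))"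
      using sums by (intro sums_sum sums_mult2 sums_mult) auto
    hence "(\<lambda>k. T (Suc k) $$ (i,j)) sums ((mat_adjoint M * P * M) $$ (i,j))"
      unfolding TS ex[OF T] ex[OF P] .
    hence "(\<lambda>k. T k $$ (i,j)) sums ((mat_adjoint M * P * M) $$ (i,j) + T 0 $$ (i,j))"
      by (rule sums_Suc)
    thus "P $$ (i,j) = (mat_adjoint M * P * M + Q) $$ (i,j)"
      using sums[OF ij] sums_unique2 ij Q M by (fastforce simp: T0)
  qed (use P Q in auto)
  fix v :: "complex vec" assume v: "v \<in> carrier_vec n"
  have sm: "(\<lambda>k. qform (T k) v) sums (qform P v)"
    unfolding form_expand[OF T v] form_expand[OF P v] using sums by (intro sums_sum sums_mult2) auto
  have nn_T: "Re (qform (T k) v) \<ge> 0" for k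
  proof -
    have "qform (T k) v = qform Q (M ^\<^sub>m k *\<^sub>v v)"
      using M Q v by (simp add: T_def mat_alg inner_mat_adjoint)
    thus ?thesis using nn M v by (metis mult_mat_vec_carrier pow_carrier_mat)
  qed
  show "Re (qform P v) \<ge> 0"
    by (rule sums_le[OF nn_T sums_zero sums_Re[OF sm]])
qed

section \<open>Transfer to the Lyapunov equation by the Cayley transform\<close>

lemma hurwitz_shift_det:
  assumes A: "A \<in> carrier_mat n n" and h: "hurwitz A" and z: "Re z \<ge> 0"
  shows "det (z \<cdot>\<^sub>m 1\<^sub>m n - A) \<noteq> 0"
proof (subst det_nonzero_iff_kernel[of _ n], use A in \<open>simp add: minus_carrier_mat\<close>, intro ballI impI, rule ccontr)
  fix v assume v: "v \<in> carrier_vec n" "(z \<cdot>\<^sub>m 1\<^sub>m n - A) *\<^sub>v v = 0\<^sub>v n" "v \<noteq> 0\<^sub>v n"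
  hence "z \<cdot>\<^sub>v v - A *\<^sub>v v = 0\<^sub>v n"
    using A by (simp add: mat_alg)
  hence "A *\<^sub>v v = z \<cdot>\<^sub>v v" using v(1) A vec_diff_eq_iff[of "z \<cdot>\<^sub>v v" n "A *\<^sub>v v" "0\<^sub>v n"] by simp
  hence "eigenvalue A z" using v A by (auto simp: eigenvalue_def eigenvector_def)
  thus False using h z by (auto simp: hurwitz_def)
qed

text \<open>The Cayley transform \<open>(1 + A)(1 - A)\<^sup>-\<^sup>1\<close> maps Hurwitz matrices to matrices with spectrum in
  the open unit disc and the Lyapunov equation to the Stein equation \<open>P = M'PM + Q\<close>.\<close>

lemma hurwitz_cayley:
  assumes A: "A \<in> carrier_mat n n" and h: "hurwitz A"
  defines "R \<equiv> minv (1\<^sub>m n - A)"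
  shows "R \<in> carrier_mat n n" "R * (1\<^sub>m n - A) = 1\<^sub>m n" "(1\<^sub>m n - A) * R = 1\<^sub>m n"
    "\<And>e. eigenvalue ((1\<^sub>m n + A) * R) e \<Longrightarrow> cmod e < 1"
proof -
  have "1 \<cdot>\<^sub>m 1\<^sub>m n = (1\<^sub>m n :: complex mat)" by auto
  hence d: "det (1\<^sub>m n - A) \<noteq> 0" using hurwitz_shift_det[OF A h, of 1] by simp
  have cA: "1\<^sub>m n - A \<in> carrier_mat n n" using A by auto
  note R = minv[OF cA d, folded R_def]
  show "R \<in> carrier_mat n n" "R * (1\<^sub>m n - A) = 1\<^sub>m n" "(1\<^sub>m n - A) * R = 1\<^sub>m n" by fact+
  fix e assume "eigenvalue ((1\<^sub>m n + A) * R) e"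
  then obtain v where v: "v \<in> carrier_vec n" "v \<noteq> 0\<^sub>v n" "(1\<^sub>m n + A) * R *\<^sub>v v = e \<cdot>\<^sub>v v"
    using A R by (auto simp: eigenvalue_def eigenvector_def)
  define x where "x = R *\<^sub>v v"
  have x: "x \<in> carrier_vec n" using R v by (simp add: x_def)
  have vx: "v = x - A *\<^sub>v x"
  proof -
    have "v = ((1\<^sub>m n - A) * R) *\<^sub>v v" using R v by simp
    also have "\<dots> = x - A *\<^sub>v x" using R(1) A v by (simp add: mat_alg x_def)
    finally show ?thesis .
  qed
  have x0: "x \<noteq> 0\<^sub>v n" using vx v(2) A by auto
  have "x + A *\<^sub>v x = e \<cdot>\<^sub>v (x - A *\<^sub>v x)"
    using v(3) A R(1) v(1) unfolding vx[symmetric] by (simp add: mat_alg x_def)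
  hence xe: "(x + A *\<^sub>v x) $ i = (e \<cdot>\<^sub>v (x - A *\<^sub>v x)) $ i" for i by simp
  have eq: "x $ i + (A *\<^sub>v x) $ i = e * (x $ i - (A *\<^sub>v x) $ i)" if "i < n" for i
    using xe[of i] that x A by (simp del: index_mult_mat_vec)
  \<comment> \<open>The number -1 is the value of the Cayley map at infinity, so it cannot come from
    an eigenvalue of \<open>A\<close>: it would force \<open>x\<close> to vanish.\<close>
  have e1: "e \<noteq> - 1"
  proof
    assume "e = - 1"
    hence "x $ i = 0" if "i < n" for i using eq[OF that] by (simp add: algebra_simps)
    thus False using x0 x by (auto simp: vec_eq_iff)
  qed
  \<comment> \<open>Inverse Cayley map: \<open>e = (1 + k) / (1 - k)\<close>, and \<open>x\<close>
    turns out to be an eigenvector of \<open>A\<close> for \<open>k\<close>.\<close>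
  define k where "k = (e - 1) / (e + 1)"
  have "e + 1 \<noteq> 0" using e1 eq_neg_iff_add_eq_0[of e 1] by blast
  hence k: "e - 1 = k * (e + 1)" by (simp add: k_def)
  have "(A *\<^sub>v x) $ i = k * x $ i" if "i < n" for i
  proof -
    have "(e + 1) * (A *\<^sub>v x) $ i = (e - 1) * x $ i" using eq[OF that] by (simp add: algebra_simps)
    also have "\<dots> = (e + 1) * (k * x $ i)" by (simp add: k)
    finally show ?thesis using \<open>e + 1 \<noteq> 0\<close> by simp
  qed
  hence "A *\<^sub>v x = k \<cdot>\<^sub>v x" using x A by (intro eq_vecI) auto
  hence "eigenvalue A k" using x x0 A by (auto simp: eigenvalue_def eigenvector_def)
  hence "Re k < 0" using h by (simp add: hurwitz_def)
  have "e * (1 - k) = 1 + k" using k by (simp add: algebra_simps)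
  hence "cmod e * cmod (1 - k) = cmod (1 + k)" by (metis norm_mult)
  \<comment> \<open>Left minus right is \<open>4 * Re k\<close>.\<close>
  moreover have "(cmod (1 + k))\<^sup>2 < (cmod (1 - k))\<^sup>2"
    unfolding cmod_power2 using \<open>Re k < 0\<close> by (simp add: power2_eq_square algebra_simps)
  hence "cmod (1 + k) < cmod (1 - k)" by (rule power2_less_imp_less) simp
  ultimately show "cmod e < 1"
    by (metis mult_le_cancel_right1 norm_not_less_zero not_le)
qed

text \<open>The terms \<open>X\<close> and \<open>A'XA\<close> are even under the exchange of
  \<open>A\<close> and \<open>-A\<close> and agree on both sides; the cross terms are odd and
  remain, doubled.\<close>

lemma cayley_identity:
  fixes A X :: "complex mat"
  assumes A: "A \<in> carrier_mat n n" and X: "X \<in> carrier_mat n n"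
  shows "mat_adjoint (1\<^sub>m n + A) * X * (1\<^sub>m n + A)
    = mat_adjoint (1\<^sub>m n - A) * X * (1\<^sub>m n - A) + 2 \<cdot>\<^sub>m (X * A + mat_adjoint A * X)"
  using A X by (simp add: mat_adjoint_simps mat_alg) (rule eq_matI; simp)

text \<open>Congruence with \<open>R\<close> turns the homogeneous Lyapunov equation into the
  homogeneous Stein equation for the Cayley transform of \<open>A\<close>.\<close>

lemma lyapunov_unique:
  fixes A X :: "complex mat"
  assumes A: "A \<in> carrier_mat n n" and h: "hurwitz A" and X: "X \<in> carrier_mat n n"
    and eq: "X * A + mat_adjoint A * X = 0\<^sub>m n n"
  shows "X = 0\<^sub>m n n"
proof -
  define R where "R = minv (1\<^sub>m n - A)"
  note R = hurwitz_cayley(1-3)[OF A h, folded R_def]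
  have 1: "mat_adjoint (1\<^sub>m n + A) * X * (1\<^sub>m n + A) = mat_adjoint (1\<^sub>m n - A) * X * (1\<^sub>m n - A)"
    unfolding cayley_identity[OF A X] eq using A X by auto
  have "X = mat_adjoint ((1\<^sub>m n - A) * R) * X * ((1\<^sub>m n - A) * R)"
    using X by (simp add: R mat_adjoint_one)
  also have "\<dots> = mat_adjoint R * (mat_adjoint (1\<^sub>m n - A) * X * (1\<^sub>m n - A)) * R"
    using A X R(1) by (simp add: mat_adjoint_mult mult_assoc_dims)
  also have "\<dots> = mat_adjoint ((1\<^sub>m n + A) * R) * X * ((1\<^sub>m n + A) * R)"
    unfolding 1[symmetric] using A X R(1) by (simp add: mat_adjoint_mult mult_assoc_dims)
  finally show ?thesis using stein_unique[OF _ X] hurwitz_cayley(4)[OF A h] A R(1)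
    unfolding R_def by (metis add_carrier_mat mult_carrier_mat)
qed

lemma lyapunov_exists:
  fixes A Q :: "complex mat"
  assumes A: "A \<in> carrier_mat n n" and h: "hurwitz A" and Q: "Q \<in> carrier_mat n n"
    and nn: "\<And>v. v \<in> carrier_vec n \<Longrightarrow> Re (qform Q v) \<ge> 0"
  obtains P where "P \<in> carrier_mat n n" "P * A + mat_adjoint A * P + Q = 0\<^sub>m n n"
    "\<And>v. v \<in> carrier_vec n \<Longrightarrow> Re (qform P v) \<ge> 0"
proof -
  define R where "R = minv (1\<^sub>m n - A)"
  note R = hurwitz_cayley(1-3)[OF A h, folded R_def]
  define M where "M = (1\<^sub>m n + A) * R"
  \<comment> \<open>Scaled so that congruence with \<open>1 - A\<close> yields \<open>2 Q\<close>,
    matching the factor 2 in \<open>cayley_identity\<close>.\<close>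
  define Q' where "Q' = 2 \<cdot>\<^sub>m (mat_adjoint R * Q * R)"
  have M: "M \<in> carrier_mat n n" and Q': "Q' \<in> carrier_mat n n" using A R(1) Q by (auto simp: M_def Q'_def)
  have nn': "Re (qform Q' v) \<ge> 0" if v: "v \<in> carrier_vec n" for v
  proof -
    have "qform Q' v = 2 * (qform Q (R *\<^sub>v v))"
      using Q R(1) v by (simp add: Q'_def mat_alg inner_smult inner_mat_adjoint)
    thus ?thesis using nn[of "R *\<^sub>v v"] R(1) v by simp
  qed
  obtain P where P: "P \<in> carrier_mat n n" "P = mat_adjoint M * P * M + Q'"
    "\<And>v. v \<in> carrier_vec n \<Longrightarrow> Re (qform P v) \<ge> 0"
    using stein_exists[OF M Q' _ nn'] hurwitz_cayley(4)[OF A h] unfolding R_def M_def by metis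
  have MA: "M * (1\<^sub>m n - A) = 1\<^sub>m n + A"
    using A R by (simp add: M_def mult_assoc_dims mult_one_dims)
  let ?N = "1\<^sub>m n - A"
  have "mat_adjoint ?N * P * ?N = mat_adjoint ?N * (mat_adjoint M * P * M + Q') * ?N"
    using P(2) by simp
  also have "\<dots> = mat_adjoint (M * ?N) * P * (M * ?N) + 2 \<cdot>\<^sub>m (mat_adjoint (R * ?N) * Q * (R * ?N))"
    using A P(1) M R(1) Q by (simp add: Q'_def mat_adjoint_mult mult_assoc_dims smult_mult_dims mult_add_dims add_mult_dims)
  also have "\<dots> = mat_adjoint (1\<^sub>m n + A) * P * (1\<^sub>m n + A) + 2 \<cdot>\<^sub>m Q"
    unfolding MA R(2) using Q by (simp add: mat_adjoint_one)
  also have "\<dots> = mat_adjoint ?N * P * ?N + 2 \<cdot>\<^sub>m (P * A + mat_adjoint A * P) + 2 \<cdot>\<^sub>m Q"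
    unfolding cayley_identity[OF A P(1)] ..
  \<comment> \<open>The chain begins and ends with the same matrix; cancelling it leaves twice the
    Lyapunov equation.\<close>
  finally have e: "mat_adjoint ?N * P * ?N = \<dots>" .
  have "P * A + mat_adjoint A * P + Q = 0\<^sub>m n n"
  proof (rule eq_matI)
    fix i j assume "i < dim_row (0\<^sub>m n n)" "j < dim_col (0\<^sub>m n n)"
    hence ij: "i < n" "j < n" by auto
    define Y where "Y = mat_adjoint ?N * P * ?N"
    define Z where "Z = P * A + mat_adjoint A * P"
    have "Y \<in> carrier_mat n n" "Z \<in> carrier_mat n n" using A P(1) by (auto simp: Y_def Z_def)
    moreover have "Y $$ (i,j) = (Y + 2 \<cdot>\<^sub>m Z + 2 \<cdot>\<^sub>m Q) $$ (i,j)"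
      using e unfolding Y_def[symmetric] Z_def[symmetric] by simp
    ultimately have "2 * (Z + Q) $$ (i,j) = 0" using ij Q by simp
    hence "(Z + Q) $$ (i,j) = 0" by simp
    thus "(P * A + mat_adjoint A * P + Q) $$ (i,j) = 0\<^sub>m n n $$ (i,j)" using ij by (simp add: Z_def)
  qed (use A P(1) Q in auto)
  thus thesis using that P by blast
qed

section \<open>Lyapunov solutions over the base field\<close>

lemma map_mat_cnj_simps:
  "dim_col A = dim_row B \<Longrightarrow> map_mat cnj (A * B) = map_mat cnj A * map_mat cnj B"
  "dim_row A = dim_row B \<Longrightarrow> dim_col A = dim_col B \<Longrightarrow> map_mat cnj (A + B) = map_mat cnj A + map_mat cnj B"
  "map_mat cnj (mat_adjoint A) = mat_adjoint (map_mat cnj A)"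
  by (auto intro!: eq_matI simp: scalar_prod_def)

lemma mats_Reals_iff: "M \<in> mats \<real> r c \<longleftrightarrow> M \<in> carrier_mat r c \<and> map_mat cnj M = M"
  by (auto simp: mats_iff Reals_cnj_iff mat_eq_iff)

lemma lyapunov_solution_unique:
  assumes A: "A \<in> carrier_mat k k" and h: "hurwitz A" and Q: "Q \<in> carrier_mat k k"
    and "P \<in> carrier_mat k k" "P * A + mat_adjoint A * P + Q = 0\<^sub>m k k"
    and "P' \<in> carrier_mat k k" "P' * A + mat_adjoint A * P' + Q = 0\<^sub>m k k"
  shows "P = P'"
proof -
  have "(P - P') * A + mat_adjoint A * (P - P') = (P * A + mat_adjoint A * P + Q) - (P' * A + mat_adjoint A * P' + Q)"
  proof -
    define X X' Y Y' where "X = P * A" and "X' = P' * A" and "Y = mat_adjoint A * P" and "Y' = mat_adjoint A * P'"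
    have "X \<in> carrier_mat k k" "X' \<in> carrier_mat k k" "Y \<in> carrier_mat k k" "Y' \<in> carrier_mat k k"
      using assms by (auto simp: X_def X'_def Y_def Y'_def)
    hence "(X - X') + (Y - Y') = (X + Y + Q) - (X' + Y' + Q)"
      using Q by (intro eq_matI) auto
    moreover have "(P - P') * A = X - X'" "mat_adjoint A * (P - P') = Y - Y'"
      unfolding X_def X'_def Y_def Y'_def using assms(1,4,6)
      by (intro minus_mult_distrib_mat[of _ k k] mult_minus_distrib_mat[of _ k k]; simp)+
    ultimately show ?thesis by (simp only: X_def X'_def Y_def Y'_def)
  qed
  also have "\<dots> = 0\<^sub>m k k" unfolding assms by auto
  finally have z: "(P - P') * A + mat_adjoint A * (P - P') = 0\<^sub>m k k" .
  have "P - P' = 0\<^sub>m k k"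
    by (rule lyapunov_unique[OF A h _ z]) (use assms(4,6) in \<open>simp add: minus_carrier_mat\<close>)
  hence "(P - P') $$ (i,j) = 0" if "i < k" "j < k" for i j using that by simp
  thus ?thesis using assms(4,6) by (intro eq_matI) auto
qed

text \<open>Complex conjugation (for real data) and the adjoint (for Hermitian \<open>Q\<close>)
  each map the equation to itself, so by uniqueness the solution is real and Hermitian. Its form is
  non-negative because it is the solution given by the series.\<close>

lemma lyapunov_solution_field:
  assumes F: "F = \<real> \<or> F = UNIV" and A: "A \<in> mats F k k" and h: "hurwitz A"
    and Q: "Q \<in> mats F k k" and pd: "pos_def Q"
  shows "\<exists>!P. lyapunov_solution F k A Q P"
    "lyapunov_solution F k A Q P \<Longrightarrow> mat_adjoint P = P"
    "lyapunov_solution F k A Q P \<Longrightarrow> v \<in> carrier_vec k \<Longrightarrow> Re (qform P v) \<ge> 0"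
proof -
  note cA = mats_carrier[OF A] and cQ = mats_carrier[OF Q]
  note uniq = lyapunov_solution_unique[OF cA h cQ]
  obtain P0 where P0: "P0 \<in> carrier_mat k k" "P0 * A + mat_adjoint A * P0 + Q = 0\<^sub>m k k"
    "\<And>v. v \<in> carrier_vec k \<Longrightarrow> Re (qform P0 v) \<ge> 0"
    using lyapunov_exists[OF cA h cQ] form_nonneg_pos_def[OF cQ pd] by blast
  have "P0 \<in> mats F k k"
  proof (cases "F = UNIV")
    case True
    thus ?thesis using P0(1) by (simp add: mats_iff)
  next
    case False
    hence R: "F = \<real>" using F by simp
    have "map_mat cnj (P0 * A + mat_adjoint A * P0 + Q) = 0\<^sub>m k k"
      unfolding P0(2) by auto
    hence "map_mat cnj P0 * A + mat_adjoint A * map_mat cnj P0 + Q = 0\<^sub>m k k"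
      using A Q P0(1) cA cQ by (simp add: map_mat_cnj_simps R mats_Reals_iff)
    hence "map_mat cnj P0 = P0" using P0(1) by (intro uniq[OF _ _ P0(1,2)]) auto
    thus ?thesis using P0(1) by (simp add: R mats_Reals_iff)
  qed
  hence sol: "lyapunov_solution F k A Q P \<longleftrightarrow> P = P0" for P
    using P0 uniq by (auto simp: lyapunov_solution_def mats_carrier)
  thus "\<exists>!P. lyapunov_solution F k A Q P" by auto
  show "Re (qform P v) \<ge> 0" if "lyapunov_solution F k A Q P" "v \<in> carrier_vec k"
    using that sol P0(3) by auto
  have "mat_adjoint (P0 * A + mat_adjoint A * P0 + Q) = 0\<^sub>m k k"
    unfolding P0(2) by (rule mat_adjoint_zero)
  hence "mat_adjoint A * mat_adjoint P0 + mat_adjoint P0 * A + Q = 0\<^sub>m k k"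
    using P0(1) cA cQ pd by (simp add: mat_adjoint_simps pos_def_iff[OF cQ])
  hence "mat_adjoint P0 * A + mat_adjoint A * mat_adjoint P0 + Q = 0\<^sub>m k k"
    using P0(1) cA cQ by (subst comm_add_mat[of _ k k]) auto
  hence "mat_adjoint P0 = P0" using P0(1) by (intro uniq[OF _ _ P0(1,2)]) auto
  thus "mat_adjoint P = P" if "lyapunov_solution F k A Q P" using that sol by simp
qed

section \<open>Hidden modes\<close>

lemma (in vec_space) maximal_indpt_cols:
  "\<exists>S. maximal S (\<lambda>T. T \<subseteq> set (cols N) \<and> lin_indpt T)"
  using maximal_exists[of "\<lambda>T. T \<subseteq> set (cols N) \<and> lin_indpt T" "card (set (cols N))" "{}"]
  by (meson List.finite_set card_mono empty_iff empty_subsetI finite_lin_indpt2 rev_finite_subset)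

text \<open>Rank is tied to the set of columns, which forgets repetitions, so the link with linear
  independence covers distinct columns only. Two equal columns give the kernel vector
  \<open>e_i - e_j\<close>, and then the rank is at most the number of distinct columns, which is
  below \<open>nc\<close>.\<close>

lemma (in vec_space) rank_eq_nc_iff:
  assumes N: "N \<in> carrier_mat n nc"
  shows "rank N = nc \<longleftrightarrow> (\<forall>v \<in> carrier_vec nc. N *\<^sub>v v = 0\<^sub>v n \<longrightarrow> v = 0\<^sub>v nc)"
proof (cases "distinct (cols N)")
  case True
  show ?thesis
    using full_rank_lin_indpt[OF N _ True] lin_indpt_full_rank[OF N True] lin_depI[OF N _ _ _ True]
      lin_depE[OF N _ True] by metis
next
  case False
  then obtain i j where ij: "i < nc" "j < nc" "i \<noteq> j" "col N i = col N j"
    using N by (auto simp: distinct_conv_nth)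
  define v where "v = unit_vec nc i - (unit_vec nc j :: 'a vec)"
  have "v $ i = 1" using ij by (simp add: v_def)
  hence "v \<noteq> 0\<^sub>v nc" using ij by auto
  moreover have "N *\<^sub>v v = 0\<^sub>v n"
    using N ij by (auto simp: v_def mult_vec_minus_dims vec_eq_iff)
  moreover have "v \<in> carrier_vec nc" by (simp add: v_def)
  moreover have "rank N \<noteq> nc"
  proof -
    obtain S where S: "maximal S (\<lambda>T. T \<subseteq> set (cols N) \<and> lin_indpt T)" using maximal_indpt_cols by blast
    have "rank N = card S" by (rule rank_card_indpt[OF N S])
    also have "card S \<le> card (set (cols N))" using S by (simp add: card_mono maximal_def)
    also have "\<dots> < length (cols N)" using False card_distinct card_length nat_less_le by blast
    finally show ?thesis using N by simp
  qed
  ultimately show ?thesis by blast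
qed

text \<open>The kernel of the adjoint is the orthogonal complement of the column space. If it is
  trivial, the Gram matrix \<open>N N'\<close> is invertible, and \<open>N' (N N')^-1\<close> is a
  right inverse that produces preimages explicitly.\<close>

lemma rank_eq_nr_iff:
  fixes N :: "complex mat"
  assumes N: "N \<in> carrier_mat n nc"
  shows "vec_space.rank n N = n \<longleftrightarrow> (\<forall>x \<in> carrier_vec n. mat_adjoint N *\<^sub>v x = 0\<^sub>v nc \<longrightarrow> x = 0\<^sub>v n)"
proof -
  interpret vec_space "TYPE(complex)" n .
  have cols: "set (cols N) \<subseteq> carrier_vec n" using N cols_dim by blast
  have span: "span (set (cols N)) = {y \<in> carrier_vec n. \<exists>x\<in>carrier_vec nc. N *\<^sub>v x = y}"
    using col_space_eq[OF N] N by (simp add: col_space_def)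
  show ?thesis
  proof
    assume r: "rank N = n"
    obtain S where S: "maximal S (\<lambda>T. T \<subseteq> set (cols N) \<and> lin_indpt T)" using maximal_indpt_cols by blast
    hence S': "S \<subseteq> set (cols N)" "lin_indpt S" by (auto simp: maximal_def)
    have "card S = n" using rank_card_indpt[OF N S] r by simp
    hence "basis S" using S' cols dim_is_n fin_dim rev_finite_subset[OF List.finite_set S'(1)]
      by (intro dim_li_is_basis) auto
    hence "carrier_vec n \<subseteq> span (set (cols N))"
      using span_is_monotone[OF S'(1)] by (simp add: basis_def)
    show "\<forall>x \<in> carrier_vec n. mat_adjoint N *\<^sub>v x = 0\<^sub>v nc \<longrightarrow> x = 0\<^sub>v n"
    proof (intro ballI impI)
      fix x assume x: "x \<in> carrier_vec n" "mat_adjoint N *\<^sub>v x = 0\<^sub>v nc"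
      then obtain y where y: "y \<in> carrier_vec nc" "N *\<^sub>v y = x"
        using \<open>carrier_vec n \<subseteq> _\<close> span by auto
      have "x \<bullet>c x = (N *\<^sub>v y) \<bullet>c x" using y by simp
      also have "\<dots> = y \<bullet>c (mat_adjoint N *\<^sub>v x)" using x y N by (intro inner_mat_adjoint) auto
      also have "\<dots> = 0" using x y by simp
      finally show "x = 0\<^sub>v n" using x sqnorm_eq_0_iff[of x] by (simp add: inner_self)
    qed
  next
    assume k: "\<forall>x \<in> carrier_vec n. mat_adjoint N *\<^sub>v x = 0\<^sub>v nc \<longrightarrow> x = 0\<^sub>v n"
    have c: "N * mat_adjoint N \<in> carrier_mat n n" using N by auto
    have "det (N * mat_adjoint N) \<noteq> 0"
    proof (rule form_nonzero_det[OF c])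
      fix v :: "complex vec" assume v: "v \<in> carrier_vec n" "v \<noteq> 0\<^sub>v n"
      have "qform (N * mat_adjoint N) v = (mat_adjoint N *\<^sub>v v) \<bullet>c (mat_adjoint N *\<^sub>v v)"
        using N v by (simp add: mat_alg inner_mat_adjoint)
      moreover have "mat_adjoint N *\<^sub>v v \<noteq> 0\<^sub>v nc" using k v by auto
      ultimately show "qform (N * mat_adjoint N) v \<noteq> 0"
        using N by (simp add: inner_self sqnorm_eq_0_iff)
    qed
    note G = minv[OF c this]
    have "carrier_vec n \<subseteq> span (set (cols N))" unfolding span
    proof (intro subsetI CollectI conjI bexI)
      fix y :: "complex vec" assume y: "y \<in> carrier_vec n"
      have "N *\<^sub>v (mat_adjoint N *\<^sub>v (minv (N * mat_adjoint N) *\<^sub>v y)) = (N * mat_adjoint N) * minv (N * mat_adjoint N) *\<^sub>v y"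
        using N G(1) y by (simp add: mat_alg)
      thus "N *\<^sub>v (mat_adjoint N *\<^sub>v (minv (N * mat_adjoint N) *\<^sub>v y)) = y" using G y by simp
      show "mat_adjoint N *\<^sub>v (minv (N * mat_adjoint N) *\<^sub>v y) \<in> carrier_vec nc"
        using N G(1) y by (auto intro!: carrier_vecI)
    qed
    hence "span (set (cols N)) = carrier_vec n" using span by blast
    hence "vs (span (set (cols N))) = V" by (simp add: module_vec_def)
    thus "rank N = n" unfolding rank_def using dim_is_n by simp
  qed
qed

section \<open>Hautus tests for hidden modes\<close>

lemma append_rows_kernel:
  fixes M N :: "complex mat"
  assumes "M \<in> carrier_mat r n" "N \<in> carrier_mat k n" "v \<in> carrier_vec n"
  shows "(M @\<^sub>r N) *\<^sub>v v = 0\<^sub>v (r + k) \<longleftrightarrow> M *\<^sub>v v = 0\<^sub>v r \<and> N *\<^sub>v v = 0\<^sub>v k"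
proof -
  have "0\<^sub>v (r + k) = 0\<^sub>v r @\<^sub>v (0\<^sub>v k :: complex vec)" by auto
  thus ?thesis using assms by (auto simp: mat_mult_append[OF assms] append_vec_eq[of _ r])
qed

lemma unobservable_ev_iff:
  assumes "E \<in> carrier_mat n n" "A \<in> carrier_mat n n" "C \<in> carrier_mat m n"
  shows "unobservable_ev n m E A C z \<longleftrightarrow>
    (\<exists>v \<in> carrier_vec n. v \<noteq> 0\<^sub>v n \<and> (z \<cdot>\<^sub>m E - A) *\<^sub>v v = 0\<^sub>v n \<and> C *\<^sub>v v = 0\<^sub>v m)"
proof -
  have c: "z \<cdot>\<^sub>m E - A \<in> carrier_mat n n" using assms by auto
  show ?thesis
    unfolding unobservable_ev_def vec_space.rank_eq_nc_iff[OF carrier_append_rows[OF c assms(3)]]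
    using append_rows_kernel[OF c assms(3)] by blast
qed

text \<open>The Hautus test with left vectors. The adjoint of the wide block matrix is a stack of
  two blocks, so both tests rest on the same kernel computation.\<close>

lemma uncontrollable_ev_iff:
  assumes "E \<in> carrier_mat n n" "A \<in> carrier_mat n n" "B \<in> carrier_mat n m"
  shows "uncontrollable_ev n m E A B z \<longleftrightarrow>
    (\<exists>x \<in> carrier_vec n. x \<noteq> 0\<^sub>v n \<and> mat_adjoint (z \<cdot>\<^sub>m E - A) *\<^sub>v x = 0\<^sub>v n \<and> mat_adjoint B *\<^sub>v x = 0\<^sub>v m)"
proof -
  define N where "N = four_block_mat (z \<cdot>\<^sub>m E - A) B (0\<^sub>m 0 n) (0\<^sub>m 0 m)"
  have c: "mat_adjoint (z \<cdot>\<^sub>m E - A) \<in> carrier_mat n n" "mat_adjoint B \<in> carrier_mat m n" using assms by auto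
  have N: "N \<in> carrier_mat n (n + m)"
    using four_block_carrier_mat[of "z \<cdot>\<^sub>m E - A" n n "0\<^sub>m 0 m" 0 m B "0\<^sub>m 0 n"] assms
    by (simp add: N_def minus_carrier_mat)
  have "mat_adjoint N = mat_adjoint (z \<cdot>\<^sub>m E - A) @\<^sub>r mat_adjoint B"
    using assms by (intro eq_matI) (auto simp: N_def append_rows_def)
  thus ?thesis
    unfolding uncontrollable_ev_def N_def[symmetric] rank_eq_nr_iff[OF N]
    using append_rows_kernel[OF c] by (metis (no_types, lifting))
qed

text \<open>The form of \<open>G = M M' + B B'\<close> is a sum of two squared norms, which vanish
  together only at an uncontrollable mode; so \<open>G\<close> is invertible and
  \<open>(M' G^-1, B' G^-1)\<close> solves the Bezout equation at \<open>z\<close>.\<close>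

lemma controllable_right_inverse:
  assumes "E \<in> carrier_mat n n" "A \<in> carrier_mat n n" "B \<in> carrier_mat n m"
    and nc: "\<not> uncontrollable_ev n m E A B z"
  obtains X Y where "X \<in> carrier_mat n n" "Y \<in> carrier_mat m n" "(z \<cdot>\<^sub>m E - A) * X + B * Y = 1\<^sub>m n"
proof -
  define M where "M = z \<cdot>\<^sub>m E - A"
  have M: "M \<in> carrier_mat n n" using assms by (auto simp: M_def)
  define G where "G = M * mat_adjoint M + B * mat_adjoint B"
  have G: "G \<in> carrier_mat n n" using M assms by (auto simp: G_def)
  have "det G \<noteq> 0"
  proof (rule form_nonzero_det[OF G])
    fix v :: "complex vec" assume v: "v \<in> carrier_vec n" "v \<noteq> 0\<^sub>v n"
    have "qform G v = of_real (sqnorm (mat_adjoint M *\<^sub>v v) + sqnorm (mat_adjoint B *\<^sub>v v))"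
      using M assms v by (simp add: G_def mat_alg inner_add inner_mat_adjoint inner_self)
    moreover have "mat_adjoint M *\<^sub>v v \<noteq> 0\<^sub>v n \<or> mat_adjoint B *\<^sub>v v \<noteq> 0\<^sub>v m"
      using nc v uncontrollable_ev_iff[OF assms(1-3)] by (auto simp: M_def)
    hence "sqnorm (mat_adjoint M *\<^sub>v v) \<noteq> 0 \<or> sqnorm (mat_adjoint B *\<^sub>v v) \<noteq> 0"
      using M assms(3) by (simp add: sqnorm_eq_0_iff)
    hence "sqnorm (mat_adjoint M *\<^sub>v v) + sqnorm (mat_adjoint B *\<^sub>v v) \<noteq> 0"
      by (simp add: add_nonneg_eq_0_iff sqnorm_nonneg)
    ultimately show "qform G v \<noteq> 0" by (metis of_real_eq_0_iff)
  qed
  note V = minv[OF G this]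
  have "M * (mat_adjoint M * minv G) + B * (mat_adjoint B * minv G) = G * minv G"
    using M assms V(1) by (simp add: mat_alg G_def)
  hence e: "(z \<cdot>\<^sub>m E - A) * (mat_adjoint M * minv G) + B * (mat_adjoint B * minv G) = 1\<^sub>m n"
    using V(2) by (simp only: M_def)
  show thesis
    by (rule that[OF _ _ e]) (use V(1) M assms in auto)
qed

section \<open>The descriptor system and its inverse\<close>

locale descriptor_system =
  fixes n m :: nat and E A B C D :: "complex mat"
  assumes E: "E \<in> carrier_mat n n" and A: "A \<in> carrier_mat n n" and B: "B \<in> carrier_mat n m"
    and C: "C \<in> carrier_mat m n" and D: "D \<in> carrier_mat m m"
    and pencil_det: "det (s_rm \<cdot>\<^sub>m const_rm E - const_rm A) \<noteq> 0"
begin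

definition "pencil = s_rm \<cdot>\<^sub>m const_rm E - const_rm A"

definition "G = transfer_fn E A B C D"

definition "Z = minv G"

lemma dims [simp]:
  "dim_row E = n" "dim_col E = n" "dim_row A = n" "dim_col A = n" "dim_row B = n" "dim_col B = m"
  "dim_row C = m" "dim_col C = n" "dim_row D = m" "dim_col D = m"
  using E A B C D by auto

lemma pencil: "pencil \<in> carrier_mat n n" "pencil \<in> mats (regular_at z) n n" "eval_rm pencil z = z \<cdot>\<^sub>m E - A"
proof -
  have r: "s_rm \<cdot>\<^sub>m const_rm E \<in> mats (regular_at z) n n" "const_rm A \<in> mats (regular_at z) n n" for z
    by (rule regular_at.mats_smult[OF s_rm_regular(1) const_rm_regular[OF E]] const_rm_regular[OF A])+
  show "pencil \<in> carrier_mat n n" by (rule mats_carrier[OF regular_at.mats_minus[OF r, of 0, folded pencil_def]])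
  show "pencil \<in> mats (regular_at z) n n" unfolding pencil_def using r by (rule regular_at.mats_minus)
  show "eval_rm pencil z = z \<cdot>\<^sub>m E - A"
    using eval_rm_minus[OF r] eval_rm_smult[OF s_rm_regular(1) const_rm_regular[OF E]] by (simp add: pencil_def)
qed

lemma minv_pencil: "minv pencil \<in> carrier_mat n n" "pencil * minv pencil = 1\<^sub>m n" "minv pencil * pencil = 1\<^sub>m n"
  using minv[OF pencil(1)] pencil_det by (auto simp: pencil_def)

lemma G_eq: "G = const_rm C * minv pencil * const_rm B + const_rm D"
  by (simp add: G_def transfer_fn_def pencil_def)

lemma G: "G \<in> carrier_mat m m"
  unfolding G_eq by (rule add_carrier_mat) (simp add: D)

lemma dims_rm [simp]: "dim_row pencil = n" "dim_col pencil = n" "dim_row (minv pencil) = n"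
  "dim_col (minv pencil) = n" "dim_row G = m" "dim_col G = m"
  using pencil(1) minv_pencil(1) G by auto

text \<open>The constant Bezout factors at \<open>z\<close> give a matrix \<open>W\<close> with
  value 1 at \<open>z\<close>, hence with an inverse that is regular at \<open>z\<close>. The
  product \<open>X W\<close> combines the two regular products of the hypotheses, and
  \<open>X = (X W) W^-1\<close>.\<close>

lemma regular_if_controllable:
  assumes X: "X \<in> carrier_mat r n" and XM: "X * pencil \<in> mats (regular_at z) r n"
    and XB: "X * const_rm B \<in> mats (regular_at z) r m" and c: "\<not> uncontrollable_ev n m E A B z"
  shows "X \<in> mats (regular_at z) r n"
proof -
  obtain V Y where VY: "V \<in> carrier_mat n n" "Y \<in> carrier_mat m n" "(z \<cdot>\<^sub>m E - A) * V + B * Y = 1\<^sub>m n"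
    using controllable_right_inverse[OF E A B c] by blast
  note V = const_rm_regular[OF VY(1)] and Y = const_rm_regular[OF VY(2)] and Br = const_rm_regular[OF B]
  define W where "W = pencil * const_rm V + const_rm B * const_rm Y"
  have W: "W \<in> mats (regular_at z) n n"
    unfolding W_def by (intro regular_at.mats_add regular_at.mats_mult[OF pencil(2) V] regular_at.mats_mult[OF Br Y])
  have "eval_rm W z = (z \<cdot>\<^sub>m E - A) * V + B * Y"
    unfolding W_def eval_rm_add[OF regular_at.mats_mult[OF pencil(2) V] regular_at.mats_mult[OF Br Y]]
      eval_rm_mult[OF pencil(2) V] eval_rm_mult[OF Br Y] by (simp add: pencil(3))
  hence W1: "det (eval_rm W z) \<noteq> 0" by (simp add: VY)
  have "X * W = X * pencil * const_rm V + X * const_rm B * const_rm Y"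
    using X VY by (simp add: W_def mult_add_dims mult_assoc_dims)
  also have "\<dots> \<in> mats (regular_at z) r n"
    by (intro regular_at.mats_add regular_at.mats_mult[OF XM V] regular_at.mats_mult[OF XB Y])
  finally have XW: "X * W \<in> mats (regular_at z) r n" .
  note m = minv[OF mats_carrier[OF W] det_nonzero_eval[OF W W1]]
  have "X = X * W * minv W"
    using X W m by (simp add: mult_assoc_dims mats_dim)
  thus ?thesis using regular_at.mats_mult[OF XW eval_rm_minv(1)[OF W W1]] by simp
qed

text \<open>Since \<open>G\<close> need not have a value at \<open>z\<close>, the relation
  \<open>y = G(z) u\<close> cannot be inverted directly. Instead \<open>X = Z C (sE - A)^-1\<close>
  satisfies \<open>X (sE - A) = Z C\<close> and \<open>X B = 1 - Z D\<close>. Both right-hand sides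
  are regular, hence so is \<open>X\<close>, and evaluating the two identities along
  \<open>(z E - A) v = B u\<close> gives the claim.\<close>

lemma eval_inverse_at_output:
  assumes dG: "det G \<noteq> 0" and Zr: "Z \<in> mats (regular_at z) m m"
    and c: "\<not> uncontrollable_ev n m E A B z"
    and v: "v \<in> carrier_vec n" and u: "u \<in> carrier_vec m" and eq: "(z \<cdot>\<^sub>m E - A) *\<^sub>v v = B *\<^sub>v u"
  shows "eval_rm Z z *\<^sub>v (C *\<^sub>v v + D *\<^sub>v u) = u"
proof -
  note Zm = minv[OF G dG, folded Z_def]
  have Zd: "dim_row Z = m" "dim_col Z = m" using Zm(1) by auto
  note Cr = const_rm_regular[OF C] and Br = const_rm_regular[OF B] and Dr = const_rm_regular[OF D]
  define X where "X = Z * const_rm C * minv pencil"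
  have X: "X \<in> carrier_mat m n" using Zd by (auto simp: X_def)
  have XM: "X * pencil = Z * const_rm C"
    using Zd by (simp add: X_def mult_assoc_dims minv_pencil mult_one_dims)
  have "X * const_rm B + Z * const_rm D = Z * G"
    using Zd by (simp add: X_def G_eq mult_assoc_dims mult_add_dims)
  hence XBD: "X * const_rm B + Z * const_rm D = 1\<^sub>m m" by (simp add: Zm)
  have XB: "X * const_rm B = 1\<^sub>m m - Z * const_rm D"
  proof (rule eq_matI)
    fix i j assume "i < dim_row (1\<^sub>m m - Z * const_rm D)" "j < dim_col (1\<^sub>m m - Z * const_rm D)"
    hence ij: "i < m" "j < m" using Zd by auto
    have "(X * const_rm B + Z * const_rm D) $$ (i,j) = 1\<^sub>m m $$ (i,j)" by (simp only: XBD)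
    moreover have "(X * const_rm B + Z * const_rm D) $$ (i,j) = (X * const_rm B) $$ (i,j) + (Z * const_rm D) $$ (i,j)"
      using ij Zd X by (intro index_add_mat) auto
    moreover have "(1\<^sub>m m - Z * const_rm D) $$ (i,j) = 1\<^sub>m m $$ (i,j) - (Z * const_rm D) $$ (i,j)"
      using ij Zd by (intro index_minus_mat) auto
    ultimately show "(X * const_rm B) $$ (i,j) = (1\<^sub>m m - Z * const_rm D) $$ (i,j)"
      by (metis add_diff_cancel_right')
  qed (use X Zd in auto)
  have ZC: "Z * const_rm C \<in> mats (regular_at z) m n" by (rule regular_at.mats_mult[OF Zr Cr])
  have ZD: "Z * const_rm D \<in> mats (regular_at z) m m" by (rule regular_at.mats_mult[OF Zr Dr])
  have Xr: "X \<in> mats (regular_at z) m n"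
    by (rule regular_if_controllable[OF X _ _ c])
      (simp_all add: XM XB ZC regular_at.mats_minus[OF regular_at.mats_one ZD])
  define Y where "Y = eval_rm X z"
  define Zz where "Zz = eval_rm Z z"
  have Y: "Y \<in> carrier_mat m n" and Zz: "Zz \<in> carrier_mat m m" using X Zm by (auto simp: Y_def Zz_def)
  have 1: "Y * (z \<cdot>\<^sub>m E - A) = Zz * C"
    using arg_cong[OF XM, of "\<lambda>M. eval_rm M z"]
    by (simp add: eval_rm_mult[OF Xr pencil(2)] eval_rm_mult[OF Zr Cr] pencil(3) Y_def Zz_def)
  have 2: "Y * B = 1\<^sub>m m - Zz * D"
    using arg_cong[OF XB, of "\<lambda>M. eval_rm M z"]
    by (simp add: eval_rm_mult[OF Xr Br] eval_rm_minus[OF regular_at.mats_one ZD] eval_rm_mult[OF Zr Dr]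
        eval_rm_one Y_def Zz_def)
  have "Zz *\<^sub>v (C *\<^sub>v v + D *\<^sub>v u) = (Zz * C) *\<^sub>v v + (Zz * D) *\<^sub>v u"
    using Zz v u by (simp add: mult_vec_add_dims mult_vec_assoc_dims)
  also have "(Zz * C) *\<^sub>v v = (Y * B) *\<^sub>v u"
    unfolding 1[symmetric] using Y v u by (simp add: mult_vec_assoc_dims eq)
  also have "\<dots> = u - (Zz * D) *\<^sub>v u" unfolding 2 using Zz u by (simp add: minus_mult_vec_dims)
  also have "u - (Zz * D) *\<^sub>v u + (Zz * D) *\<^sub>v u = u"
    using u Zz by (intro eq_vecI) auto
  finally show ?thesis by (simp add: Zz_def)
qed

section \<open>The two objectives from properties of the inverse\<close>

lemma stability_if_inverse_regular:
  assumes K: "K \<in> carrier_mat m m" and dK: "det (1\<^sub>m m - K * D) \<noteq> 0" and dG: "det G \<noteq> 0"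
    and Zr: "\<And>z. Re z \<ge> 0 \<Longrightarrow> Z \<in> mats (regular_at z) m m"
    and ZK: "\<And>z. Re z \<ge> 0 \<Longrightarrow> det (eval_rm Z z - K) \<noteq> 0"
    and hid: "hidden_modes_condition n m E A B C"
  shows "stability_objective E A B C D K"
  unfolding stability_objective_def stable_pair_def
proof (intro allI impI, rule ccontr)
  fix z
  define S where "S = minv (1\<^sub>m (dim_row K) - K * D)"
  assume "pair_eigenvalue E (A + B * minv (1\<^sub>m (dim_row K) - K * D) * K * C) z" and "\<not> Re z < 0"
  hence z: "Re z \<ge> 0" by simp
  from \<open>pair_eigenvalue _ _ _\<close> obtain v where v: "v \<in> carrier_vec n" "v \<noteq> 0\<^sub>v n"
    "(z \<cdot>\<^sub>m E - (A + B * S * K * C)) *\<^sub>v v = 0\<^sub>v n"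
    by (auto simp: pair_eigenvalue_def S_def)
  have K1: "1\<^sub>m m - K * D \<in> carrier_mat m m" by (rule minus_carrier_mat[OF mult_carrier_mat[OF K D]])
  have "dim_row K = m" using K by simp
  note S = minv[OF K1 dK, folded S_def[unfolded \<open>dim_row K = m\<close>]]
  \<comment> \<open>The plant input belonging to the mode. Applying \<open>1 - K * D\<close> unwinds
    the algebraic loop through \<open>D\<close> and yields \<open>u = K (C v + D u)\<close>.\<close>
  define u where "u = S *\<^sub>v (K *\<^sub>v (C *\<^sub>v v))"
  have u: "u \<in> carrier_vec m" using S(1) by (auto simp: u_def intro: carrier_vecI)
  define a where "a = (z \<cdot>\<^sub>m E - A) *\<^sub>v v"
  have a: "a \<in> carrier_vec n" by (auto simp: a_def intro: carrier_vecI)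
  have "(z \<cdot>\<^sub>m E - (A + B * S * K * C)) *\<^sub>v v = a - B *\<^sub>v u"
  proof -
    have "z \<cdot>\<^sub>m E - (A + B * S * K * C) = (z \<cdot>\<^sub>m E - A) - B * S * K * C"
      using S(1) K by (intro eq_matI) auto
    thus ?thesis using S(1) K v(1) by (simp only: minus_mult_vec_dims) (simp add: a_def u_def mat_alg)
  qed
  hence "a - B *\<^sub>v u = 0\<^sub>v n" using v(3) by metis
  moreover have Bu: "B *\<^sub>v u \<in> carrier_vec n" by (auto intro: carrier_vecI)
  ultimately have aB: "a = B *\<^sub>v u" using iffD1[OF vec_diff_eq_iff[OF a Bu zero_carrier_vec]] by (metis left_zero_vec)
  have "(1\<^sub>m m - K * D) *\<^sub>v u = ((1\<^sub>m m - K * D) * S) *\<^sub>v (K *\<^sub>v (C *\<^sub>v v))"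
    using S(1) K unfolding u_def by (intro mult_vec_assoc_dims[symmetric]) auto
  also have "\<dots> = K *\<^sub>v (C *\<^sub>v v)" using K by (simp add: S mult_one_dims)
  finally have "u - K *\<^sub>v (D *\<^sub>v u) = K *\<^sub>v (C *\<^sub>v v)" using K u by (simp add: mat_alg)
  hence uKD: "u = K *\<^sub>v (C *\<^sub>v v) + K *\<^sub>v (D *\<^sub>v u)"
    by (rule iffD1[OF vec_diff_eq_iff, rotated -1]) (use u K in \<open>auto intro: carrier_vecI\<close>)
  define y where "y = C *\<^sub>v v + D *\<^sub>v u"
  have y: "y \<in> carrier_vec m" by (auto simp: y_def intro: carrier_vecI)
  have "K *\<^sub>v y = K *\<^sub>v (C *\<^sub>v v) + K *\<^sub>v (D *\<^sub>v u)" using K by (simp add: y_def mult_vec_add_dims)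
  hence uK: "u = K *\<^sub>v y" using uKD by metis
  have nc: "\<not> uncontrollable_ev n m E A B z" and no: "\<not> unobservable_ev n m E A C z"
    using hid z by (meson hidden_modes_condition_def not_le)+
  have Zz: "eval_rm Z z \<in> carrier_mat m m" using mats_carrier[OF Zr[OF z]] by simp
  have "eval_rm Z z *\<^sub>v y = K *\<^sub>v y"
    using trans[OF eval_inverse_at_output[OF dG Zr[OF z] nc v(1) u aB[unfolded a_def], folded y_def] uK] .
  moreover have "(eval_rm Z z - K) *\<^sub>v y = eval_rm Z z *\<^sub>v y - K *\<^sub>v y"
    using Zz K y by (intro minus_mult_vec_dims) auto
  ultimately have "(eval_rm Z z - K) *\<^sub>v y = K *\<^sub>v y - K *\<^sub>v y" by simp
  also have "\<dots> = 0\<^sub>v m" using K by (intro eq_vecI) auto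
  finally have "(eval_rm Z z - K) *\<^sub>v y = 0\<^sub>v m" .
  hence y0: "y = 0\<^sub>v m"
    using ZK[OF z] det_nonzero_iff_kernel[of "eval_rm Z z - K" m] y K by (simp add: minus_carrier_mat)
  have u0: "u = 0\<^sub>v m" unfolding uK y0 using K by simp
  have "C *\<^sub>v v = 0\<^sub>v m"
    using y0 unfolding y_def u0 by (auto simp: vec_eq_iff)
  moreover have "(z \<cdot>\<^sub>m E - A) *\<^sub>v v = 0\<^sub>v n"
    using aB unfolding a_def u0 by simp
  ultimately show False using no v unobservable_ev_iff[OF E A C] by blast
qed

text \<open>With \<open>T = Z(z) - K\<close> and \<open>Y = T^-1\<close>, the congruence
  \<open>Y' (L'T + T'L) Y\<close> equals \<open>L Y + (L Y)'\<close>. The inverse exists by the same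
  positivity: a kernel vector of \<open>L'T\<close> would make the form vanish.\<close>

lemma spr_if_inverse_positive:
  assumes K: "K \<in> carrier_mat m m" and L: "L \<in> carrier_mat m m" "det L \<noteq> 0" and dG: "det G \<noteq> 0"
    and e: "e > 0"
    and Zr: "\<And>z. Re z \<ge> - e \<Longrightarrow> Z \<in> mats (regular_at z) m m"
    and pos: "\<And>z. Re z \<ge> - e \<Longrightarrow> pos_def (mat_adjoint L * (eval_rm Z z - K) + mat_adjoint (mat_adjoint L * (eval_rm Z z - K)))"
  shows "spr_objective G K L" "\<And>z. Re z \<ge> - e \<Longrightarrow> det (eval_rm Z z - K) \<noteq> 0"
proof -
  note Zm = minv[OF G dG, folded Z_def]
  have Zd [simp]: "dim_row Z = m" "dim_col Z = m" using Zm(1) by auto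
  have Kd [simp]: "dim_row K = m" "dim_col K = m" "dim_row L = m" "dim_col L = m" using K L by auto
  have ZKr: "Z - const_rm K \<in> mats (regular_at z) m m" if "Re z \<ge> - e" for z
    using regular_at.mats_minus[OF Zr[OF that] const_rm_regular[OF K]] .
  have ZKe: "eval_rm (Z - const_rm K) z = eval_rm Z z - K" if "Re z \<ge> - e" for z
    using eval_rm_minus[OF Zr[OF that] const_rm_regular[OF K]] by simp
  show d: "det (eval_rm Z z - K) \<noteq> 0" if z: "Re z \<ge> - e" for z
  proof -
    let ?T = "mat_adjoint L * (eval_rm Z z - K)"
    have T: "?T \<in> carrier_mat m m" by auto
    have c: "?T + mat_adjoint ?T \<in> carrier_mat m m" by auto
    have "det ?T \<noteq> 0"
    proof (rule form_nonzero_det[OF T])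
      fix v :: "complex vec" assume v: "v \<in> carrier_vec m" "v \<noteq> 0\<^sub>v m"
      have "Re (qform (?T) v) > 0"
        using pos[OF z] v Re_form_add_adjoint[OF T v(1)] by (auto simp: pos_def_iff[OF c])
      thus "qform (?T) v \<noteq> 0" by auto
    qed
    thus ?thesis
      using det_mult[OF mat_adjoint_carrier[OF L(1)], of "eval_rm Z z - K"] by (auto simp: minus_carrier_mat K)
  qed
  \<comment> \<open>The point 0 lies in the half plane, and one invertible value is enough.\<close>
  have dZK: "det (Z - const_rm K) \<noteq> 0"
    using det_nonzero_eval[OF ZKr, of 0] d[of 0] ZKe[of 0] e by auto
  have ZK: "Z - const_rm K \<in> carrier_mat m m" using K by (simp add: minus_carrier_mat)
  have fac: "1\<^sub>m m - G * const_rm K = G * (Z - const_rm K)"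
    using Zm by (simp add: mult_minus_dims)
  have dfac: "det (1\<^sub>m m - G * const_rm K) \<noteq> 0"
    unfolding fac using det_mult[OF G ZK] dG dZK by simp
  have "minv (1\<^sub>m m - G * const_rm K) = minv (Z - const_rm K) * Z"
    unfolding fac minv_mult[OF G dG ZK dZK] by (simp add: Z_def)
  hence H: "const_rm L * minv (1\<^sub>m m - G * const_rm K) * G = const_rm L * minv (Z - const_rm K)"
    using minv(1)[OF ZK dZK] by (simp add: mult_assoc_dims Zm mult_one_dims)
  have "strictly_positive_real (const_rm L * minv (Z - const_rm K))"
    unfolding strictly_positive_real_def
  proof (intro conjI exI[of _ e] e allI impI)
    show "square_mat (const_rm L * minv (Z - const_rm K))" using minv(1)[OF ZK dZK] by simp
    fix z assume "Re z \<ge> - e \<and> \<not> pole_rm (const_rm L * minv (Z - const_rm K)) z"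
    hence z: "Re z \<ge> - e" by simp
    have d': "det (eval_rm (Z - const_rm K) z) \<noteq> 0" using d[OF z] ZKe[OF z] by simp
    note mr = eval_rm_minv[OF ZKr[OF z] d', unfolded ZKe[OF z]]
    define T where "T = eval_rm Z z - K"
    define Y where "Y = minv T"
    have T: "T \<in> carrier_mat m m" by (simp add: T_def minus_carrier_mat K)
    note Y = minv[OF T d[OF z, folded T_def], folded Y_def]
    have "eval_rm (const_rm L * minv (Z - const_rm K)) z = L * Y"
      by (simp add: eval_rm_mult[OF const_rm_regular[OF L(1)] mr(1)] mr(2) Y_def T_def)
    moreover have "pos_def (mat_adjoint Y * (mat_adjoint L * T + mat_adjoint (mat_adjoint L * T)) * Y)"
      using pos[OF z, folded T_def] minv_minv(2)[OF T d[OF z, folded T_def], folded Y_def] Y(1)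
      by (intro pos_def_congruence[of _ m]) (use T in auto)
    moreover have "mat_adjoint Y * (mat_adjoint L * T + mat_adjoint (mat_adjoint L * T)) * Y
        = L * Y + mat_adjoint (L * Y)"
    proof -
      have "mat_adjoint Y * (mat_adjoint L * T + mat_adjoint (mat_adjoint L * T)) * Y
         = mat_adjoint Y * mat_adjoint L * (T * Y) + mat_adjoint (T * Y) * (L * Y)"
        using T Y(1) by (simp add: mat_adjoint_mult mat_alg)
      also have "\<dots> = mat_adjoint (L * Y) + L * Y"
        using Y(1) by (simp add: Y(2) mat_adjoint_one mat_adjoint_mult mult_one_dims)
      also have "\<dots> = L * Y + mat_adjoint (L * Y)" using Y(1) by (intro comm_add_mat[of _ m m]) auto
      finally show ?thesis .
    qed
    ultimately show "pos_def (eval_rm (const_rm L * minv (Z - const_rm K)) z +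
       mat_adjoint (eval_rm (const_rm L * minv (Z - const_rm K)) z))" by simp
  qed
  thus "spr_objective G K L"
    using dfac invertible_mat_iff_det[OF minus_carrier_mat[OF mult_carrier_mat[OF G, of "const_rm K" m]], of "1\<^sub>m m"] K
    by (simp add: spr_objective_def H)
qed

end

section \<open>Sufficiency\<close>

text \<open>The parallelogram law, with the non-negative term at \<open>t - y\<close>
  dropped.\<close>

lemma psd_form_add_le:
  fixes P :: "complex mat"
  assumes P: "P \<in> carrier_mat k k" and nn: "\<And>v. v \<in> carrier_vec k \<Longrightarrow> Re (qform P v) \<ge> 0"
    and t: "t \<in> carrier_vec k" and y: "y \<in> carrier_vec k"
  shows "Re (qform P (t + y)) \<le> 2 * Re (qform P t) + 2 * Re (qform P y)"
proof -
  have "Re (qform P (t + y)) + Re (qform P (t - y))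
      = 2 * Re (qform P t) + 2 * Re (qform P y)"
    using P t y by (simp add: mult_vec_add_dims mult_vec_minus_dims inner_add)
  moreover have "Re (qform P (t - y)) \<ge> 0" using t y by (intro nn) auto
  ultimately show ?thesis by linarith
qed

text \<open>Completing the square in the Lyapunov equation along the state equation
  \<open>s z = A\<^sub>2 z + B\<^sub>2 w\<close>.\<close>

lemma kyp_identity:
  fixes A2 B2 C2 L P Q :: "complex mat"
  assumes A2: "A2 \<in> carrier_mat k k" and B2: "B2 \<in> carrier_mat k m" and C2: "C2 \<in> carrier_mat m k"
    and L: "L \<in> carrier_mat m m" and P: "P \<in> carrier_mat k k" "mat_adjoint P = P"
    and Q: "Q \<in> carrier_mat k k" "mat_adjoint Q = Q" "det Q \<noteq> 0"
    and lyap: "P * A2 + mat_adjoint A2 * P + Q = 0\<^sub>m k k"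
    and z: "z \<in> carrier_vec k" and w: "w \<in> carrier_vec m" and zw: "s \<cdot>\<^sub>v z = A2 *\<^sub>v z + B2 *\<^sub>v w"
  defines "X \<equiv> P * B2 - mat_adjoint C2 * L"
  defines "y \<equiv> minv Q *\<^sub>v (X *\<^sub>v w)"
  shows "2 * Re ((mat_adjoint L *\<^sub>v (C2 *\<^sub>v z)) \<bullet>c w) + Re (qform (riccati_bound B2 C2 L P Q) w)
    = 2 * Re s * Re (qform P z) + Re (qform Q (z - y))"
proof -
  note mQ = minv[OF Q(1,3)]
  have X: "X \<in> carrier_mat k m" unfolding X_def by (rule minus_carrier_mat[OF mult_carrier_mat[OF mat_adjoint_carrier[OF C2] L]])
  have y: "y \<in> carrier_vec k" using mQ X w by (simp add: y_def)
  define b where "b = B2 *\<^sub>v w"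
  define a where "a = A2 *\<^sub>v z"
  define p where "p = P *\<^sub>v z"
  define x where "x = X *\<^sub>v w"
  define l where "l = L *\<^sub>v w"
  note defs = b_def a_def p_def x_def l_def
  have c: "b \<in> carrier_vec k" "a \<in> carrier_vec k" "p \<in> carrier_vec k" "x \<in> carrier_vec k" "l \<in> carrier_vec m"
    using A2 B2 P X L z w by (auto simp: defs)
  have b: "b = s \<cdot>\<^sub>v z - a"
    unfolding zw b_def[symmetric] a_def[symmetric] using c by (intro eq_vecI) auto
  have 1: "(mat_adjoint L *\<^sub>v (C2 *\<^sub>v z)) \<bullet>c w = z \<bullet>c (mat_adjoint C2 *\<^sub>v l)"
    using L C2 z w by (simp add: inner_mat_adjoint l_def)
  have x: "x = P *\<^sub>v b - mat_adjoint C2 *\<^sub>v l"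
    using P B2 C2 L w unfolding x_def X_def b_def l_def
    by (subst minus_mult_vec_dims) (auto simp: mult_vec_assoc_dims)
  have 2: "z \<bullet>c (mat_adjoint C2 *\<^sub>v l) = z \<bullet>c (P *\<^sub>v b) - z \<bullet>c x"
    using c z P C2 unfolding x by (subst inner_add(4)) auto
  have 3: "z \<bullet>c (P *\<^sub>v b) = p \<bullet>c b"
    using inner_mat_adjoint[of P z b] P z c by (simp add: p_def)
  have 4: "p \<bullet>c b = cnj s * (p \<bullet>c z) - p \<bullet>c a"
    unfolding b using c z by (simp add: inner_add inner_smult)
  have pz: "p \<bullet>c z = of_real (Re (p \<bullet>c z))"
    unfolding p_def by (rule Re_hermitian_form[OF P z])
  \<comment> \<open>The Lyapunov equation read as a form at \<open>z\<close>: the free motion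
    \<open>a = A2 z\<close> contributes minus the form of \<open>Q\<close>.\<close>
  have "0 = qform (P * A2 + mat_adjoint A2 * P + Q) z"
    unfolding lyap using z by (simp add: inner_sum)
  also have "(P * A2 + mat_adjoint A2 * P + Q) *\<^sub>v z = P *\<^sub>v a + mat_adjoint A2 *\<^sub>v p + Q *\<^sub>v z"
    using P A2 Q z by (simp add: mat_alg a_def p_def)
  also have "\<dots> \<bullet>c z = (P *\<^sub>v a) \<bullet>c z + (mat_adjoint A2 *\<^sub>v p) \<bullet>c z + qform Q z"
    using P A2 Q z c by (simp add: inner_add)
  also have "(P *\<^sub>v a) \<bullet>c z = a \<bullet>c p"
    using inner_mat_adjoint[of P a z] P z c by (simp add: p_def)
  also have "a \<bullet>c p = cnj (p \<bullet>c a)" using c by (intro inner_cnj[symmetric]) auto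
  also have "(mat_adjoint A2 *\<^sub>v p) \<bullet>c z = p \<bullet>c a"
    using inner_mat_adjoint[of "mat_adjoint A2" p z] A2 z c by (simp add: a_def)
  finally have 5: "2 * Re (p \<bullet>c a) = - Re (qform Q z)"
    by (simp add: complex_eq_iff)
  \<comment> \<open>The shift solves \<open>Q y = x\<close>. Hence the cross terms of the form of
    \<open>Q\<close> at \<open>z - y\<close> are those of \<open>x\<close>, and its constant term is
    the Riccati bound.\<close>
  have "Q *\<^sub>v y = (Q * minv Q) *\<^sub>v x"
    unfolding y_def x_def[symmetric] using mQ(1) Q(1) c by (intro mult_vec_assoc_dims[symmetric]) auto
  hence Qy: "Q *\<^sub>v y = x" using c by (simp add: mQ(2) mult_one_dims)
  have 6: "qform (riccati_bound B2 C2 L P Q) w = y \<bullet>c x"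
    using mQ X w inner_mat_adjoint[of "mat_adjoint X" y w] y
    by (simp add: riccati_bound_def X_def[symmetric] mult_vec_assoc_dims y_def x_def)
  have 7: "(Q *\<^sub>v z) \<bullet>c y = z \<bullet>c x"
    using inner_mat_adjoint[of Q z y] Q z y by (simp add: Qy)
  have "qform Q (z - y) = qform Q z - (Q *\<^sub>v z) \<bullet>c y - x \<bullet>c z + x \<bullet>c y"
    using Q z y c by (simp add: mult_vec_minus_dims Qy inner_add)
  also have "x \<bullet>c z = cnj (z \<bullet>c x)" using c z by (intro inner_cnj[symmetric]) auto
  also have "x \<bullet>c y = cnj (y \<bullet>c x)" using c y by (intro inner_cnj[symmetric]) auto
  finally have 8: "Re (qform Q (z - y)) = Re (qform Q z) - 2 * Re (z \<bullet>c x) + Re (y \<bullet>c x)"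
    by (simp add: 7)
  have "Re (cnj s * (p \<bullet>c z)) = Re s * Re (p \<bullet>c z)" by (subst pz) simp
  thus ?thesis using 1 2 3 4 5 6 8 by (simp add: p_def)
qed

text \<open>For \<open>Re s >= 0\<close> the completed square suffices; to the left of the axis the
  terms \<open>2 Re s (w'Mw + z'Pz)\<close> become negative and must be absorbed. A bound of
  \<open>z\<close> by \<open>w\<close> uniform in \<open>s\<close> is not at hand, so
  \<open>z\<close> is split as \<open>t + y\<close> with \<open>y = Y w\<close>: the square controls
  \<open>t\<close>, and the strict inequality for \<open>N\<close> controls \<open>w\<close>. The
  form of \<open>M\<close> is real, so a large imaginary part of \<open>s\<close> does no
  harm.\<close>

lemma kyp_positive:
  fixes A2 B2 C2 L P Q N M :: "complex mat"
  assumes A2: "A2 \<in> carrier_mat k k" and B2: "B2 \<in> carrier_mat k m" and C2: "C2 \<in> carrier_mat m k"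
    and L: "L \<in> carrier_mat m m" and P: "P \<in> carrier_mat k k" "mat_adjoint P = P"
    and Pn: "\<And>v. v \<in> carrier_vec k \<Longrightarrow> Re (qform P v) \<ge> 0"
    and Q: "Q \<in> carrier_mat k k" "pos_def Q"
    and lyap: "P * A2 + mat_adjoint A2 * P + Q = 0\<^sub>m k k"
    and M: "M \<in> carrier_mat m m" "pos_semidef M" and N: "N \<in> carrier_mat m m"
    and W: "pos_def (N + mat_adjoint N - riccati_bound B2 C2 L P Q)"
  obtains e where "e > 0" "\<And>s. Re s \<ge> - e \<Longrightarrow> det (s \<cdot>\<^sub>m 1\<^sub>m k - A2) \<noteq> 0"
    "\<And>s T. Re s \<ge> - e \<Longrightarrow> T = s \<cdot>\<^sub>m M + mat_adjoint L * (C2 * minv (s \<cdot>\<^sub>m 1\<^sub>m k - A2) * B2) + N \<Longrightarrow>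
      pos_def (T + mat_adjoint T)"
proof -
  define X where "X = P * B2 - mat_adjoint C2 * L"
  define R where "R = riccati_bound B2 C2 L P Q"
  have Qh: "mat_adjoint Q = Q" and Qd: "det Q \<noteq> 0"
    using Q pos_def_det by (auto simp: pos_def_iff[OF Q(1)])
  note mQ = minv[OF Q(1) Qd]
  have X: "X \<in> carrier_mat k m" unfolding X_def by (rule minus_carrier_mat[OF mult_carrier_mat[OF mat_adjoint_carrier[OF C2] L]])
  have R: "R \<in> carrier_mat m m" using X mQ unfolding R_def riccati_bound_def X_def[symmetric] by auto
  define Y where "Y = minv Q * X"
  have Y: "Y \<in> carrier_mat k m" using mQ X by (simp add: Y_def)
  define J where "J = N + mat_adjoint N - R"
  have J: "J \<in> carrier_mat m m" using R by (simp add: J_def minus_carrier_mat)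
  have Mn: "mat_adjoint M = M" "\<And>v. v \<in> carrier_vec m \<Longrightarrow> Re (qform M v) \<ge> 0"
    using M by (auto simp: pos_semidef_iff[OF M(1)])
  obtain d1 where d1: "d1 > 0" "\<And>v. v \<in> carrier_vec k \<Longrightarrow> d1 * sqnorm v \<le> Re (qform Q v)"
    using pos_def_coercive[OF Q] by blast
  obtain d2 where d2: "d2 > 0" "\<And>v. v \<in> carrier_vec m \<Longrightarrow> d2 * sqnorm v \<le> Re (qform J v)"
    using pos_def_coercive[OF J] W by (auto simp: J_def R_def)
  obtain c1 where c1: "c1 > 0" "\<And>v. v \<in> carrier_vec m \<Longrightarrow> cmod (qform M v) \<le> c1 * sqnorm v"
    using form_bound[OF M(1)] by blast
  obtain c2 where c2: "c2 > 0" "\<And>v. v \<in> carrier_vec k \<Longrightarrow> cmod (qform P v) \<le> c2 * sqnorm v"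
    using form_bound[OF P(1)] by blast
  have YPY: "mat_adjoint Y * P * Y \<in> carrier_mat m m" using Y P by auto
  obtain c3 where c3: "c3 > 0" "\<And>v. v \<in> carrier_vec m \<Longrightarrow> cmod (qform (mat_adjoint Y * P * Y) v) \<le> c3 * sqnorm v"
    using form_bound[OF YPY] by blast
  \<comment> \<open>The loss is at most \<open>4 e c2\<close> times the squared norm of
    \<open>t\<close> plus \<open>2 e (c1 + 2 c3)\<close> times that of \<open>w\<close>. The two
    entries of the minimum limit these to half of the coercivity constants \<open>d1\<close> and
    \<open>d2\<close>.\<close>
  define e where "e = min (d1 / (8 * c2)) (d2 / (4 * (c1 + 2 * c3)))"
  have e: "e > 0" using d1 d2 c1 c2 c3 by (simp add: e_def)
  have "e \<le> d1 / (8 * c2)" "e \<le> d2 / (4 * (c1 + 2 * c3))" by (simp_all add: e_def)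
  hence e1: "4 * e * c2 \<le> d1 / 2" and e2: "2 * e * (c1 + 2 * c3) \<le> d2 / 2"
    using c1 c2 c3 by (simp_all add: pos_le_divide_eq mult_ac)
  \<comment> \<open>When \<open>s z = A2 z + B2 w\<close>, this is the form of \<open>T + T'\<close>
    at \<open>w\<close>. The lower bound below treats \<open>z\<close> and \<open>w\<close> as
    independent.\<close>
  define f where "f s z w = 2 * Re s * (Re (qform M w) + Re (qform P z))
     + Re (qform Q (z - Y *\<^sub>v w)) + Re (qform J w)" for s z w
  have f: "f s z w \<ge> d1 / 2 * sqnorm (z - Y *\<^sub>v w) + d2 / 2 * sqnorm w"
    if s: "Re s \<ge> - e" and z: "z \<in> carrier_vec k" and w: "w \<in> carrier_vec m" for s z w
  proof -
    define y where "y = Y *\<^sub>v w"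
    define t where "t = z - y"
    have y: "y \<in> carrier_vec k" using Y w by (simp add: y_def)
    have t: "t \<in> carrier_vec k" using y z by (simp add: t_def)
    have zt: "z = t + y" using y z by (auto simp: t_def)
    define h where "h = Re (qform M w)"
    define p where "p = Re (qform P z)"
    have h: "0 \<le> h" "h \<le> c1 * sqnorm w"
      using Mn(2)[OF w] c1(2)[OF w] complex_Re_le_cmod[of "qform M w"] by (auto simp: h_def)
    have "qform (mat_adjoint Y * P * Y) w = qform P y"
      using Y P w inner_mat_adjoint[of "mat_adjoint Y" "P *\<^sub>v y" w] by (simp add: mult_vec_assoc_dims mult_assoc_dims y_def)
    hence "Re (qform P y) \<le> c3 * sqnorm w"
      using c3(2)[OF w] complex_Re_le_cmod[of "qform P y"] by simp
    moreover have "Re (qform P t) \<le> c2 * sqnorm t"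
      using c2(2)[OF t] complex_Re_le_cmod[of "qform P t"] by simp
    ultimately have p: "0 \<le> p" "p \<le> 2 * c2 * sqnorm t + 2 * c3 * sqnorm w"
      using psd_form_add_le[OF P(1) Pn t y] Pn[OF z] by (auto simp: p_def zt)
    have "2 * (- Re s) * (h + p) \<le> 2 * e * (h + p)" using s h p by (intro mult_right_mono) auto
    also have "\<dots> \<le> 2 * e * (c1 * sqnorm w + (2 * c2 * sqnorm t + 2 * c3 * sqnorm w))"
      using e h p by (intro mult_left_mono) auto
    also have "\<dots> = 2 * e * (c1 + 2 * c3) * sqnorm w + 4 * e * c2 * sqnorm t" by (simp add: algebra_simps)
    also have "\<dots> \<le> d2 / 2 * sqnorm w + d1 / 2 * sqnorm t"
      using e1 e2 by (intro add_mono mult_right_mono) (auto simp: sqnorm_nonneg)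
    finally have "- (2 * Re s * (h + p)) \<le> d2 / 2 * sqnorm w + d1 / 2 * sqnorm t" by simp
    moreover have "Re (qform Q t) \<ge> d1 * sqnorm t" "Re (qform J w) \<ge> d2 * sqnorm w"
      using d1(2)[OF t] d2(2)[OF w] by auto
    ultimately show ?thesis
      unfolding f_def h_def[symmetric] p_def[symmetric] y_def[symmetric] t_def[symmetric] by simp
  qed
  have id: "2 * Re ((mat_adjoint L *\<^sub>v (C2 *\<^sub>v z)) \<bullet>c w) + Re (qform R w)
    = 2 * Re s * Re (qform P z) + Re (qform Q (z - Y *\<^sub>v w))"
    if "z \<in> carrier_vec k" "w \<in> carrier_vec m" "s \<cdot>\<^sub>v z = A2 *\<^sub>v z + B2 *\<^sub>v w" for s z w
  proof -
    have "minv Q *\<^sub>v (X *\<^sub>v w) = Y *\<^sub>v w" using mQ X that by (simp add: Y_def mult_vec_assoc_dims)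
    thus ?thesis using kyp_identity[OF A2 B2 C2 L P Q(1) Qh Qd lyap that] by (simp add: X_def R_def)
  qed
  have sA: "s \<cdot>\<^sub>m 1\<^sub>m k - A2 \<in> carrier_mat k k" for s using A2 by (simp add: minus_carrier_mat)
  have rel: "s \<cdot>\<^sub>v z = A2 *\<^sub>v z + b"
    if "z \<in> carrier_vec k" "b \<in> carrier_vec k" "(s \<cdot>\<^sub>m 1\<^sub>m k - A2) *\<^sub>v z = b" for s z b
  proof -
    have "s \<cdot>\<^sub>v z - A2 *\<^sub>v z = b" using that A2 by (simp add: mat_alg)
    hence "s \<cdot>\<^sub>v z = b + A2 *\<^sub>v z"
      using vec_diff_eq_iff[of "s \<cdot>\<^sub>v z" k "A2 *\<^sub>v z" b] that(1,2) A2 by simp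
    thus ?thesis using that(1,2) A2 comm_add_vec[of "A2 *\<^sub>v z" k b] by simp
  qed
  \<comment> \<open>A kernel vector is a state with zero input. For \<open>w = 0\<close> the
    identity makes \<open>f\<close> vanish, whereas \<open>f\<close> is coercive in
    \<open>z\<close>; so the same \<open>e\<close> also separates the spectrum of \<open>A2\<close>
    from the half plane.\<close>
  have det: "det (s \<cdot>\<^sub>m 1\<^sub>m k - A2) \<noteq> 0" if s: "Re s \<ge> - e" for s
    unfolding det_nonzero_iff_kernel[OF sA]
  proof (intro ballI impI, rule ccontr)
    fix z assume z: "z \<in> carrier_vec k" "(s \<cdot>\<^sub>m 1\<^sub>m k - A2) *\<^sub>v z = 0\<^sub>v k" "z \<noteq> 0\<^sub>v k"
    have B0: "B2 *\<^sub>v 0\<^sub>v m = 0\<^sub>v k" "Y *\<^sub>v 0\<^sub>v m = 0\<^sub>v k" using B2 Y by auto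
    have z0: "z - 0\<^sub>v k = z" using z by auto
    have "s \<cdot>\<^sub>v z = A2 *\<^sub>v z + B2 *\<^sub>v 0\<^sub>v m" using rel[OF z(1) _ z(2)] by (simp add: B0)
    moreover have "(mat_adjoint L *\<^sub>v (C2 *\<^sub>v z)) \<bullet> 0\<^sub>v m = 0"
      using L by (intro scalar_prod_right_zero) (auto intro: carrier_vecI)
    ultimately
    have "d1 / 2 * sqnorm z \<le> 0"
      using id[OF z(1), of "0\<^sub>v m" s] f[OF s z(1), of "0\<^sub>v m"] z0 L C2 R J M z(1)
      by (simp add: f_def B0 sqnorm_def)
    moreover have "sqnorm z > 0" using sqnorm_pos[of z] z by auto
    ultimately show False using d1(1) by (simp add: mult_le_0_iff)
  qed
  show thesis
  proof (rule that[OF e det])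
    fix s T assume s: "Re s \<ge> - e" and T: "T = s \<cdot>\<^sub>m M + mat_adjoint L * (C2 * minv (s \<cdot>\<^sub>m 1\<^sub>m k - A2) * B2) + N"
    note mA = minv[OF sA det[OF s]]
    have cT: "T \<in> carrier_mat m m" unfolding T by (rule add_carrier_mat[OF N])
    hence cTT: "T + mat_adjoint T \<in> carrier_mat m m" by auto
    have "Re (qform (T + mat_adjoint T) w) > 0" if w: "w \<in> carrier_vec m" "w \<noteq> 0\<^sub>v m" for w
    proof -
      define z where "z = minv (s \<cdot>\<^sub>m 1\<^sub>m k - A2) *\<^sub>v (B2 *\<^sub>v w)"
      have z: "z \<in> carrier_vec k" using mA(1) by (auto simp: z_def intro: carrier_vecI)
      have "(s \<cdot>\<^sub>m 1\<^sub>m k - A2) *\<^sub>v z = B2 *\<^sub>v w"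
        unfolding z_def using mult_vec_assoc_dims[of "s \<cdot>\<^sub>m 1\<^sub>m k - A2" "minv (s \<cdot>\<^sub>m 1\<^sub>m k - A2)" "B2 *\<^sub>v w"] mA A2 B2 w
        by (simp add: mult_one_dims)
      hence zw: "s \<cdot>\<^sub>v z = A2 *\<^sub>v z + B2 *\<^sub>v w" using rel z B2 w by auto
      define a where "a = M *\<^sub>v w"
      define l where "l = mat_adjoint L *\<^sub>v (C2 *\<^sub>v z)"
      define b where "b = N *\<^sub>v w"
      have cc: "dim_vec a = m" "dim_vec l = m" "dim_vec b = m" using M L N by (auto simp: a_def l_def b_def)
      have Tw: "T *\<^sub>v w = s \<cdot>\<^sub>v a + l + b"
        using M L C2 B2 N mA(1) w unfolding T a_def l_def b_def z_def by (simp add: mat_alg)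
      have "qform J w = qform (N + mat_adjoint N) w - qform R w"
        using N R w unfolding J_def by (subst minus_mult_vec_dims) (auto simp: inner_add)
      hence Jw: "Re (qform J w) = 2 * Re (b \<bullet>c w) - Re (qform R w)"
        using Re_form_add_adjoint[OF N w(1)] by (simp add: b_def)
      have aw: "a \<bullet>c w = of_real (Re (a \<bullet>c w))"
        unfolding a_def by (rule Re_hermitian_form[OF M(1) Mn(1) w(1)])
      have "qform T w = s * (a \<bullet>c w) + l \<bullet>c w + b \<bullet>c w"
        unfolding Tw using cc w by (simp add: inner_add inner_smult)
      moreover have "Re (s * (a \<bullet>c w)) = Re s * Re (a \<bullet>c w)" by (subst aw) simp
      ultimately have "Re (qform T w) = Re s * Re (a \<bullet>c w) + Re (l \<bullet>c w) + Re (b \<bullet>c w)"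
        by (simp only: plus_complex.sel)
      moreover have "f s z w = 2 * (Re s * Re (a \<bullet>c w)) + (2 * Re s * Re (qform P z)
          + Re (qform Q (z - Y *\<^sub>v w))) + Re (qform J w)"
        by (simp only: f_def a_def distrib_left mult.assoc add.assoc)
      ultimately have "Re (qform (T + mat_adjoint T) w) = f s z w"
        using Re_form_add_adjoint[OF cT w(1)] id[OF z w(1) zw, folded l_def] Jw by linarith
      also have "\<dots> \<ge> d1 / 2 * sqnorm (z - Y *\<^sub>v w) + d2 / 2 * sqnorm w" by (rule f[OF s z w(1)])
      moreover have "d1 / 2 * sqnorm (z - Y *\<^sub>v w) \<ge> 0" using d1(1) by (simp add: sqnorm_nonneg)
      moreover have "d2 / 2 * sqnorm w > 0" using d2(1) sqnorm_pos[of w] w by auto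
      ultimately show ?thesis by linarith
    qed
    moreover have "mat_adjoint (T + mat_adjoint T) = T + mat_adjoint T"
      using cT by (subst comm_add_mat[of T m m]) (auto simp: mat_adjoint_add)
    ultimately show "pos_def (T + mat_adjoint T)" unfolding pos_def_iff[OF cTT] by blast
  qed
qed

lemma (in descriptor_system) achieves_gain:
  assumes dG: "det G \<noteq> 0" and hid: "hidden_modes_condition n m E A B C"
    and H1: "H1 \<in> carrier_mat m m" and D2: "D2 \<in> carrier_mat m m"
    and A2: "A2 \<in> carrier_mat k k" and B2: "B2 \<in> carrier_mat k m" and C2: "C2 \<in> carrier_mat m k"
    and Zeq: "Z = s_rm \<cdot>\<^sub>m const_rm H1 + const_rm D2 + strictly_proper_rm A2 B2 C2"
    and L: "L \<in> carrier_mat m m" "det L \<noteq> 0" "pos_semidef (mat_adjoint L * H1)"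
    and P: "P \<in> carrier_mat k k" "mat_adjoint P = P"
    and Pn: "\<And>v. v \<in> carrier_vec k \<Longrightarrow> Re (qform P v) \<ge> 0"
    and Q: "Q \<in> carrier_mat k k" "pos_def Q"
    and lyap: "P * A2 + mat_adjoint A2 * P + Q = 0\<^sub>m k k"
    and N: "N \<in> carrier_mat m m" "pos_def (N + mat_adjoint N - riccati_bound B2 C2 L P Q)"
    and dK: "det (1\<^sub>m m - gain D2 L N * D) \<noteq> 0"
  shows "achieves E A B C D (gain D2 L N) L"
proof -
  define K where "K = gain D2 L N"
  note mL = minv[OF L(1,2)]
  have K: "K \<in> carrier_mat m m" unfolding K_def gain_def
    by (rule minus_carrier_mat[OF mult_carrier_mat[OF mat_adjoint_carrier[OF mL(1)] N(1)]])
  have LH: "mat_adjoint L * H1 \<in> carrier_mat m m" using L H1 by auto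
  obtain e where e: "e > 0" "\<And>s. Re s \<ge> - e \<Longrightarrow> det (s \<cdot>\<^sub>m 1\<^sub>m k - A2) \<noteq> 0"
    "\<And>s T. Re s \<ge> - e \<Longrightarrow> T = s \<cdot>\<^sub>m (mat_adjoint L * H1) + mat_adjoint L * (C2 * minv (s \<cdot>\<^sub>m 1\<^sub>m k - A2) * B2) + N \<Longrightarrow>
      pos_def (T + mat_adjoint T)"
    using kyp_positive[OF A2 B2 C2 L(1) P Pn Q lyap LH L(3) N] by blast
  define U where "U = s_rm \<cdot>\<^sub>m 1\<^sub>m k - const_rm A2"
  have sH: "s_rm \<cdot>\<^sub>m const_rm H1 \<in> mats (regular_at z) m m" for z
    by (rule regular_at.mats_smult[OF s_rm_regular(1) const_rm_regular[OF H1]])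
  note U = resolvent_pencil(1)[OF A2, folded U_def] and Ue = resolvent_pencil(2)[OF A2, folded U_def]
  have sp: "strictly_proper_rm A2 B2 C2 = const_rm C2 * minv U * const_rm B2"
    using A2 by (simp add: strictly_proper_rm_def U_def)
  have Zr: "Z \<in> mats (regular_at s) m m"
    and Ze: "eval_rm Z s = s \<cdot>\<^sub>m H1 + D2 + C2 * minv (s \<cdot>\<^sub>m 1\<^sub>m k - A2) * B2" if s: "Re s \<ge> - e" for s
  proof -
    have d: "det (eval_rm U s) \<noteq> 0" using e(2)[OF s] by (simp add: Ue)
    note mU = eval_rm_minv[OF U d]
    note Cr = const_rm_regular[OF C2] and Br = const_rm_regular[OF B2]
    note 1 = regular_at.mats_mult[OF Cr mU(1)]
    note 2 = regular_at.mats_mult[OF 1 Br]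
    note 3 = regular_at.mats_add[OF sH const_rm_regular[OF D2]]
    show "Z \<in> mats (regular_at s) m m" unfolding Zeq sp by (rule regular_at.mats_add[OF 3 2])
    show "eval_rm Z s = s \<cdot>\<^sub>m H1 + D2 + C2 * minv (s \<cdot>\<^sub>m 1\<^sub>m k - A2) * B2"
      unfolding Zeq sp eval_rm_add[OF 3 2] eval_rm_add[OF sH const_rm_regular[OF D2]] eval_rm_mult[OF 1 Br]
        eval_rm_mult[OF Cr mU(1)] mU(2) eval_rm_smult[OF s_rm_regular(1) const_rm_regular[OF H1]]
      by (simp add: Ue)
  qed
  have pos: "pos_def (mat_adjoint L * (eval_rm Z s - K) + mat_adjoint (mat_adjoint L * (eval_rm Z s - K)))"
    if s: "Re s \<ge> - e" for s
  proof (rule e(3)[OF s])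
    define V where "V = C2 * minv (s \<cdot>\<^sub>m 1\<^sub>m k - A2) * B2"
    have V: "V \<in> carrier_mat m m" using B2 C2 by (auto simp: V_def)
    \<comment> \<open>The \<open>D2\<close> inside the gain cancels the constant term of
      \<open>Z\<close>.\<close>
    have "eval_rm Z s - K = s \<cdot>\<^sub>m H1 + V + mat_adjoint (minv L) * N"
      using H1 D2 V mL N(1) unfolding Ze[OF s] V_def[symmetric] K_def gain_def by (intro eq_matI) auto
    hence "mat_adjoint L * (eval_rm Z s - K)
        = mat_adjoint L * (s \<cdot>\<^sub>m H1) + mat_adjoint L * V + mat_adjoint L * mat_adjoint (minv L) * N"
      using H1 V mL(1) N(1) L(1) by (simp add: mult_add_dims mult_assoc_dims)
    also have "mat_adjoint L * mat_adjoint (minv L) = 1\<^sub>m m"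
      using mL L(1) by (simp flip: mat_adjoint_mult add: mat_adjoint_one)
    finally show "mat_adjoint L * (eval_rm Z s - K)
        = s \<cdot>\<^sub>m (mat_adjoint L * H1) + mat_adjoint L * (C2 * minv (s \<cdot>\<^sub>m 1\<^sub>m k - A2) * B2) + N"
      using L(1) H1 N(1) by (simp add: V_def smult_mult_dims mult_one_dims)
  qed
  have spr: "spr_objective G K L" and d: "\<And>s. Re s \<ge> - e \<Longrightarrow> det (eval_rm Z s - K) \<noteq> 0"
    using spr_if_inverse_positive[OF K L(1,2) dG e(1) Zr pos] by auto
  have "stability_objective E A B C D K"
    by (rule stability_if_inverse_regular[OF K dK[folded K_def] dG _ _ hid]) (use Zr d e(1) in auto)
  thus ?thesis using spr by (simp add: achieves_def K_def G_def)
qed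

section \<open>Existence of the matrices \<open>L\<close> and \<open>N\<close> over the base
  field\<close>

lemma closed_subring_F: "F = \<real> \<or> F = UNIV \<Longrightarrow> closed_subring (F :: complex set)"
  by standard auto

lemma mats_adjoint_F: "(F :: complex set) = \<real> \<or> F = UNIV \<Longrightarrow> M \<in> mats F r c \<Longrightarrow> mat_adjoint M \<in> mats F c r"
  by (auto simp: mats_iff elim!: Reals_cases)

lemma mats_minv_F:
  fixes F :: "complex set"
  assumes F: "F = \<real> \<or> F = UNIV" and M: "M \<in> mats F n n" and d: "det M \<noteq> 0"
  shows "minv M \<in> mats F n n"
  using closed_subring.det_closed[OF closed_subring_F[OF F] M] F
  by (intro mats_minv[OF closed_subring_F[OF F] M d]) auto

text \<open>For real \<open>M\<close> the real or the imaginary part of a complex kernel vector is a non-zero real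
  kernel vector.\<close>

lemma kernel_vector_F:
  fixes F :: "complex set"
  assumes F: "F = \<real> \<or> F = UNIV" and M: "M \<in> mats F n n" and d: "det M = 0"
  obtains v where "v \<in> carrier_vec n" "v \<noteq> 0\<^sub>v n" "M *\<^sub>v v = 0\<^sub>v n" "\<And>i. i < n \<Longrightarrow> v $ i \<in> F"
proof -
  note cM = mats_carrier[OF M]
  obtain v where v: "v \<in> carrier_vec n" "v \<noteq> 0\<^sub>v n" "M *\<^sub>v v = 0\<^sub>v n"
    using det_nonzero_iff_kernel[OF cM] d by auto
  show thesis
  proof (cases "F = UNIV")
    case True
    thus thesis using v that by auto
  next
    case False
    hence R: "F = \<real>" using F by simp
    have ker: "M *\<^sub>v vec n (\<lambda>i. complex_of_real (f (v $ i))) = 0\<^sub>v n" if f: "f = Re \<or> f = Im" for f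
    proof (rule eq_vecI)
      fix i assume "i < dim_vec (0\<^sub>v n)"
      hence i: "i < n" by simp
      have "(\<Sum>j<n. M $$ (i,j) * v $ j) = 0"
        using arg_cong[OF v(3), of "\<lambda>w. w $ i"] i cM v(1) by (simp add: scalar_prod_def atLeast0LessThan)
      hence "(\<Sum>j<n. f (M $$ (i,j) * v $ j)) = 0"
        using f by (metis Im_sum Re_sum zero_complex.sel)
      moreover have Mf: "complex_of_real (f (M $$ (i,j) * v $ j)) = M $$ (i,j) * complex_of_real (f (v $ j))"
        if "j < n" for j
      proof -
        have "M $$ (i,j) \<in> \<real>" using M i that R by (simp add: mats_iff)
        thus ?thesis using f by (auto elim!: Reals_cases)
      qed
      ultimately have "(\<Sum>j<n. M $$ (i,j) * complex_of_real (f (v $ j))) = 0"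
        by (simp flip: Mf of_real_sum)
      thus "(M *\<^sub>v vec n (\<lambda>i. complex_of_real (f (v $ i)))) $ i = 0\<^sub>v n $ i"
        using i cM by (simp add: scalar_prod_def atLeast0LessThan)
    qed (use cM in auto)
    obtain i where i: "i < n" "v $ i \<noteq> 0" using v by (auto simp: vec_eq_iff)
    define f where "f = (if Re (v $ i) \<noteq> 0 then Re else Im)"
    have "f (v $ i) \<noteq> 0" using i by (auto simp: f_def complex_eq_iff)
    hence "vec n (\<lambda>i. complex_of_real (f (v $ i))) \<noteq> 0\<^sub>v n" using i by (auto simp: vec_eq_iff)
    thus thesis
      using ker[of f] that[of "vec n (\<lambda>i. complex_of_real (f (v $ i)))"] by (auto simp: R f_def)
  qed
qed

text \<open>Divided by its squared norms, an orthogonal family is its own dual basis: this is the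
  explicit right inverse \<open>W\<close> of the matrix of the functionals.\<close>

lemma orthogonal_family_kernel:
  fixes v :: "nat \<Rightarrow> complex vec"
  assumes v: "\<And>i. i < n \<Longrightarrow> v i \<in> carrier_vec n" "\<And>i. i < n \<Longrightarrow> v i \<noteq> 0\<^sub>v n"
    and orth: "\<And>i j. i < n \<Longrightarrow> j < n \<Longrightarrow> i \<noteq> j \<Longrightarrow> v i \<bullet>c v j = 0"
    and x: "x \<in> carrier_vec n" "\<And>i. i < n \<Longrightarrow> x \<bullet>c v i = 0"
  shows "x = 0\<^sub>v n"
proof -
  define V where "V = mat n n (\<lambda>(i,j). cnj (v i $ j))"
  have V: "V \<in> carrier_mat n n" by (simp add: V_def)
  define W where "W = mat n n (\<lambda>(i,j). v j $ i / of_real (sqnorm (v j)))"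
  have W: "W \<in> carrier_mat n n" by (simp add: W_def)
  have "V * W = 1\<^sub>m n"
  proof (rule eq_matI)
    fix i j assume "i < dim_row (1\<^sub>m n)" "j < dim_col (1\<^sub>m n)"
    hence ij: "i < n" "j < n" by auto
    have "(V * W) $$ (i,j) = (v j \<bullet>c v i) / of_real (sqnorm (v j))"
      using ij v(1)[OF ij(1)] by (simp add: V_def W_def scalar_prod_def sum_divide_distrib mult.commute)
    also have "\<dots> = 1\<^sub>m n $$ (i,j)"
      using ij v(1,2)[OF ij(2)] orth[OF ij(2,1)] sqnorm_pos[of "v j"] by (auto simp: inner_self)
    finally show "(V * W) $$ (i,j) = 1\<^sub>m n $$ (i,j)" .
  qed (auto simp: V W V_def W_def)
  hence "det V \<noteq> 0" using right_inverse_det_nonzero V W by blast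
  moreover have "V *\<^sub>v x = 0\<^sub>v n"
  proof (rule eq_vecI)
    fix i assume "i < dim_vec (0\<^sub>v n)"
    thus "(V *\<^sub>v x) $ i = 0\<^sub>v n $ i"
      using x(2)[of i] x(1) v(1)[of i] by (simp add: V_def scalar_prod_def mult.commute)
  qed (simp add: V_def)
  ultimately show ?thesis using det_nonzero_iff_kernel[OF V] x(1) by blast
qed

text \<open>Starting from \<open>M = H\<close>, a singular \<open>M\<close> is replaced by \<open>M + u v'\<close> with \<open>M'u = 0\<close> and
  \<open>Mv = 0\<close>; this leaves \<open>M'H\<close> unchanged and adds \<open>v\<close> to the range of \<open>M'\<close>.\<close>

lemma exists_admissible_L:
  assumes F: "F = \<real> \<or> F = UNIV" and H: "H \<in> mats F m m"
  shows "\<exists>L. admissible_L F m H L"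
proof -
  note cH = mats_carrier[OF H]
  interpret F: closed_subring F by (rule closed_subring_F[OF F])
  \<comment> \<open>The last condition makes a vector \<open>u\<close> in the kernel of
    \<open>M'\<close> orthogonal to the range of \<open>H\<close>, so that adding
    \<open>u v'\<close> leaves \<open>M'H\<close> alone. The preserved value is the Gram matrix
    \<open>H'H\<close>, which is semidefinite.\<close>
  define good where "good M \<longleftrightarrow> M \<in> mats F m m \<and> mat_adjoint M * H = mat_adjoint H * H \<and>
    (\<forall>x \<in> carrier_vec m. mat_adjoint M *\<^sub>v x = 0\<^sub>v m \<longrightarrow> mat_adjoint H *\<^sub>v x = 0\<^sub>v m)" for M
  \<comment> \<open>Measures progress by \<open>j\<close> orthogonal non-zero vectors in the range
    of \<open>M'\<close>; for \<open>j = m\<close> nothing is left for the kernel of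
    \<open>M\<close>.\<close>
  define family where "family M j v \<longleftrightarrow> (\<forall>i<j. v i \<in> carrier_vec m \<and> v i \<noteq> 0\<^sub>v m \<and>
      (\<exists>x \<in> carrier_vec m. mat_adjoint M *\<^sub>v x = v i) \<and> (\<forall>k<j. k \<noteq> i \<longrightarrow> v i \<bullet>c v k = 0))"
    for M :: "complex mat" and j :: nat and v
  have "\<exists>M. good M \<and> (det M \<noteq> 0 \<or> (\<exists>v. family M j v))" for j :: nat
  proof (induction j)
    case 0
    have "good H" using H by (simp add: good_def)
    thus ?case by (auto simp: family_def)
  next
    case (Suc j)
    then obtain M where M: "good M" and M': "det M \<noteq> 0 \<or> (\<exists>v. family M j v)" by blast
    show ?case
    proof (cases "det M = 0")
      case False
      thus ?thesis using M by blast
    next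
      case True
      from M have MF: "M \<in> mats F m m" and MH: "mat_adjoint M * H = mat_adjoint H * H"
        and MK: "\<And>x. x \<in> carrier_vec m \<Longrightarrow> mat_adjoint M *\<^sub>v x = 0\<^sub>v m \<Longrightarrow> mat_adjoint H *\<^sub>v x = 0\<^sub>v m"
        by (auto simp: good_def)
      note cM = mats_carrier[OF MF]
      from M' True obtain w where w: "\<And>i. i < j \<Longrightarrow> w i \<in> carrier_vec m" "\<And>i. i < j \<Longrightarrow> w i \<noteq> 0\<^sub>v m"
        "\<And>i. i < j \<Longrightarrow> \<exists>x \<in> carrier_vec m. mat_adjoint M *\<^sub>v x = w i"
        "\<And>i k. i < j \<Longrightarrow> k < j \<Longrightarrow> k \<noteq> i \<Longrightarrow> w i \<bullet>c w k = 0" unfolding family_def by blast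
      obtain v where v: "v \<in> carrier_vec m" "v \<noteq> 0\<^sub>v m" "M *\<^sub>v v = 0\<^sub>v m" "\<And>i. i < m \<Longrightarrow> v $ i \<in> F"
        using kernel_vector_F[OF F MF True] by blast
      have "det (mat_adjoint M) = 0"
        using det_mat_adjoint_nonzero[of "mat_adjoint M" m] True cM by auto
      then obtain u where u: "u \<in> carrier_vec m" "u \<noteq> 0\<^sub>v m" "mat_adjoint M *\<^sub>v u = 0\<^sub>v m" "\<And>i. i < m \<Longrightarrow> u $ i \<in> F"
        using kernel_vector_F[OF F mats_adjoint_F[OF F MF]] by blast
      define d where "d = complex_of_real (sqnorm u)"
      have d: "d \<noteq> 0" using sqnorm_pos[of u] u by (auto simp: d_def)
      define T where "T = mat m m (\<lambda>(i,k). u $ i * cnj (v $ k))"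
      have cT: "T \<in> carrier_mat m m" by (simp add: T_def)
      have "cnj (v $ i) \<in> F" if "i < m" for i using v(4)[OF that] F by (auto simp: Reals_cnj_iff)
      hence TF: "T \<in> mats F m m" using u(4) by (auto simp: mats_iff T_def intro!: F.mult_closed)
      have Tx: "mat_adjoint T *\<^sub>v x = (x \<bullet>c u) \<cdot>\<^sub>v v" if "x \<in> carrier_vec m" for x
        using that u(1) v(1) by (intro eq_vecI) (auto simp: T_def scalar_prod_def sum_distrib_left ac_simps)
      define M1 where "M1 = M + T"
      have M1F: "M1 \<in> mats F m m" unfolding M1_def by (rule F.mats_add[OF MF TF])
      have M1x: "mat_adjoint M1 *\<^sub>v x = mat_adjoint M *\<^sub>v x + (x \<bullet>c u) \<cdot>\<^sub>v v" if "x \<in> carrier_vec m" for x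
        using that cM cT Tx[OF that] by (simp add: M1_def mat_adjoint_add add_mult_vec_dims)
      have range_orth: "(mat_adjoint M *\<^sub>v x) \<bullet>c v = 0" if "x \<in> carrier_vec m" for x
        using that cM v inner_mat_adjoint[of "mat_adjoint M" x v] by simp
      have Hu: "mat_adjoint H *\<^sub>v u = 0\<^sub>v m" by (rule MK[OF u(1,3)])
      have "mat_adjoint T * H = 0\<^sub>m m m"
      proof (rule eq_matI)
        fix i k assume "i < dim_row (0\<^sub>m m m)" "k < dim_col (0\<^sub>m m m)"
        hence ik: "i < m" "k < m" by auto
        have "(mat_adjoint T * H) $$ (i,k) = v $ i * cnj ((mat_adjoint H *\<^sub>v u) $ k)"
          using ik cH u(1) by (simp add: T_def scalar_prod_def sum_distrib_left ac_simps)
        thus "(mat_adjoint T * H) $$ (i,k) = 0\<^sub>m m m $$ (i,k)" unfolding Hu using ik by simp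
      qed (use cH in \<open>auto simp: T_def\<close>)
      hence M1H: "mat_adjoint M1 * H = mat_adjoint H * H"
        using cM cT cH MH right_add_zero_mat[OF mult_carrier_mat[OF mat_adjoint_carrier[OF cH] cH]]
        by (simp add: M1_def mat_adjoint_add add_mult_dims)
      have M1K: "mat_adjoint H *\<^sub>v x = 0\<^sub>v m" if x: "x \<in> carrier_vec m" "mat_adjoint M1 *\<^sub>v x = 0\<^sub>v m" for x
      proof -
        have e: "mat_adjoint M *\<^sub>v x + (x \<bullet>c u) \<cdot>\<^sub>v v = 0\<^sub>v m" using M1x x by simp
        \<comment> \<open>Pairing with \<open>v\<close> isolates the added term, since the range of
          \<open>M'\<close> is orthogonal to the kernel of \<open>M\<close>.\<close>
        have "0 = (mat_adjoint M *\<^sub>v x + (x \<bullet>c u) \<cdot>\<^sub>v v) \<bullet>c v"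
          unfolding e using v(1) by (simp add: inner_sum)
        also have "\<dots> = (x \<bullet>c u) * of_real (sqnorm v)"
          using cM x(1) v(1) range_orth[OF x(1)] by (simp add: inner_add inner_smult inner_self)
        finally have "x \<bullet>c u = 0" using sqnorm_pos[of v] v by auto
        hence "mat_adjoint M *\<^sub>v x = 0\<^sub>v m" using e v(1) cM by (auto simp: vec_eq_iff)
        thus ?thesis using MK x by blast
      qed
      define w' where "w' i = (if i = j then v else w i)" for i
      have ran: "\<exists>x \<in> carrier_vec m. mat_adjoint M1 *\<^sub>v x = w' i" if i: "i < Suc j" for i
      proof (cases "i = j")
        case True
        have "inverse d \<cdot>\<^sub>v 0\<^sub>v m + v = v" using v(1) by (intro eq_vecI) auto
        \<comment> \<open>As \<open>M'u = 0\<close>, only the added term acts on \<open>u\<close>;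
          dividing by the squared norm of \<open>u\<close> gives a preimage of
          \<open>v\<close>.\<close>
        hence "mat_adjoint M1 *\<^sub>v (inverse d \<cdot>\<^sub>v u) = v"
          using M1x[of "inverse d \<cdot>\<^sub>v u"] u cM d v(1) by (simp add: smult_mult_vec_dims inner_smult inner_self d_def)
        thus ?thesis using u(1) True by (auto simp: w'_def)
      next
        case False
        then obtain x where x: "x \<in> carrier_vec m" "mat_adjoint M *\<^sub>v x = w i" using w(3)[of i] i by auto
        \<comment> \<open>Removing the component along \<open>u\<close> keeps the image under
          \<open>M'\<close> and makes the added term vanish, so the old vectors stay in the
          range.\<close>
        define y where "y = x - ((x \<bullet>c u) * inverse d) \<cdot>\<^sub>v u"
        have y: "y \<in> carrier_vec m" using x u by (simp add: y_def)
        have "y \<bullet>c u = 0" using x u d by (simp add: y_def inner_add inner_smult inner_self d_def)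
        moreover have "w i - e \<cdot>\<^sub>v 0\<^sub>v m = w i" for e
          using w(1)[of i] False i by (intro eq_vecI) auto
        hence "mat_adjoint M *\<^sub>v y = w i"
          using x u cM w(1)[of i] False i by (simp add: y_def mult_vec_minus_dims smult_mult_vec_dims)
        moreover have "w i + 0 \<cdot>\<^sub>v v = w i"
          using w(1)[of i] v(1) False i by (intro eq_vecI) auto
        ultimately have "mat_adjoint M1 *\<^sub>v y = w i"
          using M1x[OF y] by simp
        thus ?thesis using y False by (auto simp: w'_def)
      qed
      have wv: "w i \<bullet>c v = 0" if "i < j" for i using w(3)[OF that] range_orth by metis
      have vw: "v \<bullet>c w i = 0" if "i < j" for i
        using inner_cnj[of "w i" v] wv[OF that] w(1)[OF that] v(1) by simp
      have "family M1 (Suc j) w'"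
        using ran w(1,2,4) v(1,2) wv vw by (auto simp: family_def w'_def less_Suc_eq)
      moreover have "good M1" using M1F M1H M1K by (auto simp: good_def)
      ultimately show ?thesis by blast
    qed
  qed
  from this[of m] obtain M where M: "good M" and M': "det M \<noteq> 0 \<or> (\<exists>v. family M m v)" by blast
  from M have MF: "M \<in> mats F m m" and MH: "mat_adjoint M * H = mat_adjoint H * H" by (auto simp: good_def)
  note cM = mats_carrier[OF MF]
  have d: "det M \<noteq> 0"
  proof (cases "det M \<noteq> 0")
    case False
    with M' obtain v where v: "\<And>i. i < m \<Longrightarrow> v i \<in> carrier_vec m" "\<And>i. i < m \<Longrightarrow> v i \<noteq> 0\<^sub>v m"
        "\<And>i. i < m \<Longrightarrow> \<exists>x \<in> carrier_vec m. mat_adjoint M *\<^sub>v x = v i"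
        "\<And>i k. i < m \<Longrightarrow> k < m \<Longrightarrow> k \<noteq> i \<Longrightarrow> v i \<bullet>c v k = 0" unfolding family_def by blast
    show ?thesis unfolding det_nonzero_iff_kernel[OF cM]
    proof (intro ballI impI)
      fix y assume y: "y \<in> carrier_vec m" "M *\<^sub>v y = 0\<^sub>v m"
      have "y \<bullet>c v i = 0" if i: "i < m" for i
      proof -
        obtain x where x: "x \<in> carrier_vec m" "mat_adjoint M *\<^sub>v x = v i" using v(3)[OF i] by blast
        show ?thesis using inner_mat_adjoint[of M y x] x y cM by simp
      qed
      thus "y = 0\<^sub>v m" using v y(1) by (intro orthogonal_family_kernel[of m v]) auto
    qed
  qed auto
  have HH: "mat_adjoint H * H \<in> carrier_mat m m" using cH by auto
  have "pos_semidef (mat_adjoint H * H)"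
    unfolding pos_semidef_iff[OF HH]
    using cH by (auto simp: mat_adjoint_mult mult_vec_assoc_dims inner_mat_adjoint inner_self sqnorm_nonneg)
  thus ?thesis using MF d invertible_mat_iff_det[OF cM] MH by (auto simp: admissible_L_def)
qed

text \<open>With \<open>N = L' D2 + t\<close> the gain collapses to \<open>-t\<close> times the
  inverse adjoint of \<open>L\<close>. Then \<open>1 - K D = 1 + t X\<close> is singular for
  finitely many \<open>t\<close> only, and \<open>N + N' - W = J + 2 t\<close> is positive definite
  once \<open>t\<close> is large.\<close>

lemma exists_admissible_N:
  assumes F: "F = \<real> \<or> F = UNIV" and D: "D \<in> carrier_mat m m" and D2: "D2 \<in> mats F m m"
    and L: "L \<in> mats F m m" "det L \<noteq> 0"
    and W: "W \<in> carrier_mat m m" "mat_adjoint W = W"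
  shows "\<exists>N. admissible_N F m D D2 L W N"
proof -
  interpret F: closed_subring F by (rule closed_subring_F[OF F])
  note cL = mats_carrier[OF L(1)] and cD2 = mats_carrier[OF D2]
  note mL = minv[OF cL L(2)]
  define X where "X = mat_adjoint (minv L) * D"
  have X: "X \<in> carrier_mat m m" unfolding X_def by (rule mult_carrier_mat[OF mat_adjoint_carrier[OF mL(1)] D])
  define S where "S = mat_adjoint L * D2"
  have S: "S \<in> mats F m m" unfolding S_def by (rule F.mats_mult[OF mats_adjoint_F[OF F L(1)] D2])
  note cS = mats_carrier[OF S]
  define J where "J = S + mat_adjoint S - W"
  have J: "J \<in> carrier_mat m m" using W by (simp add: J_def minus_carrier_mat)
  obtain c where c: "c > 0" "\<And>v. v \<in> carrier_vec m \<Longrightarrow> cmod (qform J v) \<le> c * sqnorm v"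
    using form_bound[OF J] by blast
  \<comment> \<open>The values of \<open>t\<close> to avoid. An eigenvalue 0 contributes
    \<open>- 1 / 0 = 0\<close>, which is harmless because \<open>t\<close> will be positive.\<close>
  define B where "B = (\<lambda>e. - 1 / e) ` spectrum X"
  have "finite (spectrum X)" using card_finite_spectrum[OF X] by blast
  hence fB: "finite B" by (simp add: B_def)
  \<comment> \<open>Larger than the bound for the form of \<open>J\<close> and than the modulus of
    every forbidden value.\<close>
  define t where "t = 1 + c + (\<Sum>e\<in>B. cmod e)"
  have sB: "(\<Sum>e\<in>B. cmod e) \<ge> 0" by (rule sum_nonneg) simp
  have tB: "complex_of_real t \<notin> B"
  proof
    assume "complex_of_real t \<in> B"
    hence "cmod (complex_of_real t) \<le> (\<Sum>e\<in>B. cmod e)" using fB by (intro member_le_sum) auto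
    moreover have "cmod (complex_of_real t) = t" using c(1) sB unfolding norm_of_real t_def by linarith
    ultimately show False using c(1) by (simp add: t_def)
  qed
  have t: "t > c" "t > 0" using c(1) sB by (auto simp: t_def)
  define N where "N = S + complex_of_real t \<cdot>\<^sub>m 1\<^sub>m m"
  have NF: "N \<in> mats F m m"
    unfolding N_def by (rule F.mats_add[OF S F.mats_smult[OF _ F.mats_one]]) (use F in auto)
  note cN = mats_carrier[OF NF]
  have "mat_adjoint (minv L) * S = mat_adjoint (minv L) * mat_adjoint L * D2"
    using mL cL cD2 by (simp add: S_def mult_assoc_dims)
  also have "\<dots> = D2"
    using mL cL cD2 by (simp flip: mat_adjoint_mult add: mat_adjoint_one mult_one_dims)
  finally have LS: "mat_adjoint (minv L) * S = D2" .
  have gain: "gain D2 L N = (- complex_of_real t) \<cdot>\<^sub>m mat_adjoint (minv L)"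
    using mL cS cD2 by (simp add: gain_def N_def mult_add_dims LS smult_mult_dims mult_one_dims) (rule eq_matI; simp)
  have I: "1\<^sub>m m - gain D2 L N * D = 1\<^sub>m m + complex_of_real t \<cdot>\<^sub>m X"
    unfolding gain using mL D by (simp add: smult_mult_dims X_def[symmetric]) (rule eq_matI; use X in simp)
  have cI: "1\<^sub>m m + complex_of_real t \<cdot>\<^sub>m X \<in> carrier_mat m m" using X by simp
  have "det (1\<^sub>m m + complex_of_real t \<cdot>\<^sub>m X) \<noteq> 0"
    unfolding det_nonzero_iff_kernel[OF cI]
  proof (intro ballI impI, rule ccontr)
    fix v assume v: "v \<in> carrier_vec m" "(1\<^sub>m m + complex_of_real t \<cdot>\<^sub>m X) *\<^sub>v v = 0\<^sub>v m" "v \<noteq> 0\<^sub>v m"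
    hence "v + complex_of_real t \<cdot>\<^sub>v (X *\<^sub>v v) = 0\<^sub>v m" using X by (simp add: mat_alg)
    hence vi: "(v + complex_of_real t \<cdot>\<^sub>v (X *\<^sub>v v)) $ i = 0\<^sub>v m $ i" for i by simp
    have vt: "v $ i + complex_of_real t * (X *\<^sub>v v) $ i = 0" if "i < m" for i
      using vi[of i] that v X by (simp del: index_mult_mat_vec)
    have "X *\<^sub>v v = (- 1 / complex_of_real t) \<cdot>\<^sub>v v"
    proof (rule eq_vecI)
      fix i assume i: "i < dim_vec ((- 1 / complex_of_real t) \<cdot>\<^sub>v v)"
      hence "complex_of_real t * (X *\<^sub>v v) $ i = - v $ i" using vt[of i] v by (simp add: add_eq_0_iff)
      thus "(X *\<^sub>v v) $ i = ((- 1 / complex_of_real t) \<cdot>\<^sub>v v) $ i"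
        using t i by (simp add: field_simps del: index_mult_mat_vec)
    qed (use v X in simp)
    hence "- 1 / complex_of_real t \<in> spectrum X"
      using v X by (auto simp: spectrum_def eigenvalue_def eigenvector_def)
    hence "- 1 / (- 1 / complex_of_real t) \<in> B" unfolding B_def by (rule imageI)
    thus False using tB t by simp
  qed
  hence inv: "invertible_mat (1\<^sub>m m - gain D2 L N * D)" unfolding I using invertible_mat_iff_det[OF cI] by simp
  have NN: "N + mat_adjoint N - W = J + complex_of_real (2 * t) \<cdot>\<^sub>m 1\<^sub>m m"
    using cS W by (intro eq_matI) (auto simp: N_def J_def)
  have cJ: "J + complex_of_real (2 * t) \<cdot>\<^sub>m 1\<^sub>m m \<in> carrier_mat m m" by simp
  have "pos_def (J + complex_of_real (2 * t) \<cdot>\<^sub>m 1\<^sub>m m)"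
    unfolding pos_def_iff[OF cJ]
  proof (intro conjI ballI impI)
    have "cnj (W $$ (j,i)) = W $$ (i,j)" if "i < m" "j < m" for i j
      using arg_cong[OF W(2), of "\<lambda>M. M $$ (i,j)"] that W(1) by simp
    thus "mat_adjoint (J + complex_of_real (2 * t) \<cdot>\<^sub>m 1\<^sub>m m) = J + complex_of_real (2 * t) \<cdot>\<^sub>m 1\<^sub>m m"
      using cS W(1) by (intro eq_matI) (auto simp: J_def)
    fix v :: "complex vec" assume v: "v \<in> carrier_vec m" "v \<noteq> 0\<^sub>v m"
    have "qform (J + complex_of_real (2 * t) \<cdot>\<^sub>m 1\<^sub>m m) v = qform J v + of_real (2 * t * sqnorm v)"
      using J v by (simp add: mat_alg inner_add inner_smult inner_self)
    hence "Re (qform (J + complex_of_real (2 * t) \<cdot>\<^sub>m 1\<^sub>m m) v) = Re (qform J v) + 2 * t * sqnorm v"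
      by simp
    moreover have "Re (qform J v) \<ge> - (c * sqnorm v)"
      using c(2)[OF v(1)] abs_Re_le_cmod[of "qform J v"] by linarith
    moreover have "c * sqnorm v < 2 * t * sqnorm v"
      using t sqnorm_pos[of v] v by (intro mult_strict_right_mono) auto
    ultimately show "Re (qform (J + complex_of_real (2 * t) \<cdot>\<^sub>m 1\<^sub>m m) v) > 0" by linarith
  qed
  thus ?thesis using NF inv by (auto simp: admissible_N_def NN)
qed

section \<open>Rational functions over the base field\<close>

definition poly_over :: "complex set \<Rightarrow> complex poly set" where
  "poly_over F = {p. \<forall>i. coeff p i \<in> F}"

text \<open>Allowing arbitrary representatives over \<open>F\<close> makes the closure properties
  immediate; that the reduced fraction is also over \<open>F\<close> is the content of
  \<open>quot_of_fract_over\<close>.\<close>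

definition ratfun_over :: "complex set \<Rightarrow> complex poly fract set" where
  "ratfun_over F = {to_fract p / to_fract q | p q. p \<in> poly_over F \<and> q \<in> poly_over F \<and> q \<noteq> 0}"

lemma closed_subring_poly_over:
  assumes "closed_subring F"
  shows "closed_subring (poly_over F)"
proof -
  interpret closed_subring F by fact
  show ?thesis
    by standard (auto simp: poly_over_def coeff_mult one_closed zero_closed
        intro!: diff_closed sum_closed mult_closed)
qed

lemma ratfun_overE:
  assumes "f \<in> ratfun_over F"
  obtains p q where "f = to_fract p / to_fract q" "p \<in> poly_over F" "q \<in> poly_over F" "q \<noteq> 0"
  using assms by (auto simp: ratfun_over_def)

lemma ratfun_overI:
  "f = to_fract p / to_fract q \<Longrightarrow> p \<in> poly_over F \<Longrightarrow> q \<in> poly_over F \<Longrightarrow> q \<noteq> 0 \<Longrightarrow> f \<in> ratfun_over F"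
  by (auto simp: ratfun_over_def)

lemma closed_subring_ratfun_over:
  assumes "closed_subring F"
  shows "closed_subring (ratfun_over F)"
proof -
  interpret closed_subring "poly_over F" using assms by (rule closed_subring_poly_over)
  show ?thesis
  proof
    show "1 \<in> ratfun_over F" by (rule ratfun_overI[of _ 1 1]) (auto simp: one_closed)
    fix f g assume "f \<in> ratfun_over F" "g \<in> ratfun_over F"
    then obtain p q p' q' where pq: "f = to_fract p / to_fract q" "p \<in> poly_over F" "q \<in> poly_over F" "q \<noteq> 0"
      "g = to_fract p' / to_fract q'" "p' \<in> poly_over F" "q' \<in> poly_over F" "q' \<noteq> 0"
      by (metis ratfun_overE)
    show "f - g \<in> ratfun_over F"
      by (rule ratfun_overI[of _ "p * q' - p' * q" "q * q'"])
        (use pq in \<open>auto simp: to_fract_mult to_fract_diff diff_frac_eq intro!: diff_closed mult_closed\<close>)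
    show "f * g \<in> ratfun_over F"
      by (rule ratfun_overI[of _ "p * p'" "q * q'"])
        (use pq in \<open>auto simp: to_fract_mult intro!: mult_closed\<close>)
  qed
qed

lemma ratfun_over_inverse:
  assumes "closed_subring F" "f \<in> ratfun_over F"
  shows "inverse f \<in> ratfun_over F"
proof -
  interpret closed_subring "ratfun_over F" using assms(1) by (rule closed_subring_ratfun_over)
  obtain p q where pq: "f = to_fract p / to_fract q" "p \<in> poly_over F" "q \<in> poly_over F" "q \<noteq> 0"
    using assms by (metis ratfun_overE)
  show ?thesis
  proof (cases "p = 0")
    case True
    thus ?thesis using pq by (simp add: zero_closed)
  next
    case False
    thus ?thesis using pq by (intro ratfun_overI[of _ q p]) auto
  qed
qed

lemma const_rm_ratfun:
  assumes "closed_subring F" and M: "M \<in> mats F r c"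
  shows "const_rm M \<in> mats (ratfun_over F) r c"
proof -
  interpret closed_subring F by fact
  have "to_fract [:a:] \<in> ratfun_over F" if "a \<in> F" for a
    by (rule ratfun_overI[of _ "[:a:]" 1])
      (use that in \<open>auto simp: poly_over_def coeff_pCons zero_closed one_closed split: nat.splits\<close>)
  thus ?thesis using M by (auto simp: mats_iff)
qed

lemma s_rm_ratfun: "closed_subring F \<Longrightarrow> s_rm \<in> ratfun_over F"
  unfolding s_rm_def
  by (rule ratfun_overI[of _ "[:0,1:]" 1])
    (auto simp: poly_over_def coeff_pCons closed_subring.zero_closed closed_subring.one_closed split: nat.splits)

section \<open>Descent of fractions and of division to the base field\<close>

lemma map_poly_cnj_mult: "map_poly cnj (p * q) = map_poly cnj p * map_poly cnj q"
  by (rule poly_eqI) (simp add: coeff_map_poly coeff_mult)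

lemma map_poly_cnj_add: "map_poly cnj (p + q) = map_poly cnj p + map_poly cnj q"
  by (rule poly_eqI) (simp add: coeff_map_poly)

lemma poly_over_Reals: "p \<in> poly_over \<real> \<longleftrightarrow> map_poly cnj p = p"
  by (auto simp: poly_over_def poly_eq_iff coeff_map_poly Reals_cnj_iff)

lemma degree_map_poly_cnj: "degree (map_poly cnj p) = degree p"
  by (rule degree_map_poly) auto

lemma monic_snd_quot_of_fract: "lead_coeff (snd (quot_of_fract (f :: complex poly fract))) = 1"
  using unit_factor_snd_quot_of_fract[of f] by (simp add: unit_factor_poly_def monom_0 one_pCons)

text \<open>A reduced fraction with monic denominator is unique, hence fixed by conjugation.\<close>

lemma quot_of_fract_over:
  assumes F: "F = \<real> \<or> F = UNIV" and f: "f \<in> ratfun_over F"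
  shows "fst (quot_of_fract f) \<in> poly_over F" "snd (quot_of_fract f) \<in> poly_over F"
proof -
  define a b where "a = fst (quot_of_fract f)" and "b = snd (quot_of_fract f)"
  have b: "b \<noteq> 0" "lead_coeff b = 1" and cop: "coprime a b"
    using monic_snd_quot_of_fract[of f] by (simp_all add: a_def b_def coprime_quot_of_fract)
  have "a \<in> poly_over F \<and> b \<in> poly_over F"
  proof (cases "F = UNIV")
    case True
    thus ?thesis by (simp add: poly_over_def)
  next
    case False
    hence R: "F = \<real>" using F by simp
    obtain p q where pq: "f = to_fract p / to_fract q" "map_poly cnj p = p" "map_poly cnj q = q" "q \<noteq> 0"
      using f by (metis R ratfun_overE poly_over_Reals)
    have "to_fract a / to_fract b = to_fract p / to_fract q"
      using pq fract_eq_quot[of f] by (simp add: a_def b_def)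
    hence "to_fract (a * q) = to_fract (p * b)"
      using b pq(4) by (simp add: frac_eq_eq to_fract_mult)
    hence e: "a * q = p * b" by (simp only: to_fract_eq_iff)
    define a' b' where "a' = map_poly cnj a" and "b' = map_poly cnj b"
    have e': "a' * q = p * b'"
      using arg_cong[OF e, of "map_poly cnj"] by (simp add: map_poly_cnj_mult pq a'_def b'_def)
    have "(a' * b) * (q * p) = (a' * q) * (p * b)" by simp
    also have "\<dots> = (a * b') * (q * p)" unfolding e'  using e by (simp add: algebra_simps)
    finally have ab: "a' * b = a * b'" if "p \<noteq> 0" using that pq(4) by simp
    show ?thesis
    proof (cases "p = 0")
      case True
      hence "f = 0" using pq by simp
      thus ?thesis by (simp add: a_def b_def quot_of_fract_0 poly_over_def R)
    next
      case False
      \<comment> \<open>Coprimality leaves \<open>b dvd b'\<close>; equal degrees and leading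
        coefficients 1 then force the cofactor to be 1.\<close>
      have "b dvd a * b'" using ab[OF False] by (metis dvd_triv_right)
      hence "b dvd b'" using cop by (simp add: coprime_commute coprime_dvd_mult_right_iff)
      then obtain c where c: "b' = b * c" by (elim dvdE)
      have b'0: "b' \<noteq> 0" using b(1) by (auto simp: b'_def)
      hence c0: "c \<noteq> 0" using c by auto
      have dg: "degree b' = degree b" by (simp add: b'_def degree_map_poly_cnj)
      hence "degree c = 0" using c degree_mult_eq[OF b(1) c0] by simp
      then obtain a0 where "c = [:a0:]" by (rule degree_eq_zeroE)
      moreover have "lead_coeff b' = 1" using b dg by (simp add: b'_def coeff_map_poly)
      hence "lead_coeff c = 1" using lead_coeff_mult[of b c] b(2) by (simp add: c)
      ultimately have "c = 1" by (simp add: one_pCons)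
      hence bb: "b' = b" using c by simp
      hence "a' = a" using ab[OF False] b(1) by simp
      thus ?thesis using bb by (simp add: R poly_over_Reals a'_def b'_def)
    qed
  qed
  thus "fst (quot_of_fract f) \<in> poly_over F" "snd (quot_of_fract f) \<in> poly_over F" by (simp_all add: a_def b_def)
qed

text \<open>Conjugating a division with remainder of real polynomials gives another such division of
  the same pair, so uniqueness fixes quotient and remainder.\<close>

lemma poly_over_div_mod:
  assumes F: "F = \<real> \<or> F = UNIV" and p: "p \<in> poly_over F" and q: "q \<in> poly_over F" "q \<noteq> 0"
  shows "p div q \<in> poly_over F" "p mod q \<in> poly_over F"
proof -
  have "p div q \<in> poly_over F \<and> p mod q \<in> poly_over F"
  proof (cases "F = UNIV")
    case True
    thus ?thesis by (simp add: poly_over_def)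
  next
    case False
    hence R: "F = \<real>" using F by simp
    define r where "r = map_poly cnj (p mod q)"
    have "map_poly cnj (q * (p div q) + p mod q) = map_poly cnj q * map_poly cnj (p div q) + r"
      by (simp only: map_poly_cnj_mult map_poly_cnj_add r_def)
    hence p': "p = r + q * map_poly cnj (p div q)"
      using p q by (simp add: R poly_over_Reals add.commute)
    have "r = 0 \<or> degree r < degree q"
      using degree_mod_less[OF q(2), of p] by (auto simp: r_def degree_map_poly_cnj)
    hence r: "r div q = 0" "r mod q = r" by (auto simp: div_poly_less mod_poly_less)
    have "p div q = map_poly cnj (p div q)"
      using r(1) q(2) by (subst p') simp
    moreover have "p mod q = r" using r(2) by (subst p') simp
    ultimately show ?thesis by (simp add: R poly_over_Reals r_def)
  qed
  thus "p div q \<in> poly_over F" "p mod q \<in> poly_over F" by auto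
qed

text \<open>With the product of the reduced denominators as common denominator, every root of \<open>q\<close> is a
  pole of some entry.\<close>

lemma common_denominator:
  assumes F: "F = \<real> \<or> F = UNIV" and Z: "Z \<in> mats (ratfun_over F) m m"
  obtains q P R where "lead_coeff q = 1" "q \<in> poly_over F"
    "\<And>z. Z \<in> mats (regular_at z) m m \<Longrightarrow> poly q z \<noteq> 0"
    "\<And>i j. i < m \<Longrightarrow> j < m \<Longrightarrow> P i j \<in> poly_over F \<and> R i j \<in> poly_over F \<and> (R i j = 0 \<or> degree (R i j) < degree q) \<and>
      Z $$ (i,j) = to_fract (P i j) + to_fract (R i j) / to_fract q"
proof -
  interpret closed_subring "poly_over F" by (rule closed_subring_poly_over[OF closed_subring_F[OF F]])
  define b where "b = (\<lambda>(i,j). snd (quot_of_fract (Z $$ (i,j))))"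
  define I where "I = {..<m} \<times> {..<m}"
  define q where "q = (\<Prod>x\<in>I. b x)"
  have bF: "b x \<in> poly_over F" if "x \<in> I" for x
    using that Z quot_of_fract_over(2)[OF F] by (auto simp: b_def I_def mats_iff)
  have lq: "lead_coeff q = 1" unfolding q_def lead_coeff_prod
    by (intro prod.neutral) (auto simp: b_def monic_snd_quot_of_fract)
  hence q0: "q \<noteq> 0" by auto
  have qF: "q \<in> poly_over F" unfolding q_def using bF by (rule prod_closed)
  have roots: "poly q z \<noteq> 0" if "Z \<in> mats (regular_at z) m m" for z
    using that by (auto simp: q_def poly_prod b_def I_def mats_iff regular_at_def)
  define N where "N = (\<lambda>i j. fst (quot_of_fract (Z $$ (i,j))) * (\<Prod>x\<in>I - {(i,j)}. b x))"
  define P where "P = (\<lambda>i j. N i j div q)"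
  define R where "R = (\<lambda>i j. N i j mod q)"
  have "P i j \<in> poly_over F \<and> R i j \<in> poly_over F \<and> (R i j = 0 \<or> degree (R i j) < degree q) \<and>
      Z $$ (i,j) = to_fract (P i j) + to_fract (R i j) / to_fract q" if ij: "i < m" "j < m" for i j
  proof (intro conjI)
    have NF: "N i j \<in> poly_over F"
      unfolding N_def using Z ij bF by (intro mult_closed prod_closed quot_of_fract_over(1)[OF F]) (auto simp: mats_iff)
    show "P i j \<in> poly_over F" "R i j \<in> poly_over F"
      unfolding P_def R_def using poly_over_div_mod[OF F NF qF q0] by auto
    show "R i j = 0 \<or> degree (R i j) < degree q"
      unfolding R_def using degree_mod_less[OF q0] by blast
    have q_split: "q = b (i,j) * (\<Prod>x\<in>I - {(i,j)}. b x)"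
      unfolding q_def using ij by (intro prod.remove) (auto simp: I_def)
    hence "(\<Prod>x\<in>I - {(i,j)}. b x) \<noteq> 0" using q0 by auto
    hence "Z $$ (i,j) = to_fract (N i j) / to_fract q"
      by (subst fract_eq_quot) (simp add: N_def q_split b_def to_fract_mult)
    also have "N i j = P i j * q + R i j" by (simp add: P_def R_def)
    also have "to_fract (P i j * q + R i j) / to_fract q = to_fract (P i j) + to_fract (R i j) / to_fract q"
      using q0 by (simp add: to_fract_add to_fract_mult add_divide_distrib)
    finally show "Z $$ (i,j) = to_fract (P i j) + to_fract (R i j) / to_fract q" .
  qed
  thus thesis using that lq qF roots by blast
qed

section \<open>Realization of strictly proper rational matrices\<close>

lemma to_fract_power: "to_fract (p ^ n) = to_fract p ^ n"
  by (induction n) (auto simp: to_fract_mult)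

lemma to_fract_expand:
  assumes "\<And>b. b \<ge> d \<Longrightarrow> coeff p b = 0"
  shows "to_fract p = (\<Sum>b<d. to_fract [:coeff p b:] * s_rm ^ b)"
proof -
  have "p = (\<Sum>b<d. monom (coeff p b) b)"
    using assms by (intro poly_eqI) (auto simp: coeff_sum not_less)
  also have "(\<Sum>b<d. monom (coeff p b) b) = (\<Sum>b<d. [:coeff p b:] * [:0,1:] ^ b)"
    by (simp add: monom_altdef)
  finally have "to_fract p = (\<Sum>b<d. to_fract ([:coeff p b:] * [:0,1:] ^ b))"
    by (metis sum_to_fract)
  thus ?thesis by (simp only: to_fract_mult to_fract_power s_rm_def)
qed

text \<open>State indices are written \<open>b * m + j\<close>, with the power of \<open>s\<close>
  as block number \<open>b\<close> and the input channel as \<open>j\<close>. Restricting a sum to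
  one channel leaves one term for each block.\<close>

lemma sum_blocks:
  fixes f :: "nat \<Rightarrow> 'a :: comm_monoid_add"
  assumes "j < m"
  shows "(\<Sum>c<d * m. if c mod m = j then f (c div m) else 0) = (\<Sum>b<d. f b)"
proof -
  have "(\<Sum>c<d * m. if c mod m = j then f (c div m) else 0)
     = (\<Sum>b<d. \<Sum>c=b * m..<b * m + m. if c mod m = j then f (c div m) else 0)"
    by (rule sum.nat_group[symmetric])
  also have "\<dots> = (\<Sum>b<d. f b)"
  proof (rule sum.cong[OF refl])
    fix b
    show "(\<Sum>c=b * m..<b * m + m. if c mod m = j then f (c div m) else 0) = f b"
    proof -
      have "(\<Sum>c=b * m..<b * m + m. if c mod m = j then f (c div m) else 0)
         = (\<Sum>c=b * m..<b * m + m. if c = b * m + j then f b else 0)"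
      proof (rule sum.cong[OF refl])
        fix c assume c: "c \<in> {b * m..<b * m + m}"
        define t where "t = c - b * m"
        have "c = b * m + t" "t < m" using c by (auto simp: t_def)
        thus "(if c mod m = j then f (c div m) else 0) = (if c = b * m + j then f b else 0)" by simp
      qed
      thus ?thesis using assms by simp
    qed
  qed
  finally show ?thesis .
qed

text \<open>The block companion matrix of \<open>q\<close>: the state with index \<open>a * m + i\<close> is
  \<open>s\<^sup>a u\<^sub>i / q\<close>.\<close>

lemma strictly_proper_realization:
  fixes q :: "complex poly" and R :: "nat \<Rightarrow> nat \<Rightarrow> complex poly"
  assumes F: "closed_subring F" and q: "lead_coeff q = 1" "q \<in> poly_over F"
    and roots: "\<And>z. poly q z = 0 \<Longrightarrow> Re z < 0"
    and R: "\<And>i j. i < m \<Longrightarrow> j < m \<Longrightarrow> R i j \<in> poly_over F"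
    "\<And>i j. i < m \<Longrightarrow> j < m \<Longrightarrow> R i j = 0 \<or> degree (R i j) < degree q"
  obtains k A2 B2 C2 where "A2 \<in> mats F k k" "B2 \<in> mats F k m" "C2 \<in> mats F m k" "hurwitz A2"
    "strictly_proper_rm A2 B2 C2 = mat m m (\<lambda>(i,j). to_fract (R i j) / to_fract q)"
proof
  interpret F: closed_subring F by fact
  define d where "d = degree q"
  define k where "k = d * m"
  have q0: "q \<noteq> 0" using q by auto
  have div_mod: "r div m < d" "r mod m < m" if "r < k" for r
    using that by (auto simp: k_def less_mult_imp_div_less intro!: mod_less_divisor gr0I)
  \<comment> \<open>All block rows but the last shift, realizing \<open>s * s^a = s^(a+1)\<close>;
    the last one carries the negated lower coefficients of \<open>q\<close>. For constant
    \<open>q\<close> the state is empty, and the degree condition makes every \<open>R i j\<close>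
    zero.\<close>
  define A2 where "A2 = mat k k (\<lambda>(r,c). if r div m + 1 < d then (if c = r + m then 1 else 0)
     else (if c mod m = r mod m then - coeff q (c div m) else 0))"
  define B2 where "B2 = (mat k m (\<lambda>(r,j). if r div m + 1 = d \<and> r mod m = j then 1 else 0) :: complex mat)"
  define C2 where "C2 = mat m k (\<lambda>(i,c). coeff (R i (c mod m)) (c div m))"
  show A2F: "A2 \<in> mats F k k" using q(2)
    by (auto simp: mats_iff A2_def poly_over_def F.one_closed F.zero_closed intro!: F.uminus_closed)
  show B2F: "B2 \<in> mats F k m" by (auto simp: mats_iff B2_def F.one_closed F.zero_closed)
  show C2F: "C2 \<in> mats F m k"
    using R(1) div_mod by (auto simp: mats_iff C2_def poly_over_def)
  have step: "r + m < k" if "r < k" "r div m + 1 < d" for r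
  proof -
    have "r + m = (r div m + 1) * m + r mod m" by simp
    also have "\<dots> < (r div m + 1) * m + m" using div_mod(2)[OF that(1)] by (rule add_strict_left_mono)
    also have "\<dots> = (r div m + 1 + 1) * m" by simp
    also have "\<dots> \<le> d * m" using that(2) by (intro mult_right_mono) auto
    finally show ?thesis by (simp add: k_def)
  qed
  have q_sum: "poly q z = (\<Sum>b<d. coeff q b * z ^ b) + z ^ d" for z
    using q(1) by (simp add: poly_altdef d_def[symmetric] lessThan_Suc_atMost[symmetric])
  show "hurwitz A2" unfolding hurwitz_def
  proof (intro allI impI)
    fix e assume "eigenvalue A2 e"
    then obtain v where v: "v \<in> carrier_vec k" "v \<noteq> 0\<^sub>v k" "A2 *\<^sub>v v = e \<cdot>\<^sub>v v"
      by (auto simp: eigenvalue_def eigenvector_def A2_def)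
    have row: "(\<Sum>c<k. A2 $$ (r,c) * v $ c) = e * v $ r" if "r < k" for r
      using arg_cong[OF v(3), of "\<lambda>w. w $ r"] that v(1)
      by (simp add: A2_def scalar_prod_def atLeast0LessThan)
    have shift: "v $ (r + m) = e * v $ r" if "r < k" "r div m + 1 < d" for r
    proof -
      have "(\<Sum>c<k. A2 $$ (r,c) * v $ c) = (\<Sum>c<k. if c = r + m then v $ c else 0)"
        using that by (intro sum.cong) (auto simp: A2_def)
      thus ?thesis using row[OF that(1)] step[OF that] by simp
    qed
    \<comment> \<open>The shifting rows determine an eigenvector by its first block; in a channel
      where this is non-zero, the last block row then reads \<open>q(e) = 0\<close>.\<close>
    have pow: "v $ (a * m + i) = e ^ a * v $ i" if "i < m" "a < d" for a i
      using that(2)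
    proof (induction a)
      case (Suc a)
      have "a * m + i < k"
      proof -
        have "a * m + i < (a + 1) * m" using that(1) by simp
        also have "\<dots> \<le> d * m" using Suc.prems by (intro mult_right_mono) auto
        finally show ?thesis by (simp add: k_def)
      qed
      moreover have "(a * m + i) div m + 1 < d" using that(1) Suc.prems by simp
      ultimately have "v $ (a * m + i + m) = e * v $ (a * m + i)" by (rule shift)
      thus ?case using Suc by (simp add: algebra_simps)
    qed simp
    obtain r where r: "r < k" "v $ r \<noteq> 0" using v by (auto simp: vec_eq_iff)
    define i where "i = r mod m"
    have i: "i < m" using div_mod(2)[OF r(1)] by (simp add: i_def)
    have "v $ r = e ^ (r div m) * v $ i"
      using pow[OF i div_mod(1)[OF r(1)]] by (simp add: i_def)
    hence vi: "v $ i \<noteq> 0" using r by auto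
    have dpos: "d > 0" using div_mod(1)[OF r(1)] by simp
    define t where "t = (d - 1) * m + i"
    have t: "t div m = d - 1" "t mod m = i" using i by (simp_all add: t_def)
    have "t < (d - 1) * m + m" using i by (simp add: t_def)
    also have "\<dots> = k" using dpos by (simp add: k_def algebra_simps)
    finally have tk: "t < k" .
    have "(\<Sum>c<k. A2 $$ (t,c) * v $ c) = (\<Sum>c<d * m. if c mod m = i then - coeff q (c div m) * v $ ((c div m) * m + i) else 0)"
      unfolding k_def
    proof (intro sum.cong refl)
      fix c assume "c \<in> {..<d * m}"
      hence "c < k" by (simp add: k_def)
      moreover have "\<not> t div m + 1 < d" using t dpos by simp
      moreover have "v $ ((c div m) * m + i) = v $ c" if "c mod m = i"
        using that div_mult_mod_eq[of c m] by metis
      ultimately show "A2 $$ (t,c) * v $ c = (if c mod m = i then - coeff q (c div m) * v $ ((c div m) * m + i) else 0)"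
        using tk by (simp add: A2_def t(2))
    qed
    also have "\<dots> = (\<Sum>b<d. - coeff q b * v $ (b * m + i))" by (rule sum_blocks[OF i])
    also have "\<dots> = - (\<Sum>b<d. coeff q b * e ^ b) * v $ i"
      using pow[OF i] by (simp add: sum_distrib_right sum_negf mult.assoc)
    finally have "- (\<Sum>b<d. coeff q b * e ^ b) * v $ i = e * v $ t" using row[OF tk] by simp
    also have "e * v $ t = e ^ d * v $ i"
      using pow[OF i, of "d - 1"] dpos by (simp add: t_def power_eq_if)
    finally have "((\<Sum>b<d. coeff q b * e ^ b) + e ^ d) * v $ i = 0"
      by (simp only: distrib_right mult_minus_left neg_eq_iff_add_eq_0)
    hence "poly q e = 0" using vi by (simp add: q_sum)
    thus "Re e < 0" by (rule roots)
  qed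
  note hA = this
  have cA: "A2 \<in> carrier_mat k k" and cB: "B2 \<in> carrier_mat k m" and cC: "C2 \<in> carrier_mat m k"
    using A2F B2F C2F by (auto dest: mats_carrier)
  define U where "U = s_rm \<cdot>\<^sub>m 1\<^sub>m k - const_rm A2"
  note U = resolvent_pencil(1)[OF cA, of 0, folded U_def]
  have "det U \<noteq> 0"
    using det_nonzero_eval[OF U] hurwitz_shift_det[OF cA hA, of 0] resolvent_pencil(2)[OF cA, of 0] by (simp add: U_def)
  note mU = minv[OF mats_carrier[OF U] this]
  \<comment> \<open>The expected value of \<open>(s - A2)^-1 B2\<close>; guessing it reduces the
    inversion to a multiplication.\<close>
  define X where "X = mat k m (\<lambda>(r,j). if r mod m = j then s_rm ^ (r div m) / to_fract q else 0)"
  have X: "X \<in> carrier_mat k m" by (simp add: X_def)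
  have tq: "to_fract q = (\<Sum>b<d. to_fract [:coeff q b:] * s_rm ^ b) + s_rm ^ d"
  proof -
    have "to_fract q = (\<Sum>b<Suc d. to_fract [:coeff q b:] * s_rm ^ b)"
      by (rule to_fract_expand) (auto simp: d_def coeff_eq_0)
    thus ?thesis using q(1) by (simp add: d_def one_pCons[symmetric])
  qed
  have neg: "to_fract [:- a:] = - to_fract [:a:]" for a :: complex
    by (simp flip: to_fract_uminus)
  have UX: "U * X = const_rm B2"
  proof (rule eq_matI)
    fix r j assume "r < dim_row (const_rm B2)" "j < dim_col (const_rm B2)"
    hence rj: "r < k" "j < m" using cB by auto
    have m: "m > 0" using rj by simp
    have "(U * X) $$ (r,j) = (\<Sum>c<k. ((if r = c then s_rm else 0) - to_fract [:A2 $$ (r,c):]) * X $$ (c,j))"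
      using rj cA X by (auto simp: U_def scalar_prod_def atLeast0LessThan intro!: sum.cong)
    also have "\<dots> = s_rm * X $$ (r,j) - (\<Sum>c<k. to_fract [:A2 $$ (r,c):] * X $$ (c,j))"
      using rj by (simp add: left_diff_distrib sum_subtractf if_distrib[of "\<lambda>x. x * _"] cong: if_cong)
    also have "\<dots> = to_fract [:B2 $$ (r,j):]"
    proof (cases "r div m + 1 < d")
      case True
      have "(\<Sum>c<k. to_fract [:A2 $$ (r,c):] * X $$ (c,j)) = (\<Sum>c<k. if c = r + m then X $$ (c,j) else 0)"
        using rj True by (intro sum.cong) (auto simp: A2_def one_pCons[symmetric])
      also have "\<dots> = X $$ (r + m, j)" using step[OF rj(1) True] by simp
      also have "\<dots> = s_rm * X $$ (r,j)"
        using rj step[OF rj(1) True] m by (simp add: X_def)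
      finally show ?thesis using True rj by (simp add: B2_def)
    next
      case False
      \<comment> \<open>In the last block row the term \<open>s * s^(d-1) = s^d\<close> is completed
        by the lower terms of \<open>q\<close>, so what remains is \<open>q / q = 1\<close>, the
        entry of \<open>B2\<close>.\<close>
      hence rd: "r div m + 1 = d" using div_mod(1)[OF rj(1)] by simp
      have "(\<Sum>c<k. to_fract [:A2 $$ (r,c):] * X $$ (c,j))
         = (\<Sum>c<d * m. if c mod m = j then (if r mod m = j then - (to_fract [:coeff q (c div m):] * s_rm ^ (c div m) / to_fract q) else 0) else 0)"
        unfolding k_def
      proof (intro sum.cong refl)
        fix c assume "c \<in> {..<d * m}"
        hence "c < k" by (simp add: k_def)
        thus "to_fract [:A2 $$ (r,c):] * X $$ (c,j) = (if c mod m = j then (if r mod m = j then - (to_fract [:coeff q (c div m):] * s_rm ^ (c div m) / to_fract q) else 0) else 0)"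
          using rj rd neg by (auto simp: A2_def X_def)
      qed
      also have "\<dots> = (\<Sum>b<d. if r mod m = j then - (to_fract [:coeff q b:] * s_rm ^ b / to_fract q) else 0)"
        by (rule sum_blocks[OF rj(2)])
      also have "\<dots> = (if r mod m = j then - ((\<Sum>b<d. to_fract [:coeff q b:] * s_rm ^ b) / to_fract q) else 0)"
        by (simp add: sum_negf sum_divide_distrib)
      also have "(\<Sum>b<d. to_fract [:coeff q b:] * s_rm ^ b) = to_fract q - s_rm ^ d" by (simp add: tq)
      finally have "(\<Sum>c<k. to_fract [:A2 $$ (r,c):] * X $$ (c,j))
         = (if r mod m = j then - ((to_fract q - s_rm ^ d) / to_fract q) else 0)" .
      moreover have "s_rm * s_rm ^ (r div m) = s_rm ^ d" using rd by (metis Suc_eq_plus1 power_Suc)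
      ultimately show ?thesis
        using rj rd q0 by (auto simp: X_def B2_def one_pCons[symmetric] diff_divide_distrib)
    qed
    finally show "(U * X) $$ (r,j) = const_rm B2 $$ (r,j)" using rj cB by simp
  qed (use X cA cB in \<open>auto simp: U_def\<close>)
  have CX: "const_rm C2 * X = mat m m (\<lambda>(i,j). to_fract (R i j) / to_fract q)"
  proof (rule eq_matI)
    fix i j assume "i < dim_row (mat m m (\<lambda>(i,j). to_fract (R i j) / to_fract q))"
      "j < dim_col (mat m m (\<lambda>(i,j). to_fract (R i j) / to_fract q))"
    hence ij: "i < m" "j < m" by auto
    have "(const_rm C2 * X) $$ (i,j) = (\<Sum>c<k. to_fract [:C2 $$ (i,c):] * X $$ (c,j))"
      using ij cC X by (auto simp: scalar_prod_def atLeast0LessThan intro!: sum.cong)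
    also have "\<dots> = (\<Sum>c<d * m. if c mod m = j then to_fract [:coeff (R i j) (c div m):] * s_rm ^ (c div m) / to_fract q else 0)"
      unfolding k_def
    proof (intro sum.cong refl)
      fix c assume "c \<in> {..<d * m}"
      hence "c < k" by (simp add: k_def)
      thus "to_fract [:C2 $$ (i,c):] * X $$ (c,j) = (if c mod m = j then to_fract [:coeff (R i j) (c div m):] * s_rm ^ (c div m) / to_fract q else 0)"
        using ij by (auto simp: C2_def X_def)
    qed
    also have "\<dots> = (\<Sum>b<d. to_fract [:coeff (R i j) b:] * s_rm ^ b / to_fract q)"
      by (rule sum_blocks[OF ij(2)])
    also have "\<dots> = to_fract (R i j) / to_fract q"
    proof -
      have "to_fract (R i j) = (\<Sum>b<d. to_fract [:coeff (R i j) b:] * s_rm ^ b)"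
        using R(2)[OF ij] by (intro to_fract_expand) (auto simp: d_def coeff_eq_0)
      thus ?thesis by (simp add: sum_divide_distrib)
    qed
    finally show "(const_rm C2 * X) $$ (i,j) = mat m m (\<lambda>(i,j). to_fract (R i j) / to_fract q) $$ (i,j)"
      using ij by simp
  qed (use X cC in auto)
  have "strictly_proper_rm A2 B2 C2 = const_rm C2 * minv U * (U * X)"
    using cA unfolding UX by (simp add: strictly_proper_rm_def U_def)
  also have "\<dots> = const_rm C2 * (minv U * U * X)"
    using cC X mU(1) U by (simp add: mult_assoc_dims mats_dim)
  also have "\<dots> = const_rm C2 * X" using X by (simp add: mU mult_one_dims)
  finally show "strictly_proper_rm A2 B2 C2 = mat m m (\<lambda>(i,j). to_fract (R i j) / to_fract q)"
    using CX by simp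
qed

section \<open>Necessity\<close>

text \<open>A positive real function grows at most linearly: along the ray of direction \<open>w\<close> the leading
  term dominates, and for degree at least two \<open>w\<close> can be chosen in the closed right half plane such
  that the leading term tends to \<open>-\<infinity>\<close>.\<close>

lemma positive_real_degree:
  fixes g :: "complex poly" and r :: "complex \<Rightarrow> complex"
  assumes r: "(r \<longlongrightarrow> 0) at_infinity" and pos: "\<And>z. Re z \<ge> 0 \<Longrightarrow> Re (poly g z + r z) \<ge> 0"
  shows "degree g \<le> 1"
proof (rule ccontr)
  assume "\<not> degree g \<le> 1"
  define d where "d = degree g"
  define c where "c = lead_coeff g"
  have d: "d \<ge> 2" using \<open>\<not> degree g \<le> 1\<close> by (simp add: d_def)
  have c: "c \<noteq> 0" using d by (auto simp: c_def d_def)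
  define p where "p = Arg c"
  have p: "- pi < p" "p \<le> pi" "c = of_real (cmod c) * cis p"
    using cis_Arg[OF c] c by (auto simp: p_def Arg_bounded sgn_eq)
  \<comment> \<open>The angle from \<open>Arg c\<close> to the negative real axis, taken on the side
    where its modulus is at most \<open>pi\<close>. Divided by \<open>d >= 2\<close> it is at most
    \<open>pi / 2\<close>, which keeps \<open>w\<close> in the closed right half plane.\<close>
  define u where "u = (if p \<ge> 0 then pi - p else - pi - p)"
  define t where "t = u / d"
  define w where "w = cis t"
  have "w ^ d = cis u"
    using d by (simp add: w_def DeMoivre t_def)
  hence "c * w ^ d = of_real (cmod c) * cis (if p \<ge> 0 then pi else - pi)"
    by (subst p(3)) (simp add: mult.assoc cis_mult u_def)
  hence cw: "c * w ^ d = - of_real (cmod c)" by (simp add: complex_eq_iff)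
  have "\<bar>u\<bar> \<le> pi" using p by (auto simp: u_def)
  hence "\<bar>t\<bar> \<le> pi / d" by (simp add: t_def divide_right_mono)
  also have "\<dots> \<le> pi / 2" using d by (intro divide_left_mono) auto
  finally have "cos t \<ge> 0" by (intro cos_ge_zero) auto
  hence w: "Re w \<ge> 0" "cmod w = 1" "w \<noteq> 0" by (auto simp: w_def)
  have inf: "filterlim (\<lambda>x::real. of_real x * w) at_infinity at_top"
    unfolding filterlim_at_infinity_conv_norm_at_top using w
    by (simp add: norm_mult filterlim_abs_real)
  have "((\<lambda>x. poly g (of_real x * w) / (of_real x * w) ^ d) \<longlongrightarrow> c) at_top"
    using filterlim_compose[OF poly_divide_tendsto_aux[of g] inf] by (simp add: d_def c_def)
  moreover have "((\<lambda>x. r (of_real x * w) * inverse ((of_real x * w) ^ d)) \<longlongrightarrow> 0 * 0) at_top"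
  proof (rule tendsto_mult)
    show "((\<lambda>x. r (of_real x * w)) \<longlongrightarrow> 0) at_top" by (rule filterlim_compose[OF r inf])
    have "filterlim (\<lambda>x::real. (of_real x * w) ^ d) at_infinity at_top"
      using filterlim_compose[OF filterlim_power_at_infinity inf] d by simp
    thus "((\<lambda>x. inverse ((of_real x * w) ^ d)) \<longlongrightarrow> 0) at_top"
      by (rule filterlim_compose[OF tendsto_inverse_0])
  qed
  \<comment> \<open>The factor \<open>w ^ d\<close> turns the division by \<open>(x w)^d\<close>
    into one by the positive number \<open>x^d\<close>, so the sign of the real part is that of
    \<open>g + r\<close>.\<close>
  ultimately have "((\<lambda>x. w ^ d * (poly g (of_real x * w) / (of_real x * w) ^ d
      + r (of_real x * w) * inverse ((of_real x * w) ^ d))) \<longlongrightarrow> w ^ d * (c + 0 * 0)) at_top"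
    by (intro tendsto_mult_left tendsto_add)
  hence "((\<lambda>x. Re (w ^ d * (poly g (of_real x * w) / (of_real x * w) ^ d
      + r (of_real x * w) * inverse ((of_real x * w) ^ d)))) \<longlongrightarrow> Re (w ^ d * (c + 0 * 0))) at_top"
    by (rule tendsto_Re)
  moreover have "\<forall>\<^sub>F x in at_top. 0 \<le> Re (w ^ d * (poly g (of_real x * w) / (of_real x * w) ^ d
      + r (of_real x * w) * inverse ((of_real x * w) ^ d)))"
    using eventually_gt_at_top[of "0::real"]
  proof eventually_elim
    case (elim x)
    have "w ^ d * (poly g (of_real x * w) / (of_real x * w) ^ d + r (of_real x * w) * inverse ((of_real x * w) ^ d))
       = (poly g (of_real x * w) + r (of_real x * w)) / of_real (x ^ d)"
      using w elim by (simp add: field_simps power_mult_distrib)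
    moreover have "Re (poly g (of_real x * w) + r (of_real x * w)) \<ge> 0"
      using w elim by (intro pos) simp
    ultimately show ?case using elim by (simp only: Re_divide_of_real) simp
  qed
  ultimately have "0 \<le> Re (w ^ d * (c + 0 * 0))"
    by (intro tendsto_lowerbound) auto
  also have "w ^ d * (c + 0 * 0) = - of_real (cmod c)" using cw by (simp add: mult.commute)
  finally show False using c by simp
qed

text \<open>Complex polarization with the test vectors \<open>e_j + e_i\<close> and
  \<open>e_j + i e_i\<close>. Complex vectors are essential, also for real \<open>M\<close>: on real
  vectors the form of a skew-symmetric matrix vanishes.\<close>

lemma zero_form_imp_zero_mat:
  fixes M :: "complex mat"
  assumes M: "M \<in> carrier_mat n n" and z: "\<And>v. v \<in> carrier_vec n \<Longrightarrow> qform M v = 0"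
  shows "M = 0\<^sub>m n n"
proof (rule eq_matI)
  fix i j assume "i < dim_row (0\<^sub>m n n)" "j < dim_col (0\<^sub>m n n)"
  hence ij: "i < n" "j < n" by auto
  define a b where "a = (unit_vec n j :: complex vec)" and "b = (unit_vec n i :: complex vec)"
  have ab: "a \<in> carrier_vec n" "b \<in> carrier_vec n" by (simp_all add: a_def b_def)
  have "qform M (a + b) = 0" "qform M (a + \<i> \<cdot>\<^sub>v b) = 0"
    using ab by (auto intro!: z)
  hence "(M *\<^sub>v a) \<bullet>c b + (M *\<^sub>v b) \<bullet>c a = 0" "(M *\<^sub>v b) \<bullet>c a - (M *\<^sub>v a) \<bullet>c b = 0"
    using ab M z[OF ab(1)] z[OF ab(2)]
    by (simp_all add: mult_vec_add_dims smult_mult_vec_dims inner_add inner_smult algebra_simps)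
  hence "(M *\<^sub>v a) \<bullet>c b = 0" by (simp add: complex_eq_iff)
  moreover have "(M *\<^sub>v a) \<bullet>c b = M $$ (i,j)"
  proof -
    have "(M *\<^sub>v a) \<bullet>c b = (\<Sum>k<n. (M *\<^sub>v a) $ k * cnj (b $ k))"
      using M ab by (subst inner_sum) auto
    also have "\<dots> = (\<Sum>k<n. if k = i then (M *\<^sub>v a) $ k else 0)"
      using ij by (intro sum.cong) (auto simp: b_def)
    finally have "(M *\<^sub>v a) \<bullet>c b = (\<Sum>k<n. if k = i then (M *\<^sub>v a) $ k else 0)" .
    thus ?thesis using M ij by (simp add: a_def)
  qed
  ultimately show "M $$ (i,j) = 0\<^sub>m n n $$ (i,j)" using ij by simp
qed (use M in auto)

lemma mat_diff_eq_iff: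
  fixes A :: "'a :: ring mat"
  assumes "A \<in> carrier_mat r c" "B \<in> carrier_mat r c" "C \<in> carrier_mat r c"
  shows "A - C = B \<longleftrightarrow> A = B + C"
  using assms by (auto simp: mat_eq_iff diff_eq_eq)

section \<open>Consequences of the two objectives\<close>

context descriptor_system
begin

lemma closed_loop_det:
  assumes K: "K \<in> carrier_mat m m" and st: "stability_objective E A B C D K" and z: "Re z \<ge> 0"
  shows "det (z \<cdot>\<^sub>m E - (A + B * minv (1\<^sub>m m - K * D) * K * C)) \<noteq> 0"
proof -
  let ?A = "A + B * minv (1\<^sub>m m - K * D) * K * C"
  have c: "z \<cdot>\<^sub>m E - ?A \<in> carrier_mat n n" by (intro minus_carrier_mat add_carrier_mat) auto
  have "dim_row K = m" using K by simp
  hence "\<not> pair_eigenvalue E ?A z"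
    using st z by (auto simp: stability_objective_def stable_pair_def)
  thus ?thesis unfolding det_nonzero_iff_kernel[OF c] by (auto simp: pair_eigenvalue_def)
qed

text \<open>Feedback enters through \<open>B\<close> and \<open>C\<close>, so a left vector killed
  by \<open>B'\<close> or a right vector killed by \<open>C\<close> does not see it and stays in the
  kernel of the closed-loop pencil.\<close>

lemma hidden_modes_if_stable:
  assumes K: "K \<in> carrier_mat m m" and dK: "det (1\<^sub>m m - K * D) \<noteq> 0"
    and st: "stability_objective E A B C D K"
  shows "hidden_modes_condition n m E A B C"
  unfolding hidden_modes_condition_def
proof (intro allI impI, rule ccontr)
  fix z assume h: "uncontrollable_ev n m E A B z \<or> unobservable_ev n m E A C z" and "\<not> Re z < 0"
  hence z: "Re z \<ge> 0" by simp
  define S where "S = minv (1\<^sub>m m - K * D)"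
  have K1: "1\<^sub>m m - K * D \<in> carrier_mat m m" by (rule minus_carrier_mat[OF mult_carrier_mat[OF K D]])
  have S: "S \<in> carrier_mat m m" unfolding S_def by (rule minv(1)[OF K1 dK])
  define M where "M = z \<cdot>\<^sub>m E - A"
  define T where "T = z \<cdot>\<^sub>m E - (A + B * S * K * C)"
  have M: "M \<in> carrier_mat n n" using A by (simp add: M_def minus_carrier_mat)
  have T: "T = M - B * S * K * C" using S K by (intro eq_matI) (auto simp: T_def M_def)
  have cT: "T \<in> carrier_mat n n" unfolding T using M by (intro minus_carrier_mat) auto
  have d: "det T \<noteq> 0" using closed_loop_det[OF K st z] by (simp add: T_def S_def)
  from h show False
  proof
    assume "uncontrollable_ev n m E A B z"
    then obtain x where x: "x \<in> carrier_vec n" "x \<noteq> 0\<^sub>v n" "mat_adjoint M *\<^sub>v x = 0\<^sub>v n" "mat_adjoint B *\<^sub>v x = 0\<^sub>v m"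
      using uncontrollable_ev_iff[OF E A B] by (auto simp: M_def)
    have "mat_adjoint T = mat_adjoint M - mat_adjoint (S * K * C) * mat_adjoint B"
      unfolding T using M S K by (simp add: mat_adjoint_minus mat_adjoint_mult mult_assoc_dims)
    hence "mat_adjoint T *\<^sub>v x = mat_adjoint M *\<^sub>v x - mat_adjoint (S * K * C) *\<^sub>v (mat_adjoint B *\<^sub>v x)"
      using M S K x(1) by (simp add: minus_mult_vec_dims mult_vec_assoc_dims)
    also have "mat_adjoint (S * K * C) *\<^sub>v (mat_adjoint B *\<^sub>v x) = 0\<^sub>v n" unfolding x(4) using S by simp
    also have "mat_adjoint M *\<^sub>v x - 0\<^sub>v n = 0\<^sub>v n" unfolding x(3) by (intro eq_vecI) auto
    finally show False
      using det_mat_adjoint_nonzero[OF cT d] det_nonzero_iff_kernel[OF mat_adjoint_carrier[OF cT]] x(1,2) by blast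
  next
    assume "unobservable_ev n m E A C z"
    then obtain v where v: "v \<in> carrier_vec n" "v \<noteq> 0\<^sub>v n" "M *\<^sub>v v = 0\<^sub>v n" "C *\<^sub>v v = 0\<^sub>v m"
      using unobservable_ev_iff[OF E A C] by (auto simp: M_def)
    have "T *\<^sub>v v = M *\<^sub>v v - (B * S * K) *\<^sub>v (C *\<^sub>v v)"
      unfolding T using M S K v(1) by (simp add: minus_mult_vec_dims mult_vec_assoc_dims)
    also have "(B * S * K) *\<^sub>v (C *\<^sub>v v) = 0\<^sub>v n" unfolding v(4) using K S by simp
    also have "M *\<^sub>v v - 0\<^sub>v n = 0\<^sub>v n" unfolding v(3) by (intro eq_vecI) auto
    finally show False using det_nonzero_iff_kernel[OF cT] d v(1,2) by blast
  qed
qed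

text \<open>The equation for \<open>T\<close> describes a loop with plant input \<open>U\<close> and
  state \<open>X\<close>. Resolving the feedthrough loop by \<open>S\<close> recovers the state
  equation \<open>M X = B S\<close>, whose closed-loop pencil \<open>M\<close> is invertible at
  \<open>z\<close> by stability; so \<open>X\<close>, then \<open>U\<close> and \<open>T\<close>,
  are regular there.\<close>

lemma closed_loop_regular:
  assumes K: "K \<in> carrier_mat m m" and dK: "det (1\<^sub>m m - K * D) \<noteq> 0"
    and st: "stability_objective E A B C D K" and z: "Re z \<ge> 0"
    and T: "T \<in> carrier_mat m m" and eq: "T = G * (1\<^sub>m m + const_rm K * T)"
  shows "T \<in> mats (regular_at z) m m"
proof -
  define S where "S = minv (1\<^sub>m m - K * D)"
  have K1: "1\<^sub>m m - K * D \<in> carrier_mat m m" by (rule minus_carrier_mat[OF mult_carrier_mat[OF K D]])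
  note S = minv[OF K1 dK, folded S_def]
  have [simp]: "dim_row K = m" "dim_col K = m" "dim_row S = m" "dim_col S = m" "dim_row T = m" "dim_col T = m"
    using K S T by auto
  define U where "U = 1\<^sub>m m + const_rm K * T"
  define X where "X = minv pencil * const_rm B * U"
  have [simp]: "dim_row U = m" "dim_col U = m" "dim_row X = n" "dim_col X = m" by (auto simp: U_def X_def)
  have TX: "T = const_rm C * X + const_rm D * U"
    by (subst eq) (simp add: G_eq X_def U_def[symmetric] add_mult_dims mult_assoc_dims)
  have KT: "const_rm K * T = const_rm K * const_rm C * X + const_rm (K * D) * U"
    by (subst TX) (simp add: mult_add_dims mult_assoc_dims const_rm_mult)
  have "const_rm (1\<^sub>m m - K * D) * U = U - const_rm (K * D) * U"
    by (simp add: const_rm_minus const_rm_one minus_mult_dims mult_one_dims)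
  also have "\<dots> = 1\<^sub>m m + const_rm K * const_rm C * X"
  proof -
    define Y V where "Y = const_rm K * const_rm C * X" and "V = const_rm (K * D) * U"
    have "Y \<in> carrier_mat m m" "V \<in> carrier_mat m m" by (auto simp: Y_def V_def)
    moreover have "U = 1\<^sub>m m + (Y + V)" by (rule U_def[unfolded KT, folded Y_def V_def])
    ultimately have "U - V = 1\<^sub>m m + Y" by (auto intro!: eq_matI)
    thus ?thesis by (simp only: Y_def V_def)
  qed
  finally have "const_rm S * (const_rm (1\<^sub>m m - K * D) * U) = const_rm S * (1\<^sub>m m + const_rm K * const_rm C * X)" by simp
  moreover have "const_rm S * (const_rm (1\<^sub>m m - K * D) * U) = const_rm (S * (1\<^sub>m m - K * D)) * U"
    by (simp add: const_rm_mult mult_assoc_dims)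
  ultimately have US: "U = const_rm S * (1\<^sub>m m + const_rm K * const_rm C * X)"
    by (simp add: S const_rm_one mult_one_dims)
  define W where "W = const_rm (B * S * K * C)"
  define M where "M = pencil - W"
  have W: "W \<in> carrier_mat n n" by (auto simp: W_def)
  have Wr: "W \<in> mats (regular_at z) n n" unfolding W_def by (intro const_rm_regular) auto
  have M: "M \<in> mats (regular_at z) n n" unfolding M_def by (rule regular_at.mats_minus[OF pencil(2) Wr])
  have "eval_rm M z = z \<cdot>\<^sub>m E - A - B * S * K * C"
    unfolding M_def eval_rm_minus[OF pencil(2) Wr] by (simp add: pencil(3) W_def)
  also have "\<dots> = z \<cdot>\<^sub>m E - (A + B * S * K * C)" by (intro eq_matI) auto
  finally have dM: "det (eval_rm M z) \<noteq> 0" using closed_loop_det[OF K st z] by (simp add: S_def)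
  note mM = minv[OF mats_carrier[OF M] det_nonzero_eval[OF M dM]]
  have "pencil * X = const_rm B * U"
    by (simp add: X_def minv_pencil mult_one_dims flip: mult_assoc_dims)
  also have "\<dots> = const_rm (B * S) + W * X"
    by (subst US) (simp add: W_def mult_add_dims mult_assoc_dims const_rm_mult mult_one_dims)
  finally have MX: "M * X = const_rm (B * S)"
    using W unfolding M_def by (subst minus_mult_dims) (auto simp: mat_diff_eq_iff[of _ n m])
  have "X = minv M * (M * X)"
    using mM(1) M by (subst mult_assoc_dims[symmetric]) (auto simp: mM(3) mult_one_dims mats_dim)
  also have "\<dots> \<in> mats (regular_at z) n m"
    unfolding MX by (intro regular_at.mats_mult[OF eval_rm_minv(1)[OF M dM]] const_rm_regular) auto
  finally have X: "X \<in> mats (regular_at z) n m" .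
  have c: "const_rm Y \<in> mats (regular_at z) (dim_row Y) (dim_col Y)" for Y by (rule const_rm_regular) auto
  have KC: "const_rm K * const_rm C \<in> mats (regular_at z) m n"
    using regular_at.mats_mult[of "const_rm K" z m m "const_rm C" n] c[of K] c[of C] by simp
  have "U \<in> mats (regular_at z) m m"
    unfolding US
    by (rule regular_at.mats_mult[OF _ regular_at.mats_add[OF regular_at.mats_one regular_at.mats_mult[OF KC X]]])
      (use c[of S] in simp)
  thus ?thesis
    by (subst TX, intro regular_at.mats_add regular_at.mats_mult[OF _ X] regular_at.mats_mult[of "const_rm D" z m m])
      (use c[of C] c[of D] in simp_all)
qed

text \<open>Regularity has to precede positivity, because strict positive realness constrains a
  function only off its poles; stability excludes poles of \<open>T = (1 - GK)^-1 G\<close> from the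
  closed right half plane. The last claim is positivity of \<open>L T(z)\<close> at
  \<open>x = T(z)^-1 y\<close>, as \<open>Z - K = T^-1\<close>.\<close>

lemma necessary_facts:
  assumes K: "K \<in> carrier_mat m m" and L: "L \<in> carrier_mat m m" and dK: "det (1\<^sub>m m - K * D) \<noteq> 0"
    and ach: "achieves E A B C D K L"
  shows "det G \<noteq> 0" "det L \<noteq> 0" "\<And>z. Re z \<ge> 0 \<Longrightarrow> Z \<in> mats (regular_at z) m m"
    "\<And>z y. Re z \<ge> 0 \<Longrightarrow> y \<in> carrier_vec m \<Longrightarrow> Re (((eval_rm Z z - K) *\<^sub>v y) \<bullet>c (L *\<^sub>v y)) \<ge> 0"
proof -
  have [simp]: "dim_row K = m" "dim_col K = m" "dim_row L = m" "dim_col L = m" using K L by auto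
  have st: "stability_objective E A B C D K" and spr: "spr_objective G K L"
    using ach by (auto simp: achieves_def G_def)
  define V where "V = 1\<^sub>m m - G * const_rm K"
  have V: "V \<in> carrier_mat m m" unfolding V_def by (intro minus_carrier_mat mult_carrier_mat[OF G]) (simp add: K)
  have dV: "det V \<noteq> 0" using spr invertible_mat_iff_det[OF V] by (simp add: spr_objective_def V_def)
  note mV = minv[OF V dV]
  define T where "T = minv V * G"
  have T: "T \<in> carrier_mat m m" using mV G by (simp add: T_def)
  have [simp]: "dim_row T = m" "dim_col T = m" "dim_row V = m" "dim_col V = m" using T V by auto
  have VT: "V * T = G"
    unfolding T_def using mV(1) by (subst mult_assoc_dims[symmetric]) (auto simp: mV(2) mult_one_dims)
  have "V * T = T - G * (const_rm K * T)"
    by (simp add: V_def minus_mult_dims mult_assoc_dims mult_one_dims)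
  hence "T - G * (const_rm K * T) = G" using VT by simp
  moreover have cK: "const_rm K \<in> carrier_mat m m" using K by simp
  ultimately have "T = G + G * (const_rm K * T)"
    using iffD1[OF mat_diff_eq_iff[OF T G mult_carrier_mat[OF G mult_carrier_mat[OF cK T]]]] by blast
  also have "\<dots> = G * (1\<^sub>m m + const_rm K * T)" by (simp add: mult_add_dims mult_one_dims)
  finally have eq: "T = G * (1\<^sub>m m + const_rm K * T)" .
  have Tr: "T \<in> mats (regular_at z) m m" if "Re z \<ge> 0" for z
    by (rule closed_loop_regular[OF K dK st that T eq])
  note Lr = const_rm_regular[OF L]
  have pos: "pos_def (L * eval_rm T z + mat_adjoint (L * eval_rm T z))" if z: "Re z \<ge> 0" for z
  proof -
    define H where "H = const_rm L * T"
    have "strictly_positive_real H"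
      using spr V mV(1) by (simp add: spr_objective_def V_def[symmetric] H_def T_def mult_assoc_dims)
    moreover have Hr: "H \<in> mats (regular_at z) m m" unfolding H_def by (rule regular_at.mats_mult[OF Lr Tr[OF z]])
    hence "\<not> pole_rm H z" by (rule regular_not_pole)
    ultimately have "pos_def (eval_rm H z + mat_adjoint (eval_rm H z))"
      using z by (force simp: strictly_positive_real_def)
    thus ?thesis by (simp add: H_def eval_rm_mult[OF Lr Tr[OF z]])
  qed
  have posx: "Re ((L *\<^sub>v (eval_rm T z *\<^sub>v x)) \<bullet>c x) > 0" if z: "Re z \<ge> 0" and x: "x \<in> carrier_vec m" "x \<noteq> 0\<^sub>v m" for x z
  proof -
    define H where "H = L * eval_rm T z"
    have H: "H \<in> carrier_mat m m" and HH: "H + mat_adjoint H \<in> carrier_mat m m" by (auto simp: H_def)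
    have "Re (qform H x) > 0"
      using pos[OF z, folded H_def] x Re_form_add_adjoint[OF H x(1)] by (auto simp: pos_def_iff[OF HH])
    thus ?thesis using x by (simp add: H_def mult_vec_assoc_dims)
  qed
  have dLT: "det (L * eval_rm T z) \<noteq> 0" if z: "Re z \<ge> 0" for z
  proof (rule form_nonzero_det)
    show "L * eval_rm T z \<in> carrier_mat m m" by auto
    fix v :: "complex vec" assume v: "v \<in> carrier_vec m" "v \<noteq> 0\<^sub>v m"
    have "L * eval_rm T z *\<^sub>v v = L *\<^sub>v (eval_rm T z *\<^sub>v v)" using v by (intro mult_vec_assoc_dims) auto
    thus "qform (L * eval_rm T z) v \<noteq> 0" using posx[OF z v] by auto
  qed
  have cTz: "eval_rm T z \<in> carrier_mat m m" for z using T by simp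
  have dd: "det L \<noteq> 0 \<and> det (eval_rm T z) \<noteq> 0" if z: "Re z \<ge> 0" for z
    using dLT[OF z] det_mult[OF L cTz] by auto
  \<comment> \<open>The point 0 serves as a sample of the closed right half plane.\<close>
  show dL: "det L \<noteq> 0" using dd[of 0] by simp
  have dT: "det T \<noteq> 0" using det_nonzero_eval[OF Tr, of 0] dd[of 0] by simp
  show dG: "det G \<noteq> 0" unfolding VT[symmetric] using det_mult[OF V T] dV dT by simp
  note Zm = minv[OF G dG, folded Z_def] and mT = minv[OF T dT]
  have [simp]: "dim_row Z = m" "dim_col Z = m" "dim_row (minv T) = m" "dim_col (minv T) = m" using Zm(1) mT(1) by auto
  have "Z * T = Z * G * (1\<^sub>m m + const_rm K * T)"
    by (subst eq) (simp add: mult_assoc_dims)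
  hence "Z * T * minv T = (1\<^sub>m m + const_rm K * T) * minv T"
    by (simp add: Zm mult_one_dims)
  hence Z: "Z = minv T + const_rm K"
    by (simp add: mult_assoc_dims mT add_mult_dims mult_one_dims)
  have mTr: "minv T \<in> mats (regular_at z) m m" and mTe: "eval_rm (minv T) z = minv (eval_rm T z)" if z: "Re z \<ge> 0" for z
    using eval_rm_minv[OF Tr[OF z]] dd[OF z] by auto
  note Kr = const_rm_regular[OF K]
  show "Z \<in> mats (regular_at z) m m" if z: "Re z \<ge> 0" for z
    unfolding Z by (rule regular_at.mats_add[OF mTr[OF z] Kr])
  fix z :: complex and y :: "complex vec" assume z: "Re z \<ge> 0" and y: "y \<in> carrier_vec m"
  note mTz = minv[OF cTz conjunct2[OF dd[OF z]]]
  have "eval_rm Z z = minv (eval_rm T z) + K"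
    unfolding Z eval_rm_add[OF mTr[OF z] Kr] by (simp add: mTe[OF z])
  hence ZK: "eval_rm Z z - K = minv (eval_rm T z)"
    using mTz(1) by (auto intro!: eq_matI)
  define x where "x = minv (eval_rm T z) *\<^sub>v y"
  have x: "x \<in> carrier_vec m" using mTz(1) by (auto simp: x_def intro: carrier_vecI)
  have "eval_rm T z *\<^sub>v x = (eval_rm T z * minv (eval_rm T z)) *\<^sub>v y"
    unfolding x_def using mTz(1) y by (intro mult_vec_assoc_dims[symmetric]) auto
  hence yx: "y = eval_rm T z *\<^sub>v x" using y by (simp add: mTz mult_one_dims)
  have "x \<bullet>c (L *\<^sub>v y) = cnj ((L *\<^sub>v y) \<bullet>c x)" using x by (intro inner_cnj[symmetric]) auto
  moreover have "Re ((L *\<^sub>v y) \<bullet>c x) \<ge> 0"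
  proof (cases "x = 0\<^sub>v m")
    case True
    have "(L *\<^sub>v y) \<bullet>c 0\<^sub>v m = 0" by (rule inner_zero_dims) simp
    thus ?thesis by (simp only: True zero_complex.sel order_refl)
  next
    case False
    show ?thesis unfolding yx using posx[OF z x False] by simp
  qed
  ultimately show "Re (((eval_rm Z z - K) *\<^sub>v y) \<bullet>c (L *\<^sub>v y)) \<ge> 0"
    unfolding ZK x_def[symmetric] by simp
qed

end

section \<open>The form of the inverse over the base field\<close>

lemma (in descriptor_system) inverse_over:
  assumes F: "F = \<real> \<or> F = UNIV"
    and mats: "E \<in> mats F n n" "A \<in> mats F n n" "B \<in> mats F n m" "C \<in> mats F m n" "D \<in> mats F m m"
    and dG: "det G \<noteq> 0"
  shows "Z \<in> mats (ratfun_over F) m m"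
proof -
  note sF = closed_subring_F[OF F]
  interpret closed_subring "ratfun_over F" by (rule closed_subring_ratfun_over[OF sF])
  note c = const_rm_ratfun[OF sF]
  have p: "pencil \<in> mats (ratfun_over F) n n"
    unfolding pencil_def by (rule mats_minus[OF mats_smult[OF s_rm_ratfun[OF sF] c[OF mats(1)]] c[OF mats(2)]])
  have "minv pencil \<in> mats (ratfun_over F) n n"
    using pencil_det by (intro mats_minv[OF closed_subring_axioms p] ratfun_over_inverse[OF sF] det_closed[OF p])
      (simp add: pencil_def)
  hence G: "G \<in> mats (ratfun_over F) m m"
    unfolding G_eq using c[OF mats(3)] c[OF mats(4)] c[OF mats(5)] by (intro mats_add mats_mult[of _ _ n])
  show ?thesis
    unfolding Z_def by (intro mats_minv[OF closed_subring_axioms G dG] ratfun_over_inverse[OF sF] det_closed[OF G])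
qed

text \<open>Constant test vectors reduce the degree bound to the scalar case: for each
  \<open>v\<close>, the function \<open>v' L' (Z(z) - K) v\<close> is a polynomial plus a part
  vanishing at infinity, with non-negative real part on the closed right half plane. Since
  \<open>v\<close> is an arbitrary complex vector, \<open>L'\<close> times each coefficient matrix
  of order two or more is zero, and \<open>L'\<close> cancels.\<close>

lemma (in descriptor_system) necessity:
  assumes F: "F = \<real> \<or> F = UNIV"
    and mats: "E \<in> mats F n n" "A \<in> mats F n n" "B \<in> mats F n m" "C \<in> mats F m n" "D \<in> mats F m m"
    and K: "K \<in> carrier_mat m m" and L: "L \<in> carrier_mat m m" and dK: "det (1\<^sub>m m - K * D) \<noteq> 0"
    and ach: "achieves E A B C D K L"
  shows "inverse_condition F m G"
proof -
  note nec = necessary_facts[OF K L dK ach]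
  have ZF: "Z \<in> mats (ratfun_over F) m m" by (rule inverse_over[OF F mats nec(1)])
  have cZ: "Z \<in> carrier_mat m m" by (rule mats_carrier[OF ZF])
  obtain q P R where q: "lead_coeff q = 1" "q \<in> poly_over F"
    "\<And>z. Z \<in> mats (regular_at z) m m \<Longrightarrow> poly q z \<noteq> 0"
    and PR: "\<And>i j. i < m \<Longrightarrow> j < m \<Longrightarrow> P i j \<in> poly_over F \<and> R i j \<in> poly_over F \<and>
      (R i j = 0 \<or> degree (R i j) < degree q) \<and>
      Z $$ (i,j) = to_fract (P i j) + to_fract (R i j) / to_fract q"
    using common_denominator[OF F ZF] by blast
  have roots: "poly q z \<noteq> 0" if "Re z \<ge> 0" for z using q(3) nec(3)[OF that] by blast
  hence roots': "Re z < 0" if "poly q z = 0" for z using that not_le by blast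
  have Ze: "eval_rf (Z $$ (i,j)) z = poly (P i j) z + poly (R i j) z / poly q z"
    if "i < m" "j < m" "Re z \<ge> 0" for i j z
  proof -
    note R = regular_at_quotient[OF refl roots[OF that(3)], of "R i j"]
    show ?thesis using PR[OF that(1,2)] eval_rf_add[OF regular_at_to_fract(1) R(1)] R(2)
      by (simp add: regular_at_to_fract)
  qed
  define M where "M l = mat m m (\<lambda>(i,j). coeff (P i j) l)" for l
  have M: "M l \<in> carrier_mat m m" for l by (simp add: M_def)
  have M0: "M l = 0\<^sub>m m m" if l: "l \<ge> 2" for l
  proof -
    have LM: "mat_adjoint L * M l \<in> carrier_mat m m" by (rule mult_carrier_mat[OF mat_adjoint_carrier[OF L] M])
    have "mat_adjoint L * M l = 0\<^sub>m m m"
    proof (rule zero_form_imp_zero_mat[OF LM])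
      fix v :: "complex vec" assume v: "v \<in> carrier_vec m"
      define b where "b i j = v $ j * cnj ((L *\<^sub>v v) $ i)" for i j
      define k where "k = (K *\<^sub>v v) \<bullet>c (L *\<^sub>v v)"
      \<comment> \<open>The constant \<open>k\<close> from the gain changes only the coefficient of
        order zero, while \<open>l\<close> is at least 2.\<close>
      define g where "g = (\<Sum>i<m. \<Sum>j<m. Polynomial.smult (b i j) (P i j)) - [:k:]"
      define r where "r z = (\<Sum>i<m. \<Sum>j<m. b i j * (poly (R i j) z / poly q z))" for z
      have form: "(X *\<^sub>v v) \<bullet>c (L *\<^sub>v v) = (\<Sum>i<m. \<Sum>j<m. b i j * X $$ (i,j))" if "X \<in> carrier_mat m m" for X
        using that L v by (simp add: inner_sum scalar_prod_def sum_distrib_right atLeast0LessThan b_def ac_simps)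
      have "Re (poly g z + r z) \<ge> 0" if z: "Re z \<ge> 0" for z
      proof -
        have "(eval_rm Z z *\<^sub>v v) \<bullet>c (L *\<^sub>v v)
            = (\<Sum>i<m. \<Sum>j<m. b i j * poly (P i j) z + b i j * (poly (R i j) z / poly q z))"
          using cZ by (subst form) (auto intro!: sum.cong simp: Ze[OF _ _ z] distrib_left)
        hence "poly g z + r z = (eval_rm Z z *\<^sub>v v) \<bullet>c (L *\<^sub>v v) - k"
          by (simp add: g_def r_def poly_sum sum.distrib)
        also have "\<dots> = ((eval_rm Z z - K) *\<^sub>v v) \<bullet>c (L *\<^sub>v v)"
          using cZ K L v by (subst minus_mult_vec_dims) (auto simp: k_def inner_add)
        finally show ?thesis using nec(4)[OF z v] by simp
      qed
      moreover have "(r \<longlongrightarrow> 0) at_infinity"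
      proof -
        have "((\<lambda>z. poly (R i j) z / poly q z) \<longlongrightarrow> 0) at_infinity" if "i < m" "j < m" for i j
          using PR[OF that] by (auto intro: poly_divide_tendsto_0_at_infinity)
        hence "((\<lambda>z. \<Sum>i<m. \<Sum>j<m. b i j * (poly (R i j) z / poly q z)) \<longlongrightarrow> (\<Sum>i<m. \<Sum>j<m. b i j * 0)) at_infinity"
          by (intro tendsto_sum tendsto_mult_left) auto
        thus ?thesis by (simp add: r_def[abs_def])
      qed
      ultimately have "degree g \<le> 1" using positive_real_degree by blast
      hence "coeff g l = 0" using l by (intro coeff_eq_0) simp
      moreover have "coeff g l = (M l *\<^sub>v v) \<bullet>c (L *\<^sub>v v)"
        using l by (subst form[OF M]) (auto simp: g_def M_def coeff_sum coeff_pCons split: nat.splits)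
      ultimately show "qform (mat_adjoint L * M l) v = 0"
        using M L v by (simp add: mult_vec_assoc_dims inner_mat_adjoint M_def)
    qed
    moreover have dL: "det (mat_adjoint L) \<noteq> 0" by (rule det_mat_adjoint_nonzero[OF L nec(2)])
    note mL = minv[OF mat_adjoint_carrier[OF L] dL]
    have "M l = minv (mat_adjoint L) * (mat_adjoint L * M l)"
      using mL(1) M[of l] L by (subst mult_assoc_dims[symmetric]) (auto simp: mL(3) mult_one_dims)
    ultimately show ?thesis using mL(1) by (auto simp: right_mult_zero_mat)
  qed
  have P1: "coeff (P i j) l = 0" if "i < m" "j < m" "l \<ge> 2" for i j l
  proof -
    have "M l $$ (i,j) = 0" using M0[OF that(3)] that(1,2) by simp
    thus ?thesis using that(1,2) by (simp add: M_def)
  qed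
  define H1 where "H1 = M 1"
  define D2 where "D2 = M 0"
  have HF: "H1 \<in> mats F m m" "D2 \<in> mats F m m"
    using PR by (auto simp: H1_def D2_def M_def mats_iff poly_over_def)
  obtain k A2 B2 C2 where abc: "A2 \<in> mats F k k" "B2 \<in> mats F k m" "C2 \<in> mats F m k" "hurwitz A2"
    "strictly_proper_rm A2 B2 C2 = mat m m (\<lambda>(i,j). to_fract (R i j) / to_fract q)"
    by (rule strictly_proper_realization[OF closed_subring_F[OF F] q(1,2) roots', of m R]) (use PR in auto)
  have Zeq: "Z = s_rm \<cdot>\<^sub>m const_rm H1 + const_rm D2 + strictly_proper_rm A2 B2 C2"
  proof (rule eq_matI)
    fix i j assume "i < dim_row (s_rm \<cdot>\<^sub>m const_rm H1 + const_rm D2 + strictly_proper_rm A2 B2 C2)"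
      "j < dim_col (s_rm \<cdot>\<^sub>m const_rm H1 + const_rm D2 + strictly_proper_rm A2 B2 C2)"
    hence ij: "i < m" "j < m" by (auto simp: abc(5))
    have "P i j = [:coeff (P i j) 0, coeff (P i j) 1:]"
    proof (rule poly_eqI)
      fix l
      show "coeff (P i j) l = coeff [:coeff (P i j) 0, coeff (P i j) 1:] l"
        using P1[OF ij, of l] by (cases l; cases "l - 1") (auto simp: coeff_pCons split: nat.splits)
    qed
    also have "\<dots> = [:coeff (P i j) 0:] + [:0,1:] * [:coeff (P i j) 1:]" by simp
    finally have "to_fract (P i j) = to_fract [:coeff (P i j) 0:] + s_rm * to_fract [:coeff (P i j) 1:]"
      by (metis to_fract_add to_fract_mult s_rm_def)
    thus "Z $$ (i,j) = (s_rm \<cdot>\<^sub>m const_rm H1 + const_rm D2 + strictly_proper_rm A2 B2 C2) $$ (i,j)"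
      using ij PR[OF ij] by (simp add: abc(5) H1_def D2_def M_def)
  qed (use cZ in \<open>auto simp: abc(5)\<close>)
  show ?thesis
    unfolding inverse_condition_def
  proof (intro conjI bexI)
    show "invertible_mat G" using invertible_mat_iff_det[OF G] nec(1) by simp
    show "minv G = s_rm \<cdot>\<^sub>m const_rm H1 + const_rm D2 + strictly_proper_rm A2 B2 C2"
      using Zeq by (simp add: Z_def)
    show "strictly_proper_rm A2 B2 C2 = 0\<^sub>m m m \<or> (\<exists>k. \<exists>A2' \<in> mats F k k. \<exists>B2' \<in> mats F k m. \<exists>C2' \<in> mats F m k.
       hurwitz A2' \<and> strictly_proper_rm A2 B2 C2 = strictly_proper_rm A2' B2' C2')"
      using abc by blast
    show "strictly_proper_rm A2 B2 C2 \<in> carrier_mat m m" by (simp add: abc(5))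
  qed (use HF in auto)
qed

section \<open>Sufficiency for all admissible choices, and the case without state\<close>

lemma (in descriptor_system) sufficiency:
  assumes F: "F = \<real> \<or> F = UNIV"
    and inv: "invertible_mat G" and hid: "hidden_modes_condition n m E A B C"
    and H1: "H1 \<in> mats F m m" and D2: "D2 \<in> mats F m m"
    and A2: "A2 \<in> mats F k k" and B2: "B2 \<in> mats F k m" and C2: "C2 \<in> mats F m k"
    and h: "hurwitz A2"
    and Geq: "minv G = s_rm \<cdot>\<^sub>m const_rm H1 + const_rm D2 + strictly_proper_rm A2 B2 C2"
    and L: "admissible_L F m H1 L" and Q: "Q \<in> mats F k k" "pos_def Q"
  shows "\<exists>!P. lyapunov_solution F k A2 Q P"
    "\<forall>P. lyapunov_solution F k A2 Q P \<longrightarrow>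
      (\<exists>N. admissible_N F m D D2 L (riccati_bound B2 C2 L P Q) N) \<and>
      (\<forall>N. admissible_N F m D D2 L (riccati_bound B2 C2 L P Q) N \<longrightarrow> achieves E A B C D (gain D2 L N) L)"
proof -
  show "\<exists>!P. lyapunov_solution F k A2 Q P" by (rule lyapunov_solution_field(1)[OF F A2 h Q])
next
  show "\<forall>P. lyapunov_solution F k A2 Q P \<longrightarrow>
      (\<exists>N. admissible_N F m D D2 L (riccati_bound B2 C2 L P Q) N) \<and>
      (\<forall>N. admissible_N F m D D2 L (riccati_bound B2 C2 L P Q) N \<longrightarrow> achieves E A B C D (gain D2 L N) L)"
  proof (intro allI impI conjI)
    fix P assume P: "lyapunov_solution F k A2 Q P"
    have LF: "L \<in> mats F m m" using L by (simp add: admissible_L_def)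
    note c = mats_carrier[OF H1] mats_carrier[OF D2] mats_carrier[OF A2] mats_carrier[OF B2] mats_carrier[OF C2]
      mats_carrier[OF LF] mats_carrier[OF Q(1)]
    have dL: "det L \<noteq> 0" and psd: "pos_semidef (mat_adjoint L * H1)"
      using L invertible_mat_iff_det[OF c(6)] by (auto simp: admissible_L_def)
    have dG: "det G \<noteq> 0" using inv invertible_mat_iff_det[OF G] by simp
    have Pc: "P \<in> carrier_mat k k" and Pl: "P * A2 + mat_adjoint A2 * P + Q = 0\<^sub>m k k"
      using P by (auto simp: lyapunov_solution_def mats_carrier)
    note lF = lyapunov_solution_field[OF F A2 h Q]
    have dQ: "det Q \<noteq> 0" and Qh: "mat_adjoint Q = Q" using pos_def_det[OF c(7) Q(2)] Q(2) by (auto simp: pos_def_iff[OF c(7)])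
    note mQ = minv[OF c(7) dQ]
    define X where "X = P * B2 - mat_adjoint C2 * L"
    have X: "X \<in> carrier_mat k m" unfolding X_def by (rule minus_carrier_mat[OF mult_carrier_mat[OF mat_adjoint_carrier[OF c(5)] c(6)]])
    have W: "riccati_bound B2 C2 L P Q = mat_adjoint X * minv Q * X" by (simp add: riccati_bound_def X_def)
    have "mat_adjoint (minv Q) = minv Q" using mat_adjoint_minv[OF c(7) dQ] Qh by simp
    hence "mat_adjoint (riccati_bound B2 C2 L P Q) = riccati_bound B2 C2 L P Q"
      unfolding W using X mQ(1) by (simp add: mat_adjoint_mult mult_assoc_dims)
    moreover have "riccati_bound B2 C2 L P Q \<in> carrier_mat m m" unfolding W using X mQ(1) by auto
    ultimately show "\<exists>N. admissible_N F m D D2 L (riccati_bound B2 C2 L P Q) N"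
      by (intro exists_admissible_N[OF F D D2 LF dL])
    fix N assume "admissible_N F m D D2 L (riccati_bound B2 C2 L P Q) N"
    hence N: "N \<in> mats F m m" "invertible_mat (1\<^sub>m m - gain D2 L N * D)"
      "pos_def (N + mat_adjoint N - riccati_bound B2 C2 L P Q)" by (auto simp: admissible_N_def)
    have "gain D2 L N \<in> carrier_mat m m" unfolding gain_def
      by (rule minus_carrier_mat[OF mult_carrier_mat[OF mat_adjoint_carrier[OF minv(1)[OF c(6) dL]] mats_carrier[OF N(1)]]])
    hence "1\<^sub>m m - gain D2 L N * D \<in> carrier_mat m m" by (intro minus_carrier_mat mult_carrier_mat[OF _ D])
    hence dK: "det (1\<^sub>m m - gain D2 L N * D) \<noteq> 0" using N(2) invertible_mat_iff_det by blast
    show "achieves E A B C D (gain D2 L N) L"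
      by (rule achieves_gain[OF dG hid c(1,2,3,4,5) Geq[folded Z_def] c(6) dL psd Pc lF(2)[OF P] lF(3)[OF P] c(7) Q(2) Pl
            mats_carrier[OF N(1)] N(3) dK])
  qed
qed

text \<open>A vanishing strictly proper part is the case of state dimension zero.\<close>

lemma strictly_proper_rm_empty:
  "strictly_proper_rm (0\<^sub>m 0 0) (0\<^sub>m 0 m) (0\<^sub>m m 0) = 0\<^sub>m m m"
  by (rule eq_matI) (auto simp: strictly_proper_rm_def scalar_prod_def)

lemma empty_state_facts:
  "hurwitz (0\<^sub>m 0 0)" "pos_def (0\<^sub>m 0 0)" "lyapunov_solution F 0 (0\<^sub>m 0 0) (0\<^sub>m 0 0) (0\<^sub>m 0 0)"
  "0\<^sub>m 0 r \<in> mats F 0 r" "0\<^sub>m r 0 \<in> mats F r 0"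
  by (auto simp: hurwitz_def eigenvalue_def eigenvector_def pos_def_def mats_iff lyapunov_solution_def
      intro!: eq_matI)

lemma riccati_bound_empty:
  assumes "L \<in> carrier_mat m m"
  shows "riccati_bound (0\<^sub>m 0 m) (0\<^sub>m m 0) L (0\<^sub>m 0 0) (0\<^sub>m 0 0) = 0\<^sub>m m m"
proof -
  have "minv (0\<^sub>m 0 0 :: complex mat) \<in> carrier_mat 0 0" by (rule minv) auto
  thus ?thesis using assms by (intro eq_matI) (auto simp: riccati_bound_def scalar_prod_def)
qed

theorem theorem3:
  fixes F :: "complex set" and n m :: nat and E A B C D :: "complex mat"
  assumes "F = \<real> \<or> F = UNIV"
    and "E \<in> mats F n n" and "A \<in> mats F n n" and "B \<in> mats F n m"
    and "C \<in> mats F m n" and "D \<in> mats F m m"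
    and "det (s_rm \<cdot>\<^sub>m const_rm E - const_rm A) \<noteq> 0"
  shows
    "((\<exists>K \<in> mats F m m. \<exists>L \<in> mats F m m.
         invertible_mat (1\<^sub>m m - K * D) \<and> achieves E A B C D K L)
      \<longleftrightarrow>
      inverse_condition F m (transfer_fn E A B C D) \<and> hidden_modes_condition n m E A B C)
     \<and>
     (inverse_condition F m (transfer_fn E A B C D) \<and> hidden_modes_condition n m E A B C
      \<longrightarrow>
      (\<forall>H1 \<in> mats F m m. \<forall>D2 \<in> mats F m m.
         (minv (transfer_fn E A B C D) = s_rm \<cdot>\<^sub>m const_rm H1 + const_rm D2 \<longrightarrow>
            (\<exists>L. admissible_L F m H1 L) \<and>
            (\<forall>L. admissible_L F m H1 L \<longrightarrow>
               (\<exists>N. admissible_N F m D D2 L (0\<^sub>m m m) N) \<and>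
               (\<forall>N. admissible_N F m D D2 L (0\<^sub>m m m) N \<longrightarrow>
                  achieves E A B C D (gain D2 L N) L)))
         \<and>
         (\<forall>k. \<forall>A2 \<in> mats F k k. \<forall>B2 \<in> mats F k m. \<forall>C2 \<in> mats F m k.
            hurwitz A2 \<and>
            minv (transfer_fn E A B C D) =
              s_rm \<cdot>\<^sub>m const_rm H1 + const_rm D2 + strictly_proper_rm A2 B2 C2 \<longrightarrow>
            (\<exists>L. admissible_L F m H1 L) \<and>
            (\<forall>L. admissible_L F m H1 L \<longrightarrow>
               (\<forall>Q \<in> mats F k k. pos_def Q \<longrightarrow>
                  (\<exists>!P. lyapunov_solution F k A2 Q P) \<and>
                  (\<forall>P. lyapunov_solution F k A2 Q P \<longrightarrow>
                     (\<exists>N. admissible_N F m D D2 L (riccati_bound B2 C2 L P Q) N) \<and>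
                     (\<forall>N. admissible_N F m D D2 L (riccati_bound B2 C2 L P Q) N \<longrightarrow>
                        achieves E A B C D (gain D2 L N) L)))))))"
proof -
  note F = assms(1)
  note mats = assms(2-6)
  interpret descriptor_system n m E A B C D
    by standard (use assms in \<open>auto dest: mats_carrier\<close>)
  interpret F: closed_subring F by (rule closed_subring_F[OF F])
  define cnd where "cnd \<longleftrightarrow> inverse_condition F m G"
  define hid where "hid \<longleftrightarrow> hidden_modes_condition n m E A B C"
  have sub0: "s_rm \<cdot>\<^sub>m const_rm H1 + const_rm D2 + strictly_proper_rm (0\<^sub>m 0 0) (0\<^sub>m 0 m) (0\<^sub>m m 0)
      = s_rm \<cdot>\<^sub>m const_rm H1 + const_rm D2" if "H1 \<in> mats F m m" "D2 \<in> mats F m m" for H1 D2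
    unfolding strictly_proper_rm_empty using that
    by (intro right_add_zero_mat[of _ m m] add_carrier_mat) (simp add: mats_carrier)
  have iG: "invertible_mat G" if cnd using that by (simp add: cnd_def inverse_condition_def)
  have existsL: "\<exists>L. admissible_L F m H1 L" if "H1 \<in> mats F m m" for H1
    by (rule exists_admissible_L[OF F that])
  note case2 = sufficiency[OF F iG]
  have case1: "(\<exists>N. admissible_N F m D D2 L (0\<^sub>m m m) N) \<and>
       (\<forall>N. admissible_N F m D D2 L (0\<^sub>m m m) N \<longrightarrow> achieves E A B C D (gain D2 L N) L)"
    if "cnd" "hid" "H1 \<in> mats F m m" "D2 \<in> mats F m m" "minv G = s_rm \<cdot>\<^sub>m const_rm H1 + const_rm D2"
      "admissible_L F m H1 L" for H1 D2 L
  proof -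
    have "L \<in> carrier_mat m m" using that(6) by (auto simp: admissible_L_def mats_carrier)
    note W0 = riccati_bound_empty[OF this]
    have e: "minv G = s_rm \<cdot>\<^sub>m const_rm H1 + const_rm D2 + strictly_proper_rm (0\<^sub>m 0 0) (0\<^sub>m 0 m) (0\<^sub>m m 0)"
      using that(5) sub0[OF that(3,4)] by simp
    \<comment> \<open>State dimension zero: \<open>A2\<close>, \<open>P\<close> and \<open>Q\<close>
      are empty matrices, and the Riccati bound becomes the zero matrix of size
      \<open>m\<close>.\<close>
    show ?thesis
      using mp[OF spec[OF case2(2)[OF that(1) that(2)[unfolded hid_def] that(3,4) empty_state_facts(4,4,5,1) e that(6)
            empty_state_facts(4,2)]] empty_state_facts(3)] unfolding W0 .
  qed
  have iff: "(\<exists>K \<in> mats F m m. \<exists>L \<in> mats F m m.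
         invertible_mat (1\<^sub>m m - K * D) \<and> achieves E A B C D K L) \<longleftrightarrow> cnd \<and> hid"
  proof
    assume "\<exists>K \<in> mats F m m. \<exists>L \<in> mats F m m. invertible_mat (1\<^sub>m m - K * D) \<and> achieves E A B C D K L"
    then obtain K L where KL: "K \<in> carrier_mat m m" "L \<in> carrier_mat m m" "invertible_mat (1\<^sub>m m - K * D)"
      "achieves E A B C D K L" by (auto dest: mats_carrier)
    have "1\<^sub>m m - K * D \<in> carrier_mat m m" by (rule minus_carrier_mat[OF mult_carrier_mat[OF KL(1) D]])
    hence dK: "det (1\<^sub>m m - K * D) \<noteq> 0" using invertible_mat_iff_det KL(3) by blast
    show "cnd \<and> hid"
      using necessity[OF F mats KL(1,2) dK KL(4)] hidden_modes_if_stable[OF KL(1) dK] KL(4)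
      by (simp add: cnd_def hid_def achieves_def)
  next
    assume ih: "cnd \<and> hid"
    then obtain H1 D2 R where HD: "H1 \<in> mats F m m" "D2 \<in> mats F m m"
      and R: "minv G = s_rm \<cdot>\<^sub>m const_rm H1 + const_rm D2 + R"
      "R = 0\<^sub>m m m \<or> (\<exists>k. \<exists>A2 \<in> mats F k k. \<exists>B2 \<in> mats F k m. \<exists>C2 \<in> mats F m k.
            hurwitz A2 \<and> R = strictly_proper_rm A2 B2 C2)"
      unfolding cnd_def inverse_condition_def by blast
    have "\<exists>k. \<exists>A2 \<in> mats F k k. \<exists>B2 \<in> mats F k m. \<exists>C2 \<in> mats F m k. hurwitz A2 \<and> R = strictly_proper_rm A2 B2 C2"
      using R(2) strictly_proper_rm_empty[of m] empty_state_facts by metis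
    then obtain k A2 B2 C2 where abc: "A2 \<in> mats F k k" "B2 \<in> mats F k m" "C2 \<in> mats F m k" "hurwitz A2"
      "R = strictly_proper_rm A2 B2 C2" by blast
    obtain L where L: "admissible_L F m H1 L" using existsL[OF HD(1)] by blast
    have LF: "L \<in> mats F m m" using L by (simp add: admissible_L_def)
    have dL: "det L \<noteq> 0" using L invertible_mat_iff_det[OF mats_carrier[OF LF]] by (simp add: admissible_L_def)
    \<comment> \<open>For existence alone one positive definite \<open>Q\<close> over
      \<open>F\<close> is enough; the identity is chosen and determines \<open>P\<close>.\<close>
    note c = case2[OF conjunct1[OF ih] conjunct2[OF ih, unfolded hid_def] HD abc(1-4) R(1)[unfolded abc(5)] L F.mats_one pos_def_one]
    obtain P where "lyapunov_solution F k A2 (1\<^sub>m k) P" using c(1) by blast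
    with c(2) obtain N W where N: "admissible_N F m D D2 L W N" "achieves E A B C D (gain D2 L N) L" by blast
    have "gain D2 L N \<in> mats F m m"
      unfolding gain_def using N(1)
      by (intro F.mats_minus[OF HD(2)] F.mats_mult[OF mats_adjoint_F[OF F mats_minv_F[OF F LF dL]]])
        (simp add: admissible_N_def)
    thus "\<exists>K \<in> mats F m m. \<exists>L \<in> mats F m m. invertible_mat (1\<^sub>m m - K * D) \<and> achieves E A B C D K L"
      using N LF by (auto simp: admissible_N_def)
  qed
  show ?thesis
    unfolding G_def[symmetric] cnd_def[symmetric] hid_def[symmetric]
    apply (intro conjI[OF iff] impI ballI allI conjI)
    subgoal using existsL by blast
    subgoal using case1 by blast
    subgoal using case1 by blast
    subgoal using existsL by blast
    subgoal by (rule case2(1)) (auto simp: hid_def)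
    subgoal using case2(2) by (auto simp: hid_def)
    subgoal using case2(2) by (auto simp: hid_def)
    done
qed

end
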